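(* Let $N\ge 1$ be an integer and let $A\in GR_{N\times N}(\mathbb{T})$, that is, $A:\mathbb{T}\to\mathbb{C}^{N\times N}$ is a rational matrix function without poles on the unit circle $\mathbb{T}$ and $\det A(t)\neq 0$ for all $t\in\mathbb{T}$. Put $\tilde A(t)=A(1/t)$ for $t\in\mathbb{T}$. Then the condition numbers $\kappa(T_n(A))$ are uniformly bounded as $n\to\infty$ (i.e. there are $C<\infty$ and $n_0$ with $\kappa(T_n(A))\le C$ for all $n\ge n_0$) if and only if both operators $T(A)$ and $T(\tilde A)$ are invertible on $\ell^2_N$. If at least one of the operators $T(A)$ or $T(\tilde A)$ fails to be invertible, then there exist positive constants $c,\alpha$, independent of $n$, such that $$\kappa(T_n(A))\ge c\,e^{\alpha n}\qquad\text{for all } n\ge 1.$$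
   Context: $\mathbb{T}$ is the complex unit circle. $\ell^2_N$ is the Hilbert space of square-summable sequences $(x_0,x_1,\dots)$ with $x_j\in\mathbb{C}^N$. For a bounded measurable matrix function $A:\mathbb{T}\to\mathbb{C}^{N\times N}$ with Fourier coefficients $\hat A_k=\frac1{2\pi}\int_0^{2\pi}A(e^{i\theta})e^{-ik\theta}\,d\theta$, $T(A)=(\hat A_{j-k})_{j,k=0}^\infty$ is the (bounded) block Toeplitz operator on $\ell^2_N$, and $T_n(A)=(\hat A_{j-k})_{j,k=0}^{n-1}\in\mathbb{C}^{nN\times nN}$ is the finite block Toeplitz matrix. $\kappa(M)=\|M\|\,\|M^{-1}\|$ with the spectral norm, and $\kappa(M)=\infty$ if $M$ is not invertible. *)

theory Defs
  imports "HOL-Analysis.Analysis" "HOL-Computational_Algebra.Polynomial"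
begin

(* Matrix functions on the unit circle are functions on complex of which only the values on
   sphere 0 1 are ever used. *)
definition rational_on_circle :: "(complex \<Rightarrow> complex) \<Rightarrow> bool" where
  "rational_on_circle f \<longleftrightarrow>
     (\<exists>p q :: complex poly. \<forall>t\<in>sphere 0 1. poly q t \<noteq> 0 \<and> f t = poly p t / poly q t)"

definition GR :: "(complex \<Rightarrow> complex ^ 'N ^ 'N) set" where
  "GR = {A. (\<forall>i j. rational_on_circle (\<lambda>t. A t $ i $ j)) \<and> (\<forall>t\<in>sphere 0 1. det (A t) \<noteq> 0)}"

definition reflected :: "(complex \<Rightarrow> 'a) \<Rightarrow> complex \<Rightarrow> 'a" where
  "reflected A t = A (1 / t)"

definition fourier_coeff :: "(complex \<Rightarrow> complex ^ 'N ^ 'N) \<Rightarrow> int \<Rightarrow> complex ^ 'N ^ 'N" where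
  "fourier_coeff A k =
     (\<chi> i j. 1 / (2 * of_real pi) *
        integral {0..2 * pi} (\<lambda>\<theta>. A (exp (\<i> * of_real \<theta>)) $ i $ j * exp (- (\<i> * of_int k * of_real \<theta>))))"

(* A block matrix is a function of its block row and block column index, counted from 0.  The
   n by n block matrices are read off from the indices below n; blocks with an index \<ge> n play
   no role in the functions below that take n as an argument. *)
type_synonym 'N block_matrix = "nat \<Rightarrow> nat \<Rightarrow> complex ^ 'N ^ 'N"

definition toeplitz_array :: "(complex \<Rightarrow> complex ^ 'N ^ 'N) \<Rightarrow> 'N block_matrix" where
  "toeplitz_array A j k = fourier_coeff A (int j - int k)"

definition ell2 :: "(nat \<Rightarrow> complex ^ 'N) set" where
  "ell2 = {x. summable (\<lambda>j. (norm (x j))\<^sup>2)}"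

definition ell2_norm :: "(nat \<Rightarrow> complex ^ 'N) \<Rightarrow> real" where
  "ell2_norm x = sqrt (\<Sum>j. (norm (x j))\<^sup>2)"

definition bounded_operator_ell2 ::
    "((nat \<Rightarrow> complex ^ 'N) \<Rightarrow> (nat \<Rightarrow> complex ^ 'N)) \<Rightarrow> bool" where
  "bounded_operator_ell2 S \<longleftrightarrow>
     (\<forall>x\<in>ell2. S x \<in> ell2) \<and>
     (\<forall>x\<in>ell2. \<forall>y\<in>ell2. S (\<lambda>j. x j + y j) = (\<lambda>j. S x j + S y j)) \<and>
     (\<forall>c. \<forall>x\<in>ell2. S (\<lambda>j. c *s x j) = (\<lambda>j. c *s S x j)) \<and>
     (\<exists>K. \<forall>x\<in>ell2. ell2_norm (S x) \<le> K * ell2_norm x)"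

definition invertible_operator_ell2 ::
    "((nat \<Rightarrow> complex ^ 'N) \<Rightarrow> (nat \<Rightarrow> complex ^ 'N)) \<Rightarrow> bool" where
  "invertible_operator_ell2 S \<longleftrightarrow>
     bounded_operator_ell2 S \<and>
     (\<exists>R. bounded_operator_ell2 R \<and> (\<forall>x\<in>ell2. R (S x) = x \<and> S (R x) = x))"

definition toeplitz_operator ::
    "(complex \<Rightarrow> complex ^ 'N ^ 'N) \<Rightarrow> (nat \<Rightarrow> complex ^ 'N) \<Rightarrow> (nat \<Rightarrow> complex ^ 'N)" where
  "toeplitz_operator A x j = (\<Sum>k. toeplitz_array A j k *v x k)"

(* The spectral norm, i.e. the operator norm for the Euclidean norm on n-tuples of block vectors. *)
definition block_norm :: "nat \<Rightarrow> 'N::finite block_matrix \<Rightarrow> real" where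
  "block_norm n M =
     Sup {L2_set (\<lambda>j. norm (\<Sum>k<n. M j k *v x k)) {..<n} |
          x :: nat \<Rightarrow> complex ^ 'N. L2_set (\<lambda>k. norm (x k)) {..<n} \<le> 1}"

definition block_inverse :: "nat \<Rightarrow> 'N::finite block_matrix \<Rightarrow> 'N block_matrix \<Rightarrow> bool" where
  "block_inverse n M B \<longleftrightarrow>
     (\<forall>j<n. \<forall>k<n. (\<Sum>l<n. M j l ** B l k) = (if j = k then mat 1 else 0) \<and>
                   (\<Sum>l<n. B j l ** M l k) = (if j = k then mat 1 else 0))"

(* The inverse is unique up to its irrelevant blocks, so the choice does not affect the norm. *)
definition cond_number :: "nat \<Rightarrow> 'N::finite block_matrix \<Rightarrow> ereal" where
  "cond_number n M =
     (if \<exists>B. block_inverse n M B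
      then ereal (block_norm n M * block_norm n (SOME B. block_inverse n M B))
      else \<infinity>)"

definition toeplitz_cond :: "(complex \<Rightarrow> complex ^ 'N ^ 'N) \<Rightarrow> nat \<Rightarrow> ereal" where
  "toeplitz_cond A n = cond_number n (toeplitz_array A)"

end

theory Submission
  imports Defs "HOL-Computational_Algebra.Fundamental_Theorem_Algebra"
begin

text \<open>Everything takes place in the Hilbert space of square-summable functions on the integers with
values in \<open>\<complex>\<^sup>N\<close>.  There a symbol \<open>A\<close> with Fourier coefficients \<open>a\<close> becomes the Laurent operator
\<open>L a = (\<Sum>k. shift by k, composed with a k)\<close>, the operator \<open>T(A)\<close> is its compression to the half-line
\<open>{0..}\<close>, \<open>T\<^sub>n(A)\<close> is its compression to \<open>{0..<n}\<close>, and the reversal \<open>j \<mapsto> n - 1 - j\<close> turns the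
compression of \<open>L a\<close> to \<open>{..<n}\<close> into \<open>T\<close> of the reflected symbol.  Two facts about rational symbols
are needed.  Their Fourier coefficients decay exponentially, so that \<open>L a\<close> is localized: it
transports from one set of indices to another one at distance \<open>d\<close> only an amount \<open>O(s^d)\<close>
with \<open>s < 1\<close>.  And \<open>A\<close> has a rational inverse with coefficients \<open>b\<close>, so that \<open>L b\<close> inverts \<open>L a\<close>
and is localized too (\<open>GR_fourier_coeff\<close>, \<open>laurent_op_inverse\<close>, \<open>localized_laurent_op\<close>).  In
contrast to a product of Toeplitz matrices, the identity \<open>L b (L a x) = x\<close> has no correction terms;
cutting it off at the end points of an interval produces the corrections, and these are
concentrated near the end points.

Exponential growth.  If \<open>T(A)\<close> is not invertible, then \<open>T(A)\<close> or its adjoint has a nonzero kernel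
vector \<open>x\<close>.  Indeed \<open>L b\<close> provides a left inverse of \<open>T(A)\<close> up to a compact operator, so an injective
\<open>T(A)\<close> is bounded below, and an operator which is bounded below together with its adjoint is
invertible (\<open>half_line_bounded_below\<close>, \<open>compress_surj\<close>, \<open>not_invertible_imp_kernel\<close>).  From
\<open>x = L b (L a x)\<close>, where \<open>L a x\<close> lives on the negative integers, the tails of \<open>x\<close> beyond \<open>n\<close> are
\<open>O(s^n)\<close>.  So the truncation of \<open>x\<close> to \<open>{0..<n}\<close> is almost annihilated by \<open>T\<^sub>n(A)\<close> or by its adjoint,
and the inverse of \<open>T\<^sub>n(A)\<close> has exponentially large norm (\<open>kernel_vector_almost_annihilated\<close>,
\<open>kernel_imp_cond_growth\<close>).  The reflected symbol is handled by reversal.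

Stability.  For \<open>x\<close> supported in \<open>{0..<n}\<close> put \<open>y = T\<^sub>n(A) x\<close>.  The identity \<open>x = L b (L a x)\<close> reads
\<open>x = T\<^sub>n(B) y + u + w\<close> with \<open>u\<close> concentrated near \<open>0\<close> and \<open>w\<close> concentrated near \<open>n\<close>.  On \<open>u\<close> the
matrix \<open>T\<^sub>n(A)\<close> acts nearly as \<open>T(A)\<close>, on \<open>w\<close> nearly as the reversed Toeplitz operator of the reflected
symbol, and the images of \<open>u\<close> and \<open>w\<close> nearly do not overlap.  If both Toeplitz operators are bounded
below, \<open>u\<close> and \<open>w\<close> are therefore controlled by \<open>y\<close>, and so is \<open>x\<close>
(\<open>finite_sections_bounded_below\<close>).\<close>

section \<open>Square-summable families\<close>

text \<open>The index type and the values are arbitrary.  The application uses the integers as indices, since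
on them the Laurent operators and their inverses live.\<close>

typedef (overloaded) ('i, 'a :: real_inner) l2 =
    "{x :: 'i \<Rightarrow> 'a. (\<lambda>i. (norm (x i))\<^sup>2) summable_on UNIV}"
  morphisms coord Abs_l2
  by (rule exI[of _ "\<lambda>_. 0"]) simp

setup_lifting type_definition_l2

lemma l2_eqI: "(\<And>i. coord x i = coord y i) \<Longrightarrow> x = y"
  using coord_inject by blast

lemma summable_norm_coord: "(\<lambda>i. (norm (coord x i))\<^sup>2) summable_on UNIV"
  using coord by auto

lemma abs_summable_inner:
  fixes f g :: "'i \<Rightarrow> 'a::real_inner"
  assumes "(\<lambda>i. (norm (f i))\<^sup>2) summable_on UNIV" "(\<lambda>i. (norm (g i))\<^sup>2) summable_on UNIV"
  shows "(\<lambda>i. norm (inner (f i) (g i))) summable_on UNIV"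
proof (rule summable_on_comparison_test)
  show "(\<lambda>i. (norm (f i))\<^sup>2 + (norm (g i))\<^sup>2) summable_on UNIV"
    using assms by (rule summable_on_add)
  show "norm (inner (f i) (g i)) \<le> (norm (f i))\<^sup>2 + (norm (g i))\<^sup>2" for i
  proof -
    have "norm (inner (f i) (g i)) \<le> norm (f i) * norm (g i)"
      by (simp add: Cauchy_Schwarz_ineq2)
    also have "\<dots> \<le> (norm (f i))\<^sup>2 + (norm (g i))\<^sup>2"
      using sum_squares_bound[of "norm (f i)" "norm (g i)"]
        mult_nonneg_nonneg[OF norm_ge_zero[of "f i"] norm_ge_zero[of "g i"]] by linarith
    finally show ?thesis .
  qed
qed auto

lemma summable_inner:
  fixes f g :: "'i \<Rightarrow> 'a::real_inner"
  assumes "(\<lambda>i. (norm (f i))\<^sup>2) summable_on UNIV" "(\<lambda>i. (norm (g i))\<^sup>2) summable_on UNIV"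
  shows "(\<lambda>i. inner (f i) (g i)) summable_on UNIV"
  using abs_summable_inner[OF assms] by (rule abs_summable_summable)

lemma summable_norm_add:
  fixes f g :: "'i \<Rightarrow> 'a::real_inner"
  assumes "(\<lambda>i. (norm (f i))\<^sup>2) summable_on UNIV" "(\<lambda>i. (norm (g i))\<^sup>2) summable_on UNIV"
  shows "(\<lambda>i. (norm (f i + g i))\<^sup>2) summable_on UNIV"
proof -
  have "(\<lambda>i. (norm (f i))\<^sup>2 + (norm (g i))\<^sup>2 + 2 * inner (f i) (g i)) summable_on UNIV"
    by (intro summable_on_add summable_on_cmult_right summable_inner assms)
  then show ?thesis
    by (simp add: power2_norm_eq_inner inner_add_left inner_add_right inner_commute algebra_simps)
qed

lemma summable_norm_scaleR:
  fixes f :: "'i \<Rightarrow> 'a::real_inner"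
  assumes "(\<lambda>i. (norm (f i))\<^sup>2) summable_on UNIV"
  shows "(\<lambda>i. (norm (c *\<^sub>R f i))\<^sup>2) summable_on UNIV"
  using summable_on_cmult_right[OF assms, of "c\<^sup>2"] by (simp add: power_mult_distrib)

instantiation l2 :: (type, real_inner) real_inner
begin

lift_definition zero_l2 :: "('a, 'b) l2" is "\<lambda>_. 0" by simp
lift_definition plus_l2 :: "('a, 'b) l2 \<Rightarrow> ('a, 'b) l2 \<Rightarrow> ('a, 'b) l2" is "\<lambda>x y i. x i + y i"
  by (rule summable_norm_add)
lift_definition uminus_l2 :: "('a, 'b) l2 \<Rightarrow> ('a, 'b) l2" is "\<lambda>x i. - x i" by simp
lift_definition minus_l2 :: "('a, 'b) l2 \<Rightarrow> ('a, 'b) l2 \<Rightarrow> ('a, 'b) l2" is "\<lambda>x y i. x i - y i"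
  subgoal for x y using summable_norm_add[of x "\<lambda>i. - y i"] by simp
  done
lift_definition scaleR_l2 :: "real \<Rightarrow> ('a, 'b) l2 \<Rightarrow> ('a, 'b) l2" is "\<lambda>c x i. c *\<^sub>R x i"
  by (rule summable_norm_scaleR)
definition inner_l2 :: "('a, 'b) l2 \<Rightarrow> ('a, 'b) l2 \<Rightarrow> real" where
  "inner_l2 x y = (\<Sum>\<^sub>\<infinity>i. inner (coord x i) (coord y i))"
definition norm_l2 :: "('a, 'b) l2 \<Rightarrow> real" where "norm_l2 x = sqrt (inner x x)"
definition dist_l2 :: "('a, 'b) l2 \<Rightarrow> ('a, 'b) l2 \<Rightarrow> real" where "dist_l2 x y = norm (x - y)"
definition sgn_l2 :: "('a, 'b) l2 \<Rightarrow> ('a, 'b) l2" where "sgn_l2 x = scaleR (inverse (norm x)) x"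
definition uniformity_l2 :: "(('a, 'b) l2 \<times> ('a, 'b) l2) filter" where
  "uniformity_l2 = (INF e\<in>{0<..}. principal {(x, y). dist x y < e})"
definition open_l2 :: "('a, 'b) l2 set \<Rightarrow> bool" where
  "open_l2 U = (\<forall>x\<in>U. eventually (\<lambda>(x', y). x' = x \<longrightarrow> y \<in> U) uniformity)"

instance
proof
  fix x y z :: "('a, 'b) l2" and a b :: real
  note s = summable_inner[OF summable_norm_coord summable_norm_coord]
  show "x + y + z = x + (y + z)" "x + y = y + x" "0 + x = x" "- x + x = 0" "x - y = x + - y"
    "a *\<^sub>R (x + y) = a *\<^sub>R x + a *\<^sub>R y" "(a + b) *\<^sub>R x = a *\<^sub>R x + b *\<^sub>R x"
    "a *\<^sub>R b *\<^sub>R x = (a * b) *\<^sub>R x" "1 *\<^sub>R x = x"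
    by (auto intro!: l2_eqI simp: zero_l2.rep_eq plus_l2.rep_eq uminus_l2.rep_eq
        minus_l2.rep_eq scaleR_l2.rep_eq algebra_simps)
  show "dist x y = norm (x - y)" "sgn x = inverse (norm x) *\<^sub>R x" "norm x = sqrt (inner x x)"
    by (simp_all add: dist_l2_def sgn_l2_def norm_l2_def)
  show "uniformity = (INF e\<in>{0<..}. principal {(x :: ('a, 'b) l2, y). dist x y < e})"
    by (simp add: uniformity_l2_def)
  show "open U = (\<forall>x\<in>U. eventually (\<lambda>(x', y). x' = x \<longrightarrow> y \<in> U) uniformity)"
    for U :: "('a, 'b) l2 set" by (simp add: open_l2_def)
  show "inner x y = inner y x" by (simp add: inner_l2_def inner_commute)
  show "inner (x + y) z = inner x z + inner y z"
    by (simp add: inner_l2_def plus_l2.rep_eq inner_add_left infsum_add s)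
  show "inner (a *\<^sub>R x) y = a * inner x y"
    by (simp add: inner_l2_def scaleR_l2.rep_eq infsum_cmult_right s)
  show "0 \<le> inner x x" by (simp add: inner_l2_def infsum_nonneg)
  show "(inner x x = 0) = (x = 0)"
  proof
    assume "inner x x = 0"
    then have "inner (coord x i) (coord x i) = 0" for i
      by (intro nonneg_infsum_le_0D[OF _ s]) (auto simp: inner_l2_def)
    then show "x = 0" by (intro l2_eqI) (simp add: zero_l2.rep_eq)
  qed (simp add: inner_l2_def zero_l2.rep_eq)
qed

end

lemmas coord_simps [simp] =
  zero_l2.rep_eq plus_l2.rep_eq uminus_l2.rep_eq minus_l2.rep_eq scaleR_l2.rep_eq

lemma norm_l2_square: "(norm (x :: ('i, 'a::real_inner) l2))\<^sup>2 = (\<Sum>\<^sub>\<infinity>i. (norm (coord x i))\<^sup>2)"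
  by (simp add: power2_norm_eq_inner inner_l2_def)

lemma norm_l2_le_iff:
  assumes "0 \<le> c"
  shows "norm (x :: ('i, 'a::real_inner) l2) \<le> c \<longleftrightarrow> (\<Sum>\<^sub>\<infinity>i. (norm (coord x i))\<^sup>2) \<le> c\<^sup>2"
  using assms by (simp add: norm_l2_square[symmetric] power2_le_iff_abs_le)

lemma sum_norm_coord_le: "finite F \<Longrightarrow> (\<Sum>i\<in>F. (norm (coord x i))\<^sup>2) \<le> (norm x)\<^sup>2"
  unfolding norm_l2_square by (rule finite_sum_le_infsum[OF summable_norm_coord]) auto

lemma norm_coord_le: "norm (coord x i) \<le> norm x"
  using sum_norm_coord_le[of "{i}" x] by (simp add: power2_le_iff_abs_le)

lemma bounded_linear_coord: "bounded_linear (\<lambda>x. coord x i)"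
  by (rule bounded_linear_intro[where K = 1]) (auto simp: norm_coord_le)

lemma norm_Abs_l2_le:
  assumes "\<And>F. finite F \<Longrightarrow> (\<Sum>i\<in>F. (norm (f i))\<^sup>2) \<le> c\<^sup>2" "0 \<le> c"
  shows "(\<lambda>i. (norm (f i))\<^sup>2) summable_on UNIV" "norm (Abs_l2 f) \<le> c"
proof -
  show s: "(\<lambda>i. (norm (f i))\<^sup>2) summable_on UNIV"
    by (rule nonneg_bdd_above_summable_on) (auto intro!: bdd_aboveI[of _ "c\<^sup>2"] assms)
  show "norm (Abs_l2 f) \<le> c"
    unfolding norm_l2_le_iff[OF assms(2)]
    using s assms by (auto simp: Abs_l2_inverse intro!: infsum_le_finite_sums)
qed

text \<open>A Cauchy sequence converges coordinatewise; the Cauchy estimate survives the passage to the limit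
on each finite set of coordinates, hence in norm.\<close>

instance l2 :: (type, "{real_inner, complete_space}") complete_space
proof
  fix X :: "nat \<Rightarrow> ('a, 'b) l2"
  assume X: "Cauchy X"
  have "Cauchy (\<lambda>n. coord (X n) i)" for i
    by (rule bounded_linear.Cauchy[OF bounded_linear_coord X])
  then have l: "(\<lambda>n. coord (X n) i) \<longlonglongrightarrow> lim (\<lambda>n. coord (X n) i)" for i
    by (simp add: Cauchy_convergent_iff convergent_LIMSEQ_iff)
  define l where "l i = lim (\<lambda>n. coord (X n) i)" for i
  note l = l[folded l_def]
  \<comment> \<open>Passing to the limit in the second index of the Cauchy condition, one finite set of
    coordinates at a time.\<close>
  have step: "\<exists>N. \<forall>n\<ge>N. \<forall>F. finite F \<longrightarrow> (\<Sum>i\<in>F. (norm (coord (X n) i - l i))\<^sup>2) \<le> e\<^sup>2"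
    if "e > 0" for e
  proof -
    obtain N where N: "\<And>m n. m \<ge> N \<Longrightarrow> n \<ge> N \<Longrightarrow> norm (X n - X m) < e"
      using CauchyD[OF X \<open>e > 0\<close>] by blast
    have "(\<Sum>i\<in>F. (norm (coord (X n) i - l i))\<^sup>2) \<le> e\<^sup>2" if "n \<ge> N" "finite F" for n F
    proof (rule tendsto_upperbound)
      show "(\<lambda>m. \<Sum>i\<in>F. (norm (coord (X n) i - coord (X m) i))\<^sup>2)
          \<longlonglongrightarrow> (\<Sum>i\<in>F. (norm (coord (X n) i - l i))\<^sup>2)"
        by (intro tendsto_intros l)
      show "\<forall>\<^sub>F m in sequentially. (\<Sum>i\<in>F. (norm (coord (X n) i - coord (X m) i))\<^sup>2) \<le> e\<^sup>2"
        unfolding eventually_sequentially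
      proof (intro exI allI impI)
        fix m assume "m \<ge> N"
        have "(\<Sum>i\<in>F. (norm (coord (X n - X m) i))\<^sup>2) \<le> (norm (X n - X m))\<^sup>2"
          by (rule sum_norm_coord_le[OF that(2)])
        also have "\<dots> \<le> e\<^sup>2" using N[OF \<open>m \<ge> N\<close> that(1)] by (intro power_mono) auto
        finally show "(\<Sum>i\<in>F. (norm (coord (X n) i - coord (X m) i))\<^sup>2) \<le> e\<^sup>2" by simp
      qed
    qed simp
    then show ?thesis by blast
  qed
  have l2: "(\<lambda>i. (norm (l i))\<^sup>2) summable_on UNIV"
  proof -
    obtain N where N: "\<And>F. finite F \<Longrightarrow> (\<Sum>i\<in>F. (norm (coord (X N) i - l i))\<^sup>2) \<le> 1\<^sup>2"
      using step[of 1] by (meson order_refl zero_less_one)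
    have "(\<lambda>i. (norm (coord (X N) i - l i))\<^sup>2) summable_on UNIV"
      by (rule norm_Abs_l2_le(1)[OF N]) auto
    then have "(\<lambda>i. (norm (- (coord (X N) i - l i)))\<^sup>2) summable_on UNIV"
      by (simp only: norm_minus_cancel)
    from summable_norm_add[OF this summable_norm_coord[of "X N"]]
    show ?thesis by simp
  qed
  have "X \<longlonglongrightarrow> Abs_l2 l"
  proof (rule LIMSEQ_I)
    fix e :: real assume "e > 0"
    then obtain N where
      N: "\<And>n F. n \<ge> N \<Longrightarrow> finite F \<Longrightarrow> (\<Sum>i\<in>F. (norm (coord (X n) i - l i))\<^sup>2) \<le> (e / 2)\<^sup>2"
      using step[of "e / 2"] half_gt_zero by blast
    have "norm (X n - Abs_l2 l) < e" if "n \<ge> N" for n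
    proof -
      have "(\<lambda>i. (norm (coord (X n) i - l i))\<^sup>2) summable_on UNIV"
        by (rule norm_Abs_l2_le(1)[OF N[OF that]]) (use \<open>e > 0\<close> in auto)
      then have "X n - Abs_l2 l = Abs_l2 (\<lambda>i. coord (X n) i - l i)"
        using l2 by (intro l2_eqI) (simp add: Abs_l2_inverse)
      then have "norm (X n - Abs_l2 l) \<le> e / 2"
        using norm_Abs_l2_le(2)[OF N[OF that]] \<open>e > 0\<close> by simp
      then show ?thesis using \<open>e > 0\<close> by simp
    qed
    then show "\<exists>N. \<forall>n\<ge>N. norm (X n - Abs_l2 l) < e" by blast
  qed
  then show "convergent X" by (auto simp: convergent_def)
qed

instance l2 :: (type, "{real_inner, complete_space}") banach ..

section \<open>Laurent operators with exponentially decaying coefficients\<close>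

lemma norm_vec_square: "(norm (x :: 'a::real_normed_vector ^ 'n))\<^sup>2 = (\<Sum>i\<in>UNIV. (norm (x $ i))\<^sup>2)"
  by (simp add: norm_vec_def L2_set_def sum_nonneg)

text \<open>The norm on matrices is the Frobenius norm, which is submultiplicative by the Cauchy-Schwarz
inequality applied to each row.\<close>

lemma norm_matrix_vector_mult_le:
  fixes M :: "complex ^ 'n ^ 'm"
  shows "norm (M *v x) \<le> norm M * norm x"
proof -
  have row: "norm ((M *v x) $ i) \<le> norm (M $ i) * norm x" for i
  proof -
    have "norm ((M *v x) $ i) \<le> (\<Sum>j\<in>UNIV. norm (M $ i $ j) * norm (x $ j))"
      unfolding matrix_vector_mult_def by (simp add: sum_norm_le norm_mult)
    also have "\<dots> \<le> norm (M $ i) * norm x"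
      unfolding norm_vec_def[of x] norm_vec_def[of "M $ i"]
      using L2_set_mult_ineq[of "\<lambda>j. norm (M $ i $ j)" "\<lambda>j. norm (x $ j)" UNIV] by simp
    finally show ?thesis .
  qed
  have "(norm (M *v x))\<^sup>2 \<le> (\<Sum>i\<in>UNIV. (norm (M $ i) * norm x)\<^sup>2)"
    unfolding norm_vec_square[of "M *v x"] by (intro sum_mono power_mono row) auto
  also have "\<dots> = (norm M * norm x)\<^sup>2"
    by (simp add: norm_vec_square[of M] power_mult_distrib sum_distrib_right)
  finally show ?thesis by (simp add: power2_le_iff_abs_le)
qed

lemma norm_matrix_mult_le:
  fixes M :: "complex ^ 'n ^ 'm" and M' :: "complex ^ 'k ^ 'n"
  shows "norm (M ** M') \<le> norm M * norm M'"
proof -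
  have col: "(\<Sum>i\<in>UNIV. (norm ((M ** M') $ i $ j))\<^sup>2) \<le> (norm M)\<^sup>2 * (\<Sum>l\<in>UNIV. (norm (M' $ l $ j))\<^sup>2)" for j
  proof -
    have "(norm (M *v (\<chi> l. M' $ l $ j)))\<^sup>2 \<le> (norm M * norm (\<chi> l. M' $ l $ j))\<^sup>2"
      by (intro power_mono norm_matrix_vector_mult_le) auto
    then show ?thesis
      by (simp add: norm_vec_square[of "M *v _"] norm_vec_square[of "\<chi> l. _ l"] power_mult_distrib
          matrix_vector_mult_def matrix_matrix_mult_def)
  qed
  have "(norm (M ** M'))\<^sup>2 = (\<Sum>j\<in>UNIV. \<Sum>i\<in>UNIV. (norm ((M ** M') $ i $ j))\<^sup>2)"
    unfolding norm_vec_square by (rule sum.swap)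
  also have "\<dots> \<le> (\<Sum>j\<in>UNIV. (norm M)\<^sup>2 * (\<Sum>l\<in>UNIV. (norm (M' $ l $ j))\<^sup>2))"
    by (intro sum_mono col)
  also have "\<dots> = (norm M * norm M')\<^sup>2"
    unfolding power_mult_distrib norm_vec_square[of M'] norm_vec_square[of "M' $ _"]
      sum_distrib_left[symmetric] by (subst sum.swap) simp
  finally show ?thesis by (simp add: power2_le_iff_abs_le)
qed

definition cadj :: "complex ^ 'n ^ 'm \<Rightarrow> complex ^ 'm ^ 'n" where
  "cadj M = (\<chi> i j. cnj (M $ j $ i))"

lemma norm_cadj [simp]: "norm (cadj M) = norm M"
proof -
  have "(norm (cadj M))\<^sup>2 = (norm M)\<^sup>2"
    unfolding norm_vec_square cadj_def by (simp, subst sum.swap, rule refl)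
  then show ?thesis by simp
qed

text \<open>The inner product is the real one, the real part of the Hermitian product; the conjugate transpose
is the adjoint with respect to both.\<close>

lemma inner_matrix_vector_mult: "inner (M *v x) y = inner x (cadj M *v y)"
proof -
  have c: "inner a b = Re (a * cnj b)" for a b by (simp add: inner_complex_def)
  have "inner (M *v x) y = (\<Sum>i\<in>UNIV. \<Sum>j\<in>UNIV. Re (M $ i $ j * x $ j * cnj (y $ i)))"
    by (simp only: inner_vec_def matrix_vector_mult_def vec_lambda_beta c sum_distrib_right Re_sum)
  also have "\<dots> = (\<Sum>j\<in>UNIV. \<Sum>i\<in>UNIV. Re (M $ i $ j * x $ j * cnj (y $ i)))"
    by (rule sum.swap)
  also have "\<dots> = inner x (cadj M *v y)"
    by (simp only: inner_vec_def matrix_vector_mult_def vec_lambda_beta c sum_distrib_left Re_sum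
        cnj_sum complex_cnj_mult cadj_def complex_cnj_cnj mult_ac)
  finally show ?thesis .
qed

lift_definition cutoff :: "'i set \<Rightarrow> ('i, 'a::real_inner) l2 \<Rightarrow> ('i, 'a) l2"
  is "\<lambda>S x i. if i \<in> S then x i else 0"
  by (erule summable_on_comparison_test) auto

text \<open>The unitary reversal which preserves \<open>{0..<n}\<close> and exchanges the half-lines \<open>{0..}\<close> and \<open>{..<n}\<close>.\<close>

lift_definition flip :: "int \<Rightarrow> (int, 'a::real_inner) l2 \<Rightarrow> (int, 'a) l2"
  is "\<lambda>n x j. x (n - 1 - j)"
  subgoal for n x
    by (subst summable_on_reindex_bij_witness[of UNIV "\<lambda>j. n - 1 - j" "\<lambda>j. n - 1 - j" UNIV
          "\<lambda>j. (norm (x j))\<^sup>2"]) auto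
  done

lemma summable_shift:
  fixes x :: "int \<Rightarrow> complex ^ 'n" and M :: "complex ^ 'n ^ 'm"
  assumes "(\<lambda>i. (norm (x i))\<^sup>2) summable_on UNIV"
  shows "(\<lambda>j. (norm M)\<^sup>2 * (norm (x (j - k)))\<^sup>2) summable_on UNIV"
    "(\<lambda>j. (norm (M *v x (j - k)))\<^sup>2) summable_on UNIV"
proof -
  have "(\<lambda>j. (norm (x (j - k)))\<^sup>2) summable_on UNIV"
    using assms by (subst summable_on_reindex_bij_witness[of UNIV "\<lambda>j. j + k" "\<lambda>j. j - k" UNIV
          "\<lambda>j. (norm (x j))\<^sup>2"]) auto
  then show s: "(\<lambda>j. (norm M)\<^sup>2 * (norm (x (j - k)))\<^sup>2) summable_on UNIV"
    by (rule summable_on_cmult_right)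
  show "(\<lambda>j. (norm (M *v x (j - k)))\<^sup>2) summable_on UNIV"
    using s
  proof (rule summable_on_comparison_test)
    show "(norm (M *v x (j - k)))\<^sup>2 \<le> (norm M)\<^sup>2 * (norm (x (j - k)))\<^sup>2" for j
      unfolding power_mult_distrib[symmetric]
      by (intro power_mono norm_matrix_vector_mult_le) auto
  qed auto
qed

lift_definition mshift ::
  "int \<Rightarrow> complex ^ 'n ^ 'm \<Rightarrow> (int, complex ^ 'n) l2 \<Rightarrow> (int, complex ^ 'm) l2"
  is "\<lambda>k M x j. M *v x (j - k)"
  by (rule summable_shift(2))

lemmas coord_ops [simp] = cutoff.rep_eq flip.rep_eq mshift.rep_eq

lemma norm_cutoff_le: "norm (cutoff S x) \<le> norm x"
  unfolding norm_l2_le_iff[OF norm_ge_zero] norm_l2_square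
proof (rule infsum_mono)
  show "(norm (coord (cutoff S x) i))\<^sup>2 \<le> (norm (coord x i))\<^sup>2" for i by simp
qed (rule summable_norm_coord)+

lemma norm_flip [simp]: "norm (flip n x) = norm x"
proof -
  have "(norm (flip n x))\<^sup>2 = (norm x)\<^sup>2"
    unfolding norm_l2_square
    by (rule infsum_reindex_bij_witness[of UNIV "\<lambda>j. n - 1 - j" "\<lambda>j. n - 1 - j"]) auto
  then show ?thesis by simp
qed

lemma norm_mshift_le: "norm (mshift k M x) \<le> norm M * norm x"
proof -
  have "(\<Sum>\<^sub>\<infinity>j. (norm (coord (mshift k M x) j))\<^sup>2) \<le> (\<Sum>\<^sub>\<infinity>j. (norm M)\<^sup>2 * (norm (coord x (j - k)))\<^sup>2)"
  proof (rule infsum_mono)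
    show "(\<lambda>j. (norm M)\<^sup>2 * (norm (coord x (j - k)))\<^sup>2) summable_on UNIV"
      by (rule summable_shift(1)[OF summable_norm_coord])
    show "(norm (coord (mshift k M x) j))\<^sup>2 \<le> (norm M)\<^sup>2 * (norm (coord x (j - k)))\<^sup>2" for j
      unfolding power_mult_distrib[symmetric]
      by (intro power_mono) (simp_all add: norm_matrix_vector_mult_le)
  qed (rule summable_norm_coord)
  also have "\<dots> = (norm M)\<^sup>2 * (\<Sum>\<^sub>\<infinity>j. (norm (coord x (j - k)))\<^sup>2)"
    by (rule infsum_cmult_right')
  also have "(\<Sum>\<^sub>\<infinity>j. (norm (coord x (j - k)))\<^sup>2) = (norm x)\<^sup>2"
    unfolding norm_l2_square
    by (rule infsum_reindex_bij_witness[of UNIV "\<lambda>j. j + k" "\<lambda>j. j - k"]) auto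
  finally show ?thesis
    by (subst norm_l2_le_iff) (auto simp: power_mult_distrib)
qed

lemma bounded_linear_cutoff [intro]: "bounded_linear (cutoff S)"
  by (rule bounded_linear_intro[where K = 1]) (auto intro!: l2_eqI simp: norm_cutoff_le)

lemma bounded_linear_flip: "bounded_linear (flip n)"
  by (rule bounded_linear_intro[where K = 1]) (auto intro!: l2_eqI)

lemma matrix_vector_mult_scaleR: "M *v (c *\<^sub>R x) = c *\<^sub>R (M *v (x :: complex ^ 'n))"
  by (simp add: vec_eq_iff matrix_vector_mult_def scaleR_sum_right)

lemma scaleR_matrix_vector_mult: "(c *\<^sub>R M) *v x = c *\<^sub>R (M *v (x :: complex ^ 'n))"
  by (simp add: vec_eq_iff matrix_vector_mult_def scaleR_sum_right)

lemma bounded_linear_mshift: "bounded_linear (mshift k M)"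
  by (rule bounded_linear_intro[where K = "norm M"])
    (auto intro!: l2_eqI simp: matrix_vector_right_distrib matrix_vector_mult_scaleR
      norm_mshift_le mult.commute[of _ "norm M"])

text \<open>Linearity in the matrix lets a convergent series of coefficients be summed inside one shift, which
is how the convolution of coefficients enters the product of two Laurent operators.\<close>

lemma bounded_linear_mshift_matrix: "bounded_linear (\<lambda>M. mshift k M x)"
  by (rule bounded_linear_intro[where K = "norm x"])
    (auto intro!: l2_eqI simp: matrix_vector_mult_add_rdistrib scaleR_matrix_vector_mult norm_mshift_le)

lemma mshift_mshift: "mshift k M (mshift l M' x) = mshift (k + l) (M ** M') x"
  by (intro l2_eqI) (simp add: matrix_vector_mul_assoc algebra_simps)

lemma mshift_one: "mshift 0 (mat 1) x = x"
  by (intro l2_eqI) simp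

lemma flip_flip [simp]: "flip n (flip n x) = x"
  by (intro l2_eqI) simp

lemma flip_mshift: "flip n (mshift k M x) = mshift (- k) M (flip n x)"
  by (intro l2_eqI) (simp add: algebra_simps)

lemma cutoff_flip:
  assumes "\<And>j. j \<in> S' \<longleftrightarrow> n - 1 - j \<in> S"
  shows "cutoff S (flip n x) = flip n (cutoff S' x)"
  by (intro l2_eqI) (simp add: assms)

lemma cutoff_cutoff [simp]: "cutoff S (cutoff S' x) = cutoff (S \<inter> S') x"
  by (intro l2_eqI) simp

lemma cutoff_empty [simp]: "cutoff {} x = 0"
  by (intro l2_eqI) simp

lemma cutoff_add_Compl: "cutoff S x + cutoff (- S) x = x"
  by (intro l2_eqI) simp

lemma inner_cutoff: "inner (cutoff S x) y = inner x (cutoff S y)"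
  unfolding inner_l2_def by (rule infsum_cong) simp

lemma inner_mshift: "inner (mshift k M x) y = inner x (mshift (- k) (cadj M) y)"
  unfolding inner_l2_def
  by (rule infsum_reindex_bij_witness[of UNIV "\<lambda>j. j + k" "\<lambda>j. j - k"])
    (auto simp: inner_matrix_vector_mult)

text \<open>Coefficient sequences in a weighted convolution algebra.  The weight \<^term>\<open>\<rho> ^ nat \<bar>k\<bar>\<close>
  is submultiplicative, which makes exponential decay stable under convolution without any loss
  in \<^term>\<open>\<rho>\<close>.\<close>

definition decaying :: "(int \<Rightarrow> 'a::real_normed_vector) \<Rightarrow> bool" where
  "decaying a \<longleftrightarrow> (\<exists>\<rho>>1. (\<lambda>k. norm (a k) * \<rho> ^ nat \<bar>k\<bar>) summable_on UNIV)"

lemma decayingE: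
  assumes "decaying a"
  obtains \<rho> where "\<rho> > (1::real)" "(\<lambda>k. norm (a k) * \<rho> ^ nat \<bar>k\<bar>) summable_on UNIV"
  using assms by (auto simp: decaying_def)

lemma decaying_weaken:
  assumes "(\<lambda>k::int. norm (a k) * \<rho> ^ nat \<bar>k\<bar>) summable_on UNIV" "0 \<le> \<sigma>" "\<sigma> \<le> \<rho>"
  shows "(\<lambda>k. norm (a k) * \<sigma> ^ nat \<bar>k\<bar>) summable_on UNIV"
  using assms(1)
  by (rule summable_on_comparison_test) (auto intro!: mult_left_mono power_mono mult_nonneg_nonneg zero_le_power assms)

lemma decaying_abs_summable: "decaying a \<Longrightarrow> (\<lambda>k. norm (a k)) summable_on UNIV"
  using decaying_weaken[of a _ 1] by (fastforce elim: decayingE)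

lemma decaying_reflect:
  assumes "decaying a"
  shows "decaying (\<lambda>k. a (- k))"
proof -
  obtain \<rho> where \<rho>: "\<rho> > 1" "(\<lambda>k. norm (a k) * \<rho> ^ nat \<bar>k\<bar>) summable_on UNIV"
    using assms by (rule decayingE)
  have "(\<lambda>k. norm (a (- k)) * \<rho> ^ nat \<bar>k\<bar>) summable_on UNIV"
    using \<rho>(2) by (subst summable_on_reindex_bij_witness[of UNIV uminus uminus UNIV
          "\<lambda>k. norm (a k) * \<rho> ^ nat \<bar>k\<bar>"]) auto
  with \<rho>(1) show ?thesis by (auto simp: decaying_def)
qed

text \<open>The Fourier coefficients of the pointwise conjugate transpose of a symbol on the unit circle.\<close>

definition adjoint_coeff :: "(int \<Rightarrow> complex ^ 'n ^ 'm) \<Rightarrow> int \<Rightarrow> complex ^ 'm ^ 'n" where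
  "adjoint_coeff a k = cadj (a (- k))"

lemma decaying_adjoint_coeff: "decaying a \<Longrightarrow> decaying (adjoint_coeff a)"
  using decaying_reflect[of a] by (simp add: decaying_def adjoint_coeff_def)

text \<open>This is multiplication by the symbol, seen in Fourier coordinates.  Writing it as a norm convergent
series of weighted shifts gives its boundedness, its adjoint, its behaviour under reversal and its
localization term by term.\<close>

definition laurent_op ::
    "(int \<Rightarrow> complex ^ 'n ^ 'm) \<Rightarrow> (int, complex ^ 'n) l2 \<Rightarrow> (int, complex ^ 'm) l2" where
  "laurent_op a x = (\<Sum>\<^sub>\<infinity>k. mshift k (a k) x)"

lemma has_sum_laurent_op:
  assumes "decaying a"
  shows "((\<lambda>k. mshift k (a k) x) has_sum laurent_op a x) UNIV"
proof -
  have "(\<lambda>k. norm (mshift k (a k) x)) summable_on UNIV"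
    using summable_on_cmult_left[OF decaying_abs_summable[OF assms], of "norm x"]
    by (rule summable_on_comparison_test) (auto simp: norm_mshift_le)
  then show ?thesis
    unfolding laurent_op_def by (rule has_sum_infsum[OF abs_summable_summable])
qed

lemma bounded_linear_laurent_op:
  assumes "decaying a"
  shows "bounded_linear (laurent_op a)"
proof (rule bounded_linear_intro[where K = "\<Sum>\<^sub>\<infinity>k. norm (a k)"])
  note s = has_sum_laurent_op[OF assms]
  show "laurent_op a (x + y) = laurent_op a x + laurent_op a y" for x y
    using has_sum_unique[OF s] has_sum_add[OF s[of x] s[of y]]
    by (simp add: linear_add[OF bounded_linear.linear[OF bounded_linear_mshift]])
  show "laurent_op a (r *\<^sub>R x) = r *\<^sub>R laurent_op a x" for r x
    using has_sum_unique[OF s] has_sum_scaleR[OF s[of x], of r]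
    by (simp add: linear_scale[OF bounded_linear.linear[OF bounded_linear_mshift]])
  show "norm (laurent_op a x) \<le> norm x * (\<Sum>\<^sub>\<infinity>k. norm (a k))" for x
  proof (rule norm_infsum_le[OF s])
    show "((\<lambda>k. norm x * norm (a k)) has_sum norm x * (\<Sum>\<^sub>\<infinity>k. norm (a k))) UNIV"
      by (intro has_sum_cmult_right has_sum_infsum decaying_abs_summable assms)
  qed (simp add: norm_mshift_le mult.commute[of "norm x"])
qed

lemma coord_laurent_op:
  assumes "decaying a"
  shows "((\<lambda>k. a (j - k) *v coord x k) has_sum coord (laurent_op a x) j) UNIV"
proof -
  have "((\<lambda>k. coord (mshift k (a k) x) j) has_sum coord (laurent_op a x) j) UNIV"
    by (rule has_sum_bounded_linear[OF bounded_linear_coord has_sum_laurent_op[OF assms]])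
  then show ?thesis
    by (subst has_sum_reindex_bij_witness[of UNIV "\<lambda>k. j - k" "\<lambda>k. j - k" UNIV
          "\<lambda>k. coord (mshift k (a k) x) j"]) auto
qed

lemma inner_laurent_op:
  assumes "decaying a"
  shows "inner (laurent_op a x) y = inner x (laurent_op (adjoint_coeff a) y)"
proof (rule has_sum_unique)
  have "((\<lambda>k. inner (mshift k (a k) x) y) has_sum inner (laurent_op a x) y) UNIV"
    by (rule has_sum_bounded_linear[OF bounded_linear_inner_left has_sum_laurent_op[OF assms]])
  then show "((\<lambda>k. inner x (mshift k (adjoint_coeff a k) y)) has_sum inner (laurent_op a x) y) UNIV"
    by (subst has_sum_reindex_bij_witness[of UNIV uminus uminus UNIV
          "\<lambda>k. inner (mshift k (a k) x) y"]) (auto simp: inner_mshift adjoint_coeff_def)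
  show "((\<lambda>k. inner x (mshift k (adjoint_coeff a k) y)) has_sum
      inner x (laurent_op (adjoint_coeff a) y)) UNIV"
    by (rule has_sum_bounded_linear[OF bounded_linear_inner_right
          has_sum_laurent_op[OF decaying_adjoint_coeff[OF assms]]])
qed

lemma flip_laurent_op:
  assumes "decaying a"
  shows "flip n (laurent_op a x) = laurent_op (\<lambda>k. a (- k)) (flip n x)"
proof (rule has_sum_unique)
  have "((\<lambda>k. flip n (mshift k (a k) x)) has_sum flip n (laurent_op a x)) UNIV"
    by (rule has_sum_bounded_linear[OF bounded_linear_flip has_sum_laurent_op[OF assms]])
  then show "((\<lambda>k. mshift k (a (- k)) (flip n x)) has_sum flip n (laurent_op a x)) UNIV"
    by (subst has_sum_reindex_bij_witness[of UNIV uminus uminus UNIV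
          "\<lambda>k. flip n (mshift k (a k) x)"]) (auto simp: flip_mshift)
  show "((\<lambda>k. mshift k (a (- k)) (flip n x)) has_sum laurent_op (\<lambda>k. a (- k)) (flip n x)) UNIV"
    by (rule has_sum_laurent_op[OF decaying_reflect[OF assms]])
qed

text \<open>Absolute summability over all pairs \<open>(k, l)\<close> permits summation along the diagonals \<open>k + l = m\<close>.\<close>

lemma summable_convolution:
  fixes h :: "int \<Rightarrow> int \<Rightarrow> 'c::banach" and u v :: "int \<Rightarrow> real"
  assumes u: "u summable_on UNIV" "\<And>k. u k \<ge> 0" and v: "v summable_on UNIV" "\<And>l. v l \<ge> 0"
    and h: "\<And>k l. norm (h k l) \<le> u k * v l"
  shows "(\<lambda>k. h k (m - k)) summable_on UNIV"
    and "((\<lambda>m. \<Sum>\<^sub>\<infinity>k. h k (m - k)) has_sum (\<Sum>\<^sub>\<infinity>k. \<Sum>\<^sub>\<infinity>l. h k l)) UNIV"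
proof -
  have "(\<lambda>p. u (fst p) * v (snd p)) summable_on UNIV \<times> UNIV"
  proof (rule summable_on_SigmaI)
    show "((\<lambda>l. u (fst (k, l)) * v (snd (k, l))) has_sum u k * infsum v UNIV) UNIV" for k
      by (simp, intro has_sum_cmult_right has_sum_infsum v)
    show "(\<lambda>k. u k * infsum v UNIV) summable_on UNIV"
      by (intro summable_on_cmult_left u)
  qed (auto simp: u v)
  then have "(\<lambda>p. norm (h (fst p) (snd p))) summable_on UNIV \<times> UNIV"
    by (rule summable_on_comparison_test) (use h in auto)
  then have *: "(\<lambda>(k, l). h k l) summable_on UNIV \<times> UNIV"
    by (simp add: abs_summable_summable case_prod_unfold)
  then have **: "(\<lambda>(m, k). h k (m - k)) summable_on UNIV \<times> UNIV"
    by (subst summable_on_reindex_bij_witness[of _ "\<lambda>(k, l). (k + l, k)" "\<lambda>(m, k). (k, m - k)" _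
          "\<lambda>(k, l). h k l"]) auto
  show "(\<lambda>k. h k (m - k)) summable_on UNIV"
    using summable_on_reindex[of "Pair m" UNIV "\<lambda>(m, k). h k (m - k)"]
      summable_on_subset_banach[OF **, of "Pair m ` UNIV"]
    by (simp add: inj_on_def o_def)
  have "(\<Sum>\<^sub>\<infinity>k. \<Sum>\<^sub>\<infinity>l. h k l) = (\<Sum>\<^sub>\<infinity>(k, l)\<in>UNIV \<times> UNIV. h k l)"
    by (rule infsum_Sigma'_banach[OF *])
  also have "\<dots> = (\<Sum>\<^sub>\<infinity>(m, k)\<in>UNIV \<times> UNIV. h k (m - k))"
    by (rule infsum_reindex_bij_witness[of _ "\<lambda>(m, k). (k, m - k)" "\<lambda>(k, l). (k + l, k)"]) auto
  also have "\<dots> = (\<Sum>\<^sub>\<infinity>m. \<Sum>\<^sub>\<infinity>k. h k (m - k))"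
    by (rule infsum_Sigma'_banach[OF **, symmetric])
  finally show "((\<lambda>m. \<Sum>\<^sub>\<infinity>k. h k (m - k)) has_sum (\<Sum>\<^sub>\<infinity>k. \<Sum>\<^sub>\<infinity>l. h k l)) UNIV"
    using has_sum_infsum[OF summable_on_Sigma_banach[OF **]] by simp
qed

definition convolution_inverse :: "(int \<Rightarrow> complex ^ 'n ^ 'n) \<Rightarrow> (int \<Rightarrow> complex ^ 'n ^ 'n) \<Rightarrow> bool" where
  "convolution_inverse a b \<longleftrightarrow>
     (\<forall>m. ((\<lambda>k. a k ** b (m - k)) has_sum (if m = 0 then mat 1 else 0)) UNIV)"

text \<open>The double series of the products of weighted shifts, collected by total shift \<open>m\<close>, has the
coefficient of the convolution at \<open>m\<close>, which vanishes unless \<open>m = 0\<close>.\<close>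

lemma laurent_op_inverse:
  assumes a: "decaying a" and b: "decaying b" and ab: "convolution_inverse a b"
  shows "laurent_op a (laurent_op b x) = x"
proof -
  define h where "h k l = mshift (k + l) (a k ** b l) x" for k l
  have h: "norm (h k l) \<le> norm (a k) * (norm (b l) * norm x)" for k l
  proof -
    have "norm (h k l) \<le> norm (a k ** b l) * norm x" by (simp add: h_def norm_mshift_le)
    also have "\<dots> \<le> norm (a k) * norm (b l) * norm x"
      by (intro mult_right_mono norm_matrix_mult_le) auto
    finally show ?thesis by (simp add: mult.assoc)
  qed
  have "laurent_op a (laurent_op b x) = (\<Sum>\<^sub>\<infinity>k. \<Sum>\<^sub>\<infinity>l. h k l)"
    unfolding laurent_op_def[of a]
  proof (rule infsum_cong)
    fix k
    have "((\<lambda>l. mshift k (a k) (mshift l (b l) x)) has_sum mshift k (a k) (laurent_op b x)) UNIV"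
      by (rule has_sum_bounded_linear[OF bounded_linear_mshift has_sum_laurent_op[OF b]])
    then show "mshift k (a k) (laurent_op b x) = (\<Sum>\<^sub>\<infinity>l. h k l)"
      by (simp add: h_def mshift_mshift infsumI)
  qed
  moreover have "((\<lambda>m. \<Sum>\<^sub>\<infinity>k. h k (m - k)) has_sum (\<Sum>\<^sub>\<infinity>k. \<Sum>\<^sub>\<infinity>l. h k l)) UNIV"
    by (rule summable_convolution(2)[OF _ _ _ _ h])
      (auto intro!: summable_on_cmult_left decaying_abs_summable[OF a] decaying_abs_summable[OF b])
  moreover have "(\<Sum>\<^sub>\<infinity>k. h k (m - k)) = (if m = 0 then x else 0)" for m
  proof (rule infsumI)
    have "((\<lambda>k. mshift m (a k ** b (m - k)) x) has_sum mshift m (if m = 0 then mat 1 else 0) x) UNIV"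
      using ab by (intro has_sum_bounded_linear[OF bounded_linear_mshift_matrix])
        (simp add: convolution_inverse_def)
    then show "((\<lambda>k. h k (m - k)) has_sum (if m = 0 then x else 0)) UNIV"
      by (simp add: h_def mshift_one split: if_splits
          add: linear_0[OF bounded_linear.linear[OF bounded_linear_mshift_matrix]])
  qed
  moreover have "((\<lambda>m::int. if m = 0 then x else 0) has_sum x) UNIV"
    by (rule has_sum_finite_neutralI[of "{0}"]) auto
  ultimately show ?thesis by (simp add: has_sum_unique)
qed

text \<open>The set sizes do not enter the bound, so infinite sets may be used; \<open>d = 0\<close> is boundedness.  The
decay at distance \<open>d\<close> takes over the role which compactness of Hankel operators plays in the usual
treatment of Toeplitz operators.\<close>

definition localized :: "((int, 'a::real_inner) l2 \<Rightarrow> (int, 'a) l2) \<Rightarrow> bool" where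
  "localized T \<longleftrightarrow> bounded_linear T \<and>
     (\<exists>C>0. \<exists>s>0. s < 1 \<and> (\<forall>d S S' x. (\<forall>i\<in>S. \<forall>j\<in>S'. int d \<le> \<bar>i - j\<bar>) \<longrightarrow>
        norm (cutoff S (T (cutoff S' x))) \<le> C * s ^ d * norm x))"

text \<open>Only shifts by \<open>k\<close> with \<open>\<bar>k\<bar> \<ge> d\<close> connect two sets at distance \<open>d\<close>, and for these the weight
\<open>\<rho> ^ \<bar>k\<bar>\<close> gains a factor \<open>\<rho> ^ d\<close>.\<close>

lemma localized_laurent_op:
  assumes "decaying a"
  shows "localized (laurent_op a)"
proof -
  obtain \<rho> where \<rho>: "\<rho> > 1" and sum: "(\<lambda>k. norm (a k) * \<rho> ^ nat \<bar>k\<bar>) summable_on UNIV"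
    using assms by (rule decayingE)
  define C where "C = (\<Sum>\<^sub>\<infinity>k. norm (a k) * \<rho> ^ nat \<bar>k\<bar>)"
  have "C \<ge> 0" unfolding C_def using \<rho> by (intro infsum_nonneg) auto
  have "norm (cutoff S (laurent_op a (cutoff S' x))) \<le> C * (1 / \<rho>) ^ d * norm x"
    if d: "\<forall>i\<in>S. \<forall>j\<in>S'. int d \<le> \<bar>i - j\<bar>" for d S S' x
  proof (rule norm_infsum_le)
    show "((\<lambda>k. cutoff S (mshift k (a k) (cutoff S' x))) has_sum
        cutoff S (laurent_op a (cutoff S' x))) UNIV"
      by (rule has_sum_bounded_linear[OF bounded_linear_cutoff has_sum_laurent_op[OF assms]])
    show "((\<lambda>k. norm (a k) * \<rho> ^ nat \<bar>k\<bar> * (1 / \<rho>) ^ d * norm x) has_sum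
        C * (1 / \<rho>) ^ d * norm x) UNIV"
      unfolding C_def by (intro has_sum_cmult_left has_sum_infsum sum)
    show "norm (cutoff S (mshift k (a k) (cutoff S' x)))
        \<le> norm (a k) * \<rho> ^ nat \<bar>k\<bar> * (1 / \<rho>) ^ d * norm x" for k
    proof (cases "int d \<le> \<bar>k\<bar>")
      case True
      have "norm (cutoff S (mshift k (a k) (cutoff S' x))) \<le> norm (a k) * norm x"
        using norm_cutoff_le norm_mshift_le[of k "a k" "cutoff S' x"]
          mult_left_mono[OF norm_cutoff_le[of S' x] norm_ge_zero[of "a k"]] by (meson order_trans)
      also have "\<dots> \<le> norm (a k) * (\<rho> ^ nat \<bar>k\<bar> * (1 / \<rho>) ^ d) * norm x"
      proof (intro mult_right_mono)
        have "\<rho> ^ d \<le> \<rho> ^ nat \<bar>k\<bar>" using True \<rho> by (intro power_increasing) auto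
        then have "1 \<le> \<rho> ^ nat \<bar>k\<bar> * (1 / \<rho>) ^ d"
          using \<rho> by (simp add: power_one_over field_simps)
        then show "norm (a k) \<le> norm (a k) * (\<rho> ^ nat \<bar>k\<bar> * (1 / \<rho>) ^ d)"
          by (simp add: mult_le_cancel_left1)
      qed auto
      finally show ?thesis by (simp add: mult.assoc)
    next
      case False
      then have "cutoff S (mshift k (a k) (cutoff S' x)) = 0"
        using d by (intro l2_eqI) (fastforce simp: matrix_vector_mult_0_right)
      then show ?thesis using \<rho> by simp
    qed
  qed
  moreover have "C * (1 / \<rho>) ^ d * norm x \<le> (C + 1) * (1 / \<rho>) ^ d * norm x"
    for d and x :: "(int, complex ^ 'a) l2"
    using \<rho> by (intro mult_right_mono) auto
  ultimately have *: "\<forall>d S S' x. (\<forall>i\<in>S. \<forall>j\<in>S'. int d \<le> \<bar>i - j\<bar>) \<longrightarrow>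
        norm (cutoff S (laurent_op a (cutoff S' x))) \<le> (C + 1) * (1 / \<rho>) ^ d * norm x"
    by (meson order_trans)
  show ?thesis
    unfolding localized_def
    by (rule conjI[OF bounded_linear_laurent_op[OF assms]], rule exI[of _ "C + 1"],
        rule conjI, use \<open>C \<ge> 0\<close> in simp, rule exI[of _ "1 / \<rho>"]) (use \<rho> * in auto)
qed

section \<open>Hilbert space tools\<close>

text \<open>Let \<open>S\<close> be the adjoint of \<open>T\<close>.  Since \<open>S\<close> is bounded below, \<open>T S\<close> is positive definite, and the damped iteration
\<open>x \<mapsto> x - c (T (S x) - y)\<close> is a contraction for small \<open>c\<close>; its fixed point solves \<open>T (S x) = y\<close>.\<close>

lemma bounded_below_adjoint_imp_surj:
  fixes T S :: "'a::{real_inner, complete_space} \<Rightarrow> 'a"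
  assumes T: "bounded_linear T" and S: "bounded_linear S"
    and adj: "\<And>x y. inner (S x) y = inner x (T y)"
    and \<delta>: "\<delta> > 0" "\<And>x. \<delta> * norm x \<le> norm (S x)"
  obtains x where "T x = y"
proof -
  obtain M0 where M0: "\<And>x. norm (T x) \<le> norm x * M0"
    using bounded_linear.nonneg_bounded[OF T] by blast
  \<comment> \<open>With \<open>M \<ge> \<delta>\<close> the contraction factor \<open>q\<close> below is the square root of a nonnegative number.\<close>
  define M where "M = max M0 \<delta>"
  have M: "norm (T x) \<le> M * norm x" for x
    using M0[of x] mult_left_mono[of M0 M "norm x"] by (simp add: M_def mult.commute)
  have M_pos: "M > 0" and "\<delta> \<le> M" using \<delta> by (auto simp: M_def)
  define c where "c = 1 / M\<^sup>2"
  have c: "c > 0" "c * M\<^sup>2 = 1" using M_pos by (auto simp: c_def)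
  define q where "q = sqrt (1 - c * \<delta>\<^sup>2)"
  have "c * \<delta>\<^sup>2 \<le> 1" using power_mono[OF \<open>\<delta> \<le> M\<close>, of 2] \<delta> M_pos by (simp add: c_def)
  then have q: "0 \<le> q" "q < 1" "q\<^sup>2 = 1 - c * \<delta>\<^sup>2" using c \<delta> by (auto simp: q_def)
  have contr: "norm (w - c *\<^sub>R T (S w)) \<le> q * norm w" for w
  proof -
    have i: "inner w (T (S w)) = (norm (S w))\<^sup>2" by (simp add: adj[symmetric] power2_norm_eq_inner)
    have "(norm (w - c *\<^sub>R T (S w)))\<^sup>2 = (norm w)\<^sup>2 - 2 * c * (norm (S w))\<^sup>2 + c\<^sup>2 * (norm (T (S w)))\<^sup>2"
      unfolding power2_norm_eq_inner[of "w - _"] power2_norm_eq_inner[of w]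
        power2_norm_eq_inner[of "T _"]
      by (simp add: inner_diff_left inner_diff_right i inner_commute[of "T (S w)" w]
          power2_eq_square[of c] algebra_simps)
    also have "c\<^sup>2 * (norm (T (S w)))\<^sup>2 \<le> c\<^sup>2 * (M * norm (S w))\<^sup>2"
      by (intro mult_left_mono power_mono M) auto
    also have "\<dots> = c * (c * M\<^sup>2) * (norm (S w))\<^sup>2" by (simp add: power2_eq_square)
    also have "\<dots> = c * (norm (S w))\<^sup>2" using c by simp
    finally have "(norm (w - c *\<^sub>R T (S w)))\<^sup>2 \<le> (norm w)\<^sup>2 - c * (norm (S w))\<^sup>2" by simp
    also have "\<dots> \<le> (norm w)\<^sup>2 - c * (\<delta> * norm w)\<^sup>2"
      using c \<delta> by (intro diff_left_mono mult_left_mono power_mono) auto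
    also have "\<dots> = (q * norm w)\<^sup>2"
      unfolding power_mult_distrib q(3) by (simp add: algebra_simps)
    finally show ?thesis using q by (simp add: power2_le_iff_abs_le)
  qed
  define g where "g x = x - c *\<^sub>R (T (S x) - y)" for x
  have "dist (g a) (g b) \<le> q * dist a b" for a b
  proof -
    have "g a - g b = (a - b) - c *\<^sub>R T (S (a - b))"
      by (simp add: g_def linear_diff[OF bounded_linear.linear[OF T]]
          linear_diff[OF bounded_linear.linear[OF S]] algebra_simps)
    then show ?thesis using contr[of "a - b"] by (simp add: dist_norm)
  qed
  then have "\<exists>!x. g x = x" by (intro banach_fix_type[OF q(1,2)]) auto
  then obtain x where "g x = x" by blast
  then have "T (S x) = y" using c by (simp add: g_def)
  then show thesis by (rule that)
qed

lift_definition single :: "'i \<Rightarrow> 'a \<Rightarrow> ('i, 'a::real_inner) l2" is "\<lambda>j v i. if i = j then v else 0"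
  subgoal for j v by (rule finite_nonzero_values_imp_summable_on, rule finite_subset[of _ "{j}"]) auto
  done

lemma coord_single [simp]: "coord (single j v) i = (if i = j then v else 0)"
  by (simp add: single.rep_eq)

lemma norm_single [simp]: "norm (single j v) = norm v"
proof -
  have "(norm (single j v))\<^sup>2 = (norm v)\<^sup>2"
    unfolding norm_l2_square
    by (rule infsumI, rule has_sum_finite_neutralI[of "{j}"]) auto
  then show ?thesis by simp
qed

lemma bounded_linear_single: "bounded_linear (single j)"
  by (rule bounded_linear_intro[where K = 1]) (auto intro!: l2_eqI)

lemma cutoff_ball_subset_compact:
  assumes "finite S"
  shows "\<exists>K. compact K \<and> cutoff S ` cball (0 :: ('i, 'a::euclidean_space) l2) R \<subseteq> K"
  using assms
proof (induction S)
  case empty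
  show ?case by (rule exI[of _ "{0}"]) auto
next
  case (insert j S)
  then obtain K where K: "compact K" "cutoff S ` cball (0 :: ('i, 'a) l2) R \<subseteq> K" by blast
  let ?f = "\<lambda>p. single j (fst p) + snd p :: ('i, 'a) l2"
  have "compact (?f ` (cball 0 R \<times> K))"
    by (intro compact_continuous_image compact_Times compact_cball K continuous_on_add
        continuous_on_snd continuous_on_id bounded_linear.continuous_on[OF bounded_linear_single]
        continuous_on_fst)
  moreover have "cutoff (insert j S) x \<in> ?f ` (cball 0 R \<times> K)" if "x \<in> cball 0 R" for x
  proof (rule image_eqI)
    show "cutoff (insert j S) x = ?f (coord x j, cutoff S x)"
      using insert.hyps by (intro l2_eqI) auto
    show "(coord x j, cutoff S x) \<in> cball 0 R \<times> K"
      using that K(2) order_trans[OF norm_coord_le] by auto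
  qed
  ultimately show ?case by blast
qed

text \<open>Up to an error \<open>e\<close> the set lies in a bounded subset of a finite-dimensional space, so it is totally
bounded.\<close>

lemma relatively_compact_if_tails_small:
  fixes U :: "('i, 'a::euclidean_space) l2 set"
  assumes bdd: "\<And>x. x \<in> U \<Longrightarrow> norm x \<le> R"
    and tail: "\<And>e. e > 0 \<Longrightarrow> \<exists>S. finite S \<and> (\<forall>x\<in>U. norm (cutoff (- S) x) < e)"
  shows "compact (closure U)"
  unfolding compact_eq_totally_bounded
proof (intro conjI allI impI)
  show "complete (closure U)" by (simp add: complete_eq_closed)
  fix e :: real assume "e > 0"
  then obtain S where S: "finite S" "\<And>x. x \<in> U \<Longrightarrow> norm (cutoff (- S) x) < e / 3"
    using tail[of "e / 3"] by auto
  obtain K where K: "compact K" "cutoff S ` cball (0 :: ('i, 'a) l2) R \<subseteq> K"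
    using cutoff_ball_subset_compact[OF S(1)] by blast
  then obtain k where k: "finite k" "K \<subseteq> (\<Union>x\<in>k. ball x (e / 3))"
    using \<open>e > 0\<close> unfolding compact_eq_totally_bounded by (meson divide_pos_pos zero_less_numeral)
  have "closure U \<subseteq> (\<Union>x\<in>k. ball x e)"
  proof
    fix z assume "z \<in> closure U"
    then obtain y where y: "y \<in> U" "dist y z < e / 3"
      using \<open>e > 0\<close> by (meson closure_approachable divide_pos_pos zero_less_numeral)
    have "cutoff S y \<in> K" using K(2) bdd[OF y(1)] by auto
    then obtain x where x: "x \<in> k" "dist x (cutoff S y) < e / 3" using k(2) by auto
    have "dist (cutoff S y) y = norm (cutoff (- S) y)"
      using cutoff_add_Compl[of S y]
      by (metis add_diff_cancel_left' dist_commute dist_norm)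
    then have "dist x z < e"
      using x(2) y(2) S(2)[OF y(1)] dist_triangle[of x z "cutoff S y"]
        dist_triangle[of "cutoff S y" z y] by simp
    with x(1) show "z \<in> (\<Union>x\<in>k. ball x e)" by auto
  qed
  with k(1) show "\<exists>k. finite k \<and> closure U \<subseteq> (\<Union>x\<in>k. ball x e)" by blast
qed

text \<open>Here \<open>B\<close> is a left inverse of \<open>T\<close> modulo the compact operator \<open>K\<close>.  If \<open>T\<close> were not bounded below, take
unit vectors \<open>u n\<close> with \<open>T (u n) \<rightarrow> 0\<close>.  Along a subsequence \<open>K (u n)\<close> converges, hence so does \<open>u n\<close>
by the regularizer identity, and the limit is a unit vector in the kernel of \<open>T\<close>.\<close>

lemma injective_imp_bounded_below:
  fixes T B K :: "('i, 'a::euclidean_space) l2 \<Rightarrow> ('i, 'a) l2"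
  assumes T: "bounded_linear T" and B: "bounded_linear B" and K: "bounded_linear K"
    and reg: "\<And>x. B (T x) + K x = x"
    and tail: "\<And>e. e > 0 \<Longrightarrow> \<exists>S. finite S \<and> (\<forall>x. norm x \<le> 1 \<longrightarrow> norm (cutoff (- S) (K x)) < e)"
    and inj: "\<And>x. T x = 0 \<Longrightarrow> x = 0"
  shows "\<exists>\<delta>>0. \<forall>x. \<delta> * norm x \<le> norm (T x)"
proof (rule ccontr)
  assume neg: "\<not> ?thesis"
  have "\<exists>u. norm u = 1 \<and> norm (T u) < 1 / Suc n" for n
  proof -
    obtain x where x: "norm (T x) < 1 / Suc n * norm x"
      using neg[simplified, rule_format, of "1 / Suc n"] by (auto simp: not_le)
    then have "x \<noteq> 0" by (auto simp: linear_0[OF bounded_linear.linear[OF T]])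
    then have "norm (sgn x) = 1" "norm (T (sgn x)) < 1 / Suc n"
      using x by (simp_all add: sgn_div_norm linear_scale[OF bounded_linear.linear[OF T]]
          norm_inverse field_simps)
    then show ?thesis by blast
  qed
  then obtain u where u: "\<And>n. norm (u n) = 1" "\<And>n. norm (T (u n)) < 1 / Suc n" by metis
  obtain R where R: "\<And>x. norm (K x) \<le> norm x * R"
    using bounded_linear.nonneg_bounded[OF K] by blast
  have "compact (closure (K ` {x. norm x = 1}))"
  proof (rule relatively_compact_if_tails_small)
    show "norm y \<le> R" if "y \<in> K ` {x. norm x = 1}" for y
      using that by (elim imageE) (metis R mem_Collect_eq mult_1)
    show "\<exists>S. finite S \<and> (\<forall>x\<in>K ` {x. norm x = 1}. norm (cutoff (- S) x) < e)" if "e > 0" for e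
    proof -
      obtain S where "finite S" "\<And>x. norm x \<le> 1 \<Longrightarrow> norm (cutoff (- S) (K x)) < e"
        using tail[OF \<open>e > 0\<close>] by blast
      then show ?thesis by (intro exI[of _ S]) auto
    qed
  qed
  moreover have "\<forall>n. (K \<circ> u) n \<in> closure (K ` {x. norm x = 1})"
    using u(1) by (intro allI subsetD[OF closure_subset]) auto
  ultimately obtain v r where "strict_mono (r :: nat \<Rightarrow> nat)" "((K \<circ> u) \<circ> r) \<longlonglongrightarrow> v"
    unfolding compact_def by blast
  note r = this[unfolded o_def]
  have T0: "(\<lambda>n. T (u (r n))) \<longlonglongrightarrow> 0"
  proof (rule Lim_null_comparison)
    have "norm (T (u (r n))) \<le> 1 / Suc n" for n
    proof -
      have "1 / real (Suc (r n)) \<le> 1 / Suc n"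
        using strict_mono_imp_increasing[OF r(1), of n] by (simp add: frac_le)
      then show ?thesis using u(2)[of "r n"] by simp
    qed
    then show "\<forall>\<^sub>F n in sequentially. norm (T (u (r n))) \<le> 1 / Suc n" by simp
    show "(\<lambda>n. 1 / real (Suc n)) \<longlonglongrightarrow> 0" by (rule lim_1_over_n[THEN LIMSEQ_Suc])
  qed
  have "(\<lambda>n. B (T (u (r n))) + K (u (r n))) \<longlonglongrightarrow> B 0 + v"
    by (intro tendsto_add r(2) bounded_linear.tendsto[OF B T0])
  then have lim: "(\<lambda>n. u (r n)) \<longlonglongrightarrow> v"
    by (simp add: reg linear_0[OF bounded_linear.linear[OF B]])
  have "T v = 0"
    using LIMSEQ_unique[OF bounded_linear.tendsto[OF T lim] T0] .
  moreover have "norm v = 1"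
    using LIMSEQ_unique[OF tendsto_norm[OF lim]] u(1) by simp
  ultimately show False using inj by fastforce
qed

section \<open>Compressions of localized operators\<close>

definition compress ::
    "'i set \<Rightarrow> (('i, 'a::real_inner) l2 \<Rightarrow> ('i, 'a) l2) \<Rightarrow> ('i, 'a) l2 \<Rightarrow> ('i, 'a) l2" where
  "compress S T x = cutoff S (T (cutoff S x))"

lemma localized_common:
  fixes T T' :: "(int, 'a::real_inner) l2 \<Rightarrow> (int, 'a) l2"
  assumes "localized T" "localized T'"
  obtains C s where "C > 0" "0 < s" "s < 1"
    "\<And>d S S' x. (\<And>i j. i \<in> S \<Longrightarrow> j \<in> S' \<Longrightarrow> int d \<le> \<bar>i - j\<bar>) \<Longrightarrow>
        norm (cutoff S (T (cutoff S' x))) \<le> C * s ^ d * norm x"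
    "\<And>d S S' x. (\<And>i j. i \<in> S \<Longrightarrow> j \<in> S' \<Longrightarrow> int d \<le> \<bar>i - j\<bar>) \<Longrightarrow>
        norm (cutoff S (T' (cutoff S' x))) \<le> C * s ^ d * norm x"
    "\<And>x. norm (T x) \<le> C * norm x" "\<And>x. norm (T' x) \<le> C * norm x"
proof -
  obtain C s where 1: "C > 0" "0 < s" "s < 1" "\<And>d S S' x. (\<forall>i\<in>S. \<forall>j\<in>S'. int d \<le> \<bar>i - j\<bar>) \<Longrightarrow>
        norm (cutoff S (T (cutoff S' x))) \<le> C * s ^ d * norm x"
    using assms(1) unfolding localized_def by blast
  obtain C' s' where 2: "C' > 0" "0 < s'" "s' < 1" "\<And>d S S' x. (\<forall>i\<in>S. \<forall>j\<in>S'. int d \<le> \<bar>i - j\<bar>) \<Longrightarrow>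
        norm (cutoff S (T' (cutoff S' x))) \<le> C' * s' ^ d * norm x"
    using assms(2) unfolding localized_def by blast
  have le: "C * s ^ d * norm x \<le> max C C' * max s s' ^ d * norm x"
    "C' * s' ^ d * norm x \<le> max C C' * max s s' ^ d * norm x" for d and x :: "(int, 'a) l2"
    using 1 2 by (intro mult_right_mono mult_mono power_mono; simp)+
  have bound: "norm (T x) \<le> max C C' * norm x" "norm (T' x) \<le> max C C' * norm x" for x
  proof -
    have u: "cutoff UNIV z = z" for z :: "(int, 'a) l2" by (intro l2_eqI) simp
    show "norm (T x) \<le> max C C' * norm x"
      using order_trans[OF 1(4)[of UNIV UNIV 0 x] le(1)[of 0 x]] by (simp add: u)
    show "norm (T' x) \<le> max C C' * norm x"
      using order_trans[OF 2(4)[of UNIV UNIV 0 x] le(2)[of 0 x]] by (simp add: u)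
  qed
  show thesis
    by (rule that[of "max C C'" "max s s'"])
      (use 1 2 bound in \<open>auto intro: order_trans[OF 1(4) le(1)] order_trans[OF 2(4) le(2)]\<close>)
qed

lemmas bl_add = linear_add[OF bounded_linear.linear]
lemmas bl_diff = linear_diff[OF bounded_linear.linear]
lemmas bl_zero = linear_0[OF bounded_linear.linear]

lemma localized_bounded_linear: "localized T \<Longrightarrow> bounded_linear T"
  by (simp add: localized_def)

text \<open>Compressing \<open>B (T x) = x\<close> to the half-line, the compression of \<open>B\<close> is a left inverse up to the error
\<open>P B N T P\<close>, where \<open>P\<close> and \<open>N\<close> project onto the nonnegative and the negative integers.  Its values
at \<open>d\<close> and beyond come from the negative integers through \<open>B\<close>, so localization makes the tails
small and the error compact.\<close>

lemma half_line_bounded_below: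
  fixes T B :: "(int, 'a::euclidean_space) l2 \<Rightarrow> (int, 'a) l2"
  assumes T: "localized T" and B: "localized B" and BT: "\<And>x. B (T x) = x"
    and inj: "\<And>x. cutoff {0..} x = x \<Longrightarrow> compress {0..} T x = 0 \<Longrightarrow> x = 0"
  shows "\<exists>\<delta>>0. \<forall>x. cutoff {0..} x = x \<longrightarrow> \<delta> * norm x \<le> norm (compress {0..} T x)"
proof -
  note T' = localized_bounded_linear[OF T] and B' = localized_bounded_linear[OF B]
  obtain C s where C: "C > 0" "0 < s" "s < 1"
    and loc: "\<And>d S S' x. (\<And>i j. i \<in> S \<Longrightarrow> j \<in> S' \<Longrightarrow> int d \<le> \<bar>i - j\<bar>) \<Longrightarrow>
        norm (cutoff S (B (cutoff S' x))) \<le> C * s ^ d * norm x"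
    and TC: "\<And>x. norm (T x) \<le> C * norm x"
    by (rule localized_common[OF T B]) blast
  define P :: "(int, 'a) l2 \<Rightarrow> (int, 'a) l2" where "P = cutoff {0..}"
  define N :: "(int, 'a) l2 \<Rightarrow> (int, 'a) l2" where "N = cutoff {..<0}"
  have PN: "P x + N x = x" "P (P x) = P x" "N (N x) = N x" "P (N x) = 0" "N (P x) = 0" for x
    by (auto intro!: l2_eqI simp: P_def N_def)
  have bl: "bounded_linear P" "bounded_linear N" unfolding P_def N_def by auto
  \<comment> \<open>The compressions, extended by the identity on the negative integers.\<close>
  define T1 where "T1 x = P (T (P x)) + N x" for x
  define B1 where "B1 x = P (B (P x)) + N x" for x
  define K where "K x = P (B (N (T (P x))))" for x
  note comp = bounded_linear_compose
  have "bounded_linear T1" "bounded_linear B1" "bounded_linear K"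
    unfolding T1_def B1_def K_def
    by (intro bounded_linear_add bl comp[OF bl(1)] comp[OF T'] comp[OF B'] comp[OF bl(2)])+
  moreover have "B1 (T1 x) + K x = x" for x
  proof -
    have "B1 (T1 x) + K x = P (B (P (T (P x))) + B (N (T (P x)))) + N x"
      unfolding B1_def T1_def K_def by (simp add: bl_add[OF bl(1)] bl_add[OF bl(2)] PN)
    also have "B (P (T (P x))) + B (N (T (P x))) = P x"
      by (simp add: bl_add[OF B', symmetric] PN BT)
    finally show ?thesis by (simp add: PN)
  qed
  moreover have "\<exists>S. finite S \<and> (\<forall>x. norm x \<le> 1 \<longrightarrow> norm (cutoff (- S) (K x)) < e)" if "e > 0" for e
  proof -
    have "(\<lambda>d. C * C * s ^ d) \<longlonglongrightarrow> 0"
      using tendsto_mult_left[OF LIMSEQ_realpow_zero[of s], of "C * C"] C by simp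
    then obtain d where d: "C * C * s ^ d < e"
      using order_tendstoD(2)[OF _ \<open>e > 0\<close>] by (metis eventually_happens sequentially_bot)
    have "norm (cutoff (- {0..<int d}) (K x)) < e" if "norm x \<le> 1" for x
    proof -
      have "cutoff (- {0..<int d}) (K x) = cutoff {int d..} (B (cutoff {..<0} (T (P x))))"
        unfolding K_def P_def N_def by (intro l2_eqI) auto
      also have "norm \<dots> \<le> C * s ^ d * norm (T (P x))"
        by (rule loc) auto
      also have "\<dots> \<le> C * s ^ d * (C * 1)"
        using C TC[of "P x"] norm_cutoff_le[of "{0..}" x] that unfolding P_def
        by (intro mult_left_mono order_trans[OF TC]) auto
      finally show ?thesis using d by (simp add: algebra_simps)
    qed
    then show ?thesis by blast
  qed
  moreover have "x = 0" if "T1 x = 0" for x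
  proof -
    have "P (T1 x) = 0" "N (T1 x) = 0" by (simp_all add: that bl_zero[OF bl(1)] bl_zero[OF bl(2)])
    then have "P (T (P x)) = 0" "N x = 0"
      by (simp_all add: T1_def bl_add[OF bl(1)] bl_add[OF bl(2)] PN)
    then have "P x = 0" using inj[of "P x"] PN(2) by (simp add: compress_def P_def)
    then show ?thesis using PN(1)[of x] \<open>N x = 0\<close> by simp
  qed
  ultimately obtain \<delta> where \<delta>: "\<delta> > 0" "\<And>x. \<delta> * norm x \<le> norm (T1 x)"
    using injective_imp_bounded_below[of T1 B1 K] by blast
  have "\<delta> * norm x \<le> norm (compress {0..} T x)" if "cutoff {0..} x = x" for x
  proof -
    have "N x = 0" using PN(5)[of x] that by (simp add: P_def)
    then show ?thesis using \<delta>(2)[of x] by (simp add: T1_def compress_def P_def)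
  qed
  with \<delta>(1) show ?thesis by blast
qed

text \<open>Extended by the identity on the complement of \<open>S\<close>, the compression becomes an operator on the whole
space to which the surjectivity criterion applies.\<close>

lemma compress_surj:
  fixes T T' :: "('i, 'a::euclidean_space) l2 \<Rightarrow> ('i, 'a) l2"
  assumes T: "bounded_linear T" and T': "bounded_linear T'"
    and adj: "\<And>x y. inner (T' x) y = inner x (T y)"
    and \<delta>: "\<delta> > 0" "\<And>x. cutoff S x = x \<Longrightarrow> \<delta> * norm x \<le> norm (compress S T' x)"
    and y: "cutoff S y = y"
  obtains x where "cutoff S x = x" "compress S T x = y"
proof -
  define E where "E F x = cutoff S (F (cutoff S x)) + cutoff (- S) x"
    for F :: "('i, 'a) l2 \<Rightarrow> ('i, 'a) l2" and x
  have bl: "bounded_linear (E F)" if "bounded_linear F" for F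
    unfolding E_def using that
    by (intro bounded_linear_add bounded_linear_cutoff bounded_linear_compose[OF bounded_linear_cutoff]
        bounded_linear_compose[OF that])
  obtain x where x: "E T x = y"
  proof (rule bounded_below_adjoint_imp_surj[OF bl[OF T] bl[OF T'], where \<delta> = "1 / (1 / \<delta> + 1)"])
    show "inner (E T' x) y = inner x (E T y)" for x y
      by (simp add: E_def inner_add_left inner_add_right inner_cutoff adj)
    show "1 / (1 / \<delta> + 1) * norm x \<le> norm (E T' x)" for x
    proof -
      have "cutoff S (E T' x) = compress S T' (cutoff S x)" "cutoff (- S) (E T' x) = cutoff (- S) x"
        unfolding E_def compress_def by (intro l2_eqI, simp)+
      then have 1: "\<delta> * norm (cutoff S x) \<le> norm (E T' x)" and 2: "norm (cutoff (- S) x) \<le> norm (E T' x)"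
        using \<delta>(2)[of "cutoff S x"] norm_cutoff_le[of S "E T' x"] norm_cutoff_le[of "- S" "E T' x"]
        by simp_all
      have "norm x \<le> norm (cutoff S x) + norm (cutoff (- S) x)"
        by (metis cutoff_add_Compl norm_triangle_ineq)
      also have "\<dots> \<le> 1 / \<delta> * norm (E T' x) + norm (E T' x)"
        using 1 2 \<delta>(1) by (intro add_mono) (simp_all add: field_simps)
      finally have "norm x \<le> (1 / \<delta> + 1) * norm (E T' x)" by (simp add: algebra_simps)
      moreover have "1 / \<delta> + 1 > 0" using \<delta>(1) by (simp add: add_pos_pos)
      ultimately show ?thesis by (simp add: divide_le_eq mult.commute)
    qed
    show "1 / (1 / \<delta> + 1) > 0" using \<delta>(1) by (simp add: add_pos_pos)
  qed
  show thesis
  proof (rule that)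
    have "cutoff (- S) (cutoff S y) = 0" by simp
    then have "cutoff (- S) (E T x) = 0" by (simp only: x y)
    moreover have "cutoff (- S) (E T x) = cutoff (- S) x" unfolding E_def by (intro l2_eqI) simp
    ultimately have "cutoff (- S) x = 0" by simp
    then show "cutoff S x = x" "compress S T x = y"
      using cutoff_add_Compl[of S x] x by (simp_all add: E_def compress_def)
  qed
qed

text \<open>For a kernel vector \<open>x\<close> of the half-line compression, \<open>T x\<close> is supported on the negative integers,
so \<open>x = B (T x)\<close> has tails of size \<open>O(s^n)\<close> beyond \<open>n\<close>.  Truncating \<open>x\<close> therefore changes \<open>T x\<close>,
which vanishes on \<open>{0..<n}\<close>, only by \<open>O(s^n)\<close>.\<close>

lemma kernel_vector_almost_annihilated:
  fixes T B :: "(int, 'a::euclidean_space) l2 \<Rightarrow> (int, 'a) l2"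
  assumes T: "localized T" and B: "localized B" and BT: "\<And>x. B (T x) = x"
    and x: "cutoff {0..} x = x" "x \<noteq> 0" "compress {0..} T x = 0"
  shows "\<exists>D>0. \<exists>s>0. s < 1 \<and> (\<exists>n0. \<forall>n\<ge>n0. \<exists>\<xi>. cutoff {0..<int n} \<xi> = \<xi> \<and> \<xi> \<noteq> 0 \<and>
           norm (compress {0..<int n} T \<xi>) \<le> D * s ^ n * norm \<xi>)"
proof -
  note T' = localized_bounded_linear[OF T] and B' = localized_bounded_linear[OF B]
  obtain C s where C: "C > 0" "0 < s" "s < 1"
    and loc: "\<And>d S S' x. (\<And>i j. i \<in> S \<Longrightarrow> j \<in> S' \<Longrightarrow> int d \<le> \<bar>i - j\<bar>) \<Longrightarrow>
        norm (cutoff S (B (cutoff S' x))) \<le> C * s ^ d * norm x"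
    and TC: "\<And>x. norm (T x) \<le> C * norm x"
    by (rule localized_common[OF T B]) blast
  have "cutoff {0..} (T x) = 0" using x by (simp add: compress_def)
  then have Tx: "T x = cutoff {..<0} (T x)"
    using cutoff_add_Compl[of "{0..}" "T x"] by (simp add: Compl_atLeast)
  have tail: "norm (cutoff {int n..} x) \<le> C * s ^ n * (C * norm x)" for n
  proof -
    have "cutoff {int n..} x = cutoff {int n..} (B (cutoff {..<0} (T x)))"
      by (simp add: Tx[symmetric] BT)
    also have "norm \<dots> \<le> C * s ^ n * norm (T x)" by (rule loc) auto
    also have "\<dots> \<le> C * s ^ n * (C * norm x)" using C TC by (intro mult_left_mono) auto
    finally show ?thesis .
  qed
  define \<xi> where "\<xi> n = cutoff {0..<int n} x" for n
  have split: "x = \<xi> n + cutoff {int n..} x" for n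
  proof (rule l2_eqI)
    show "coord x i = coord (\<xi> n + cutoff {int n..} x) i" for i
      using arg_cong[OF x(1), of "\<lambda>z. coord z i"] by (auto simp: \<xi>_def)
  qed
  have small: "norm (compress {0..<int n} T (\<xi> n)) \<le> C * (C * s ^ n * (C * norm x))" for n
  proof -
    have "cutoff {0..<int n} (T x) = cutoff {0..<int n} (cutoff {0..} (T x))"
      by (intro l2_eqI) simp
    then have "cutoff {0..<int n} (T x) = 0"
      using \<open>cutoff {0..} (T x) = 0\<close> bl_zero[OF bounded_linear_cutoff] by simp
    moreover have "T (\<xi> n) = T x - T (cutoff {int n..} x)"
      using split[of n] by (metis add_diff_cancel_right' bl_diff[OF T'])
    ultimately have "compress {0..<int n} T (\<xi> n) = - cutoff {0..<int n} (T (cutoff {int n..} x))"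
      by (simp add: compress_def \<xi>_def bl_diff[OF bounded_linear_cutoff])
    then have "norm (compress {0..<int n} T (\<xi> n)) \<le> norm (T (cutoff {int n..} x))"
      by (simp add: norm_cutoff_le)
    also have "\<dots> \<le> C * (C * s ^ n * (C * norm x))"
      using C by (intro order_trans[OF TC] mult_left_mono tail) auto
    finally show ?thesis .
  qed
  have "(\<lambda>n. C * s ^ n * (C * norm x)) \<longlonglongrightarrow> 0"
    using tendsto_mult_left[OF LIMSEQ_realpow_zero[of s], of "C * (C * norm x)"] C
    by (simp add: mult_ac)
  then have "\<forall>\<^sub>F n in sequentially. C * s ^ n * (C * norm x) < norm x / 2"
    by (rule order_tendstoD(2)) (use x(2) in simp)
  then obtain n0 where n0: "\<And>n. n \<ge> n0 \<Longrightarrow> C * s ^ n * (C * norm x) < norm x / 2"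
    unfolding eventually_sequentially by blast
  have big: "norm x / 2 \<le> norm (\<xi> n)" if "n \<ge> n0" for n
    using n0[OF that] tail[of n] norm_triangle_ineq[of "\<xi> n" "cutoff {int n..} x"] split[of n] by simp
  show ?thesis
  proof (rule exI[of _ "2 * C * C * C"], intro conjI exI[of _ s] exI[of _ n0] allI impI)
    fix n assume n: "n \<ge> n0"
    show "\<exists>\<xi>. cutoff {0..<int n} \<xi> = \<xi> \<and> \<xi> \<noteq> 0 \<and>
        norm (compress {0..<int n} T \<xi>) \<le> 2 * C * C * C * s ^ n * norm \<xi>"
    proof (rule exI[of _ "\<xi> n"], intro conjI)
      show "cutoff {0..<int n} (\<xi> n) = \<xi> n" by (simp add: \<xi>_def)
      show "\<xi> n \<noteq> 0" using big[OF n] x(2) by auto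
      have "C * (C * s ^ n * (C * norm x)) = 2 * C * C * C * s ^ n * (norm x / 2)" by simp
      also have "\<dots> \<le> 2 * C * C * C * s ^ n * norm (\<xi> n)"
        using C by (intro mult_left_mono big n) auto
      finally show "norm (compress {0..<int n} T (\<xi> n)) \<le> 2 * C * C * C * s ^ n * norm (\<xi> n)"
        using small[of n] by simp
    qed
  qed (use C in auto)
qed

text \<open>With \<open>y\<close> the compression of \<open>T\<close> applied to \<open>x\<close>, decompose \<open>x = P B y + u + w\<close>, where \<open>P\<close> projects onto
\<open>{0..<n}\<close> and \<open>u\<close>, \<open>w\<close> arise from the parts of \<open>T x\<close> to the left and to the right of this interval.
With \<open>h = n div 4\<close>, the vector \<open>u\<close> is small beyond \<open>h\<close> and \<open>T u\<close> is small beyond \<open>2 h\<close>;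
symmetrically \<open>w\<close> is small below \<open>n - h\<close> and \<open>T w\<close> is small below \<open>2 h\<close>.  So left of \<open>2 h\<close> the
vector \<open>T (u + w)\<close> shows \<open>T u\<close>, and right of it \<open>T w\<close>, and the lower bounds on the two half-lines
apply to \<open>u\<close> and \<open>w\<close> separately.\<close>

lemma finite_sections_bounded_below:
  fixes T B :: "(int, 'a::euclidean_space) l2 \<Rightarrow> (int, 'a) l2"
  assumes T: "localized T" and B: "localized B" and BT: "\<And>x. B (T x) = x"
    and \<delta>: "\<delta> > 0"
      "\<And>x. cutoff {0..} x = x \<Longrightarrow> \<delta> * norm x \<le> norm (compress {0..} T x)"
      "\<And>n x. cutoff {..<int n} x = x \<Longrightarrow> \<delta> * norm x \<le> norm (compress {..<int n} T x)"
  shows "\<exists>\<eta>>0. \<exists>n0. \<forall>n\<ge>n0. \<forall>x. cutoff {0..<int n} x = x \<longrightarrow>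
           \<eta> * norm x \<le> norm (compress {0..<int n} T x)"
proof -
  note T' = localized_bounded_linear[OF T] and B' = localized_bounded_linear[OF B]
  obtain C s where C: "C > 0" "0 < s" "s < 1"
    and locT: "\<And>d S S' x. (\<And>i j. i \<in> S \<Longrightarrow> j \<in> S' \<Longrightarrow> int d \<le> \<bar>i - j\<bar>) \<Longrightarrow>
        norm (cutoff S (T (cutoff S' x))) \<le> C * s ^ d * norm x"
    and locB: "\<And>d S S' x. (\<And>i j. i \<in> S \<Longrightarrow> j \<in> S' \<Longrightarrow> int d \<le> \<bar>i - j\<bar>) \<Longrightarrow>
        norm (cutoff S (B (cutoff S' x))) \<le> C * s ^ d * norm x"
    and TC: "\<And>x. norm (T x) \<le> C * norm x" and BC: "\<And>x. norm (B x) \<le> C * norm x"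
    by (rule localized_common[OF T B]) blast
  note bc = bounded_linear_cutoff
  define G where "G = 2 * (C + 2 * (1 + C * C) / \<delta>)"
  have "G > 0" using C \<delta>(1) by (auto simp: G_def intro!: add_pos_pos mult_pos_pos divide_pos_pos)
  have "(\<lambda>h. 8 * (C * C * C) / \<delta> * s ^ h) \<longlonglongrightarrow> 0"
    using tendsto_mult_left[OF LIMSEQ_realpow_zero[of s], of "8 * (C * C * C) / \<delta>"] C by simp
  then have "\<forall>\<^sub>F h in sequentially. 8 * (C * C * C) / \<delta> * s ^ h < 1 / 2"
    by (rule order_tendstoD(2)) simp
  then obtain h0 where h0: "\<And>h. h \<ge> h0 \<Longrightarrow> 8 * (C * C * C) / \<delta> * s ^ h < 1 / 2"
    unfolding eventually_sequentially by blast
  have main: "norm x \<le> G * norm (compress {0..<int n} T x)"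
    if n: "n \<ge> 4 * h0" and x: "cutoff {0..<int n} x = x" for n x
  proof -
    \<comment> \<open>Four disjoint stretches of length \<open>h\<close> fit into \<open>{0..<n}\<close>: \<open>u\<close> decays over the first, \<open>T u\<close>
      over the second, \<open>T w\<close> and \<open>w\<close> over the third and the fourth.\<close>
    define h where "h = n div 4"
    have "h \<ge> h0" "4 * h \<le> n" using n by (auto simp: h_def)
    define y where "y = cutoff {0..<int n} (T x)"
    define u where "u = cutoff {0..<int n} (B (cutoff {..<0} (T x)))"
    define w where "w = cutoff {0..<int n} (B (cutoff {int n..} (T x)))"
    define r where "r = C * C * C * s ^ h * norm x"
    have y_eq: "compress {0..<int n} T x = y" by (simp add: compress_def y_def x)
    have Tx: "T x = y + cutoff {..<0} (T x) + cutoff {int n..} (T x)"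
      by (intro l2_eqI) (auto simp: y_def)
    have x_eq: "x = cutoff {0..<int n} (B y) + u + w"
    proof -
      have "x = cutoff {0..<int n} (B (T x))" by (simp add: BT x)
      also have "B (T x) = B y + B (cutoff {..<0} (T x)) + B (cutoff {int n..} (T x))"
        by (subst Tx) (simp add: bl_add[OF B'])
      finally show ?thesis by (simp add: bl_add[OF bc] u_def w_def)
    qed
    have uw: "norm (cutoff {0..<int n} (T (u + w))) \<le> (1 + C * C) * norm y"
    proof -
      have "u + w = x - cutoff {0..<int n} (B y)" using x_eq by simp
      then have "cutoff {0..<int n} (T (u + w)) = y - cutoff {0..<int n} (T (cutoff {0..<int n} (B y)))"
        by (simp add: bl_diff[OF bc] bl_diff[OF T'] y_def)
      also have "norm \<dots> \<le> norm y + norm (T (cutoff {0..<int n} (B y)))"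
        by (intro order_trans[OF norm_triangle_ineq4] add_left_mono norm_cutoff_le)
      also have "norm (T (cutoff {0..<int n} (B y))) \<le> C * (C * norm y)"
        using C by (intro order_trans[OF TC] mult_left_mono order_trans[OF norm_cutoff_le] BC) auto
      finally show ?thesis by (simp add: algebra_simps)
    qed
    have norm_uw: "norm u \<le> C * C * norm x" "norm w \<le> C * C * norm x"
      unfolding u_def w_def mult.assoc using C
      by (intro order_trans[OF norm_cutoff_le] order_trans[OF BC] mult_left_mono TC; simp)+
    have s1: "C * s ^ h * norm z \<le> C * s ^ h * (C * norm x)" if "norm z \<le> C * norm x" for z
      using that C by (intro mult_left_mono) auto
    have uh: "norm (cutoff {int h..} u) \<le> C * s ^ h * (C * norm x)"
    proof -
      have "cutoff {int h..} u = cutoff {int h..<int n} (B (cutoff {..<0} (T x)))"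
        unfolding u_def by (intro l2_eqI) auto
      also have "norm \<dots> \<le> C * s ^ h * norm (T x)" by (rule locB) auto
      also have "\<dots> \<le> C * s ^ h * (C * norm x)" by (rule s1[OF TC])
      finally show ?thesis .
    qed
    have wh: "norm (cutoff {..<int n - int h} w) \<le> C * s ^ h * (C * norm x)"
    proof -
      have "cutoff {..<int n - int h} w = cutoff {0..<int n - int h} (B (cutoff {int n..} (T x)))"
        unfolding w_def by (intro l2_eqI) auto
      also have "norm \<dots> \<le> C * s ^ h * norm (T x)" by (rule locB) auto
      also have "\<dots> \<le> C * s ^ h * (C * norm x)" by (rule s1[OF TC])
      finally show ?thesis .
    qed
    have far: "norm (cutoff S (T z)) \<le> 2 * r"
      if z: "norm z \<le> C * C * norm x" and S': "norm (cutoff (- S') z) \<le> C * s ^ h * (C * norm x)"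
        and dist: "\<And>i j. i \<in> S \<Longrightarrow> j \<in> S' \<Longrightarrow> int h \<le> \<bar>i - j\<bar>" for S S' z
    proof -
      have "cutoff S (T z) = cutoff S (T (cutoff S' z)) + cutoff S (T (cutoff (- S') z))"
        by (simp add: bl_add[OF bc, symmetric] bl_add[OF T', symmetric] cutoff_add_Compl)
      also have "norm \<dots> \<le> C * s ^ h * norm z + C * norm (cutoff (- S') z)"
        by (intro order_trans[OF norm_triangle_ineq] add_mono locT dist
            order_trans[OF norm_cutoff_le] TC)
      also have "\<dots> \<le> C * s ^ h * (C * C * norm x) + C * (C * s ^ h * (C * norm x))"
        using C by (intro add_mono mult_left_mono z S') auto
      finally show ?thesis by (simp add: r_def algebra_simps)
    qed
    have far_u: "norm (cutoff S (T u)) \<le> 2 * r" if "S \<subseteq> {2 * int h..}" for S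
      by (rule far[of u "{..<int h}" S, OF norm_uw(1)]) (use uh that in \<open>auto simp: Compl_lessThan\<close>)
    have far_w: "norm (cutoff S (T w)) \<le> 2 * r" if "S \<subseteq> {..<2 * int h}" for S
      by (rule far[of w "{int n - int h..}" S, OF norm_uw(2)])
        (use wh that \<open>4 * h \<le> n\<close> in \<open>auto simp: Compl_atLeast\<close>)
    have inner_part: "norm (cutoff S (T (u + w))) \<le> (1 + C * C) * norm y" if "S \<subseteq> {0..<int n}" for S
    proof -
      have "cutoff S (T (u + w)) = cutoff S (cutoff {0..<int n} (T (u + w)))"
        using that by (simp add: Int_absorb2)
      then show ?thesis using order_trans[OF norm_cutoff_le uw] by metis
    qed
    have u_le: "\<delta> * norm u \<le> (1 + C * C) * norm y + 4 * r"
    proof -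
      have u: "cutoff {0..} u = u" unfolding u_def by (intro l2_eqI) simp
      have "compress {0..} T u = cutoff {0..<2 * int h} (T (u + w)) - cutoff {0..<2 * int h} (T w)
            + cutoff {2 * int h..} (T u)"
        unfolding compress_def u by (intro l2_eqI) (auto simp: bl_add[OF T'])
      also have "norm \<dots> \<le> (1 + C * C) * norm y + 2 * r + 2 * r"
        using \<open>4 * h \<le> n\<close> by (intro order_trans[OF norm_triangle_ineq] add_mono
            order_trans[OF norm_triangle_ineq4] inner_part far_u far_w) auto
      finally show ?thesis using \<delta>(2)[OF u] by simp
    qed
    have w_le: "\<delta> * norm w \<le> (1 + C * C) * norm y + 4 * r"
    proof -
      have w: "cutoff {..<int n} w = w" unfolding w_def by (intro l2_eqI) simp
      have "compress {..<int n} T w = cutoff {2 * int h..<int n} (T (u + w))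
            - cutoff {2 * int h..<int n} (T u) + cutoff {..<2 * int h} (T w)"
        unfolding compress_def w using \<open>4 * h \<le> n\<close> by (intro l2_eqI) (auto simp: bl_add[OF T'])
      also have "norm \<dots> \<le> (1 + C * C) * norm y + 2 * r + 2 * r"
        using \<open>4 * h \<le> n\<close> by (intro order_trans[OF norm_triangle_ineq] add_mono
            order_trans[OF norm_triangle_ineq4] inner_part far_u far_w) auto
      finally show ?thesis using \<delta>(3)[OF w] by simp
    qed
    have "norm x \<le> norm (cutoff {0..<int n} (B y)) + norm u + norm w"
      using x_eq norm_triangle_ineq[of "cutoff {0..<int n} (B y) + u" w]
        norm_triangle_ineq[of "cutoff {0..<int n} (B y)" u] by simp
    also have "\<dots> \<le> C * norm y + ((1 + C * C) * norm y + 4 * r) / \<delta> + ((1 + C * C) * norm y + 4 * r) / \<delta>"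
      using u_le w_le \<delta>(1) by (intro add_mono order_trans[OF norm_cutoff_le BC])
        (simp_all add: field_simps)
    also have "\<dots> = G / 2 * norm y + 8 * (C * C * C) / \<delta> * s ^ h * norm x"
      using \<delta>(1) by (simp add: G_def r_def field_simps)
    also have "\<dots> \<le> G / 2 * norm y + 1 / 2 * norm x"
      using h0[OF \<open>h \<ge> h0\<close>] by (intro add_left_mono mult_right_mono) auto
    finally show ?thesis by (simp add: y_eq)
  qed
  show ?thesis
  proof (rule exI[of _ "1 / G"], intro conjI exI[of _ "4 * h0"] allI impI)
    show "1 / G > 0" using \<open>G > 0\<close> by simp
    show "1 / G * norm x \<le> norm (compress {0..<int n} T x)"
      if "n \<ge> 4 * h0" "cutoff {0..<int n} x = x" for n x
      using main[OF that] \<open>G > 0\<close> by (simp add: field_simps)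
  qed
qed

section \<open>Laurent series of rational functions on the unit circle\<close>

lemma decaying_common:
  assumes "decaying a" "decaying b"
  obtains \<rho> where "\<rho> > (1::real)" "(\<lambda>k. norm (a k) * \<rho> ^ nat \<bar>k\<bar>) summable_on UNIV"
    "(\<lambda>k. norm (b k) * \<rho> ^ nat \<bar>k\<bar>) summable_on UNIV"
proof -
  obtain \<rho>1 where 1: "\<rho>1 > 1" "(\<lambda>k. norm (a k) * \<rho>1 ^ nat \<bar>k\<bar>) summable_on UNIV"
    using assms(1) by (rule decayingE)
  obtain \<rho>2 where 2: "\<rho>2 > 1" "(\<lambda>k. norm (b k) * \<rho>2 ^ nat \<bar>k\<bar>) summable_on UNIV"
    using assms(2) by (rule decayingE)
  show thesis
  proof (rule that[of "min \<rho>1 \<rho>2"])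
    show "(\<lambda>k. norm (a k) * min \<rho>1 \<rho>2 ^ nat \<bar>k\<bar>) summable_on UNIV"
      by (rule decaying_weaken[OF 1(2)]) (use 1 2 in auto)
    show "(\<lambda>k. norm (b k) * min \<rho>1 \<rho>2 ^ nat \<bar>k\<bar>) summable_on UNIV"
      by (rule decaying_weaken[OF 2(2)]) (use 1 2 in auto)
  qed (use 1 2 in auto)
qed

lemma decaying_mono:
  assumes "decaying b" "\<And>k. norm (a k) \<le> norm (b k)"
  shows "decaying a"
proof -
  obtain \<rho> where \<rho>: "\<rho> > 1" "(\<lambda>k. norm (b k) * \<rho> ^ nat \<bar>k\<bar>) summable_on UNIV"
    using assms(1) by (rule decayingE)
  have "(\<lambda>k. norm (a k) * \<rho> ^ nat \<bar>k\<bar>) summable_on UNIV"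
    using \<rho>(2) by (rule summable_on_comparison_test) (use \<rho> assms(2) in \<open>auto intro!: mult_right_mono\<close>)
  with \<rho>(1) show ?thesis by (auto simp: decaying_def)
qed

lemma decaying_finite_support:
  assumes "finite {k. a k \<noteq> 0}"
  shows "decaying a"
  unfolding decaying_def
proof (intro exI conjI)
  show "(\<lambda>k. norm (a k) * 2 ^ nat \<bar>k\<bar>) summable_on UNIV"
    by (rule finite_nonzero_values_imp_summable_on) (use assms in simp)
qed simp

lemma decaying_add:
  assumes "decaying a" "decaying b"
  shows "decaying (\<lambda>k. a k + b k)"
proof -
  obtain \<rho> where \<rho>: "\<rho> > (1::real)" "(\<lambda>k. norm (a k) * \<rho> ^ nat \<bar>k\<bar>) summable_on UNIV"
    "(\<lambda>k. norm (b k) * \<rho> ^ nat \<bar>k\<bar>) summable_on UNIV"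
    using assms by (rule decaying_common)
  have "(\<lambda>k. norm (a k + b k) * \<rho> ^ nat \<bar>k\<bar>) summable_on UNIV"
    using summable_on_add[OF \<rho>(2,3)]
  proof (rule summable_on_comparison_test)
    show "norm (a k + b k) * \<rho> ^ nat \<bar>k\<bar> \<le> norm (a k) * \<rho> ^ nat \<bar>k\<bar> + norm (b k) * \<rho> ^ nat \<bar>k\<bar>" for k
      unfolding distrib_right[symmetric] using \<rho>(1) by (intro mult_right_mono norm_triangle_ineq) auto
  qed (use \<rho>(1) in auto)
  with \<rho>(1) show ?thesis by (auto simp: decaying_def)
qed

lemma decaying_sum:
  assumes "\<And>i. i \<in> I \<Longrightarrow> decaying (a i)"
  shows "decaying (\<lambda>k. \<Sum>i\<in>I. a i k)"
  using assms by (induction I rule: infinite_finite_induct)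
    (auto intro: decaying_add decaying_finite_support)

text \<open>Follows from submultiplicativity of the weight, since \<open>\<bar>m\<bar> \<le> \<bar>k\<bar> + \<bar>m - k\<bar>\<close>.\<close>

lemma decaying_convolution:
  fixes a b :: "int \<Rightarrow> complex"
  assumes "decaying a" "decaying b"
  shows "decaying (\<lambda>m. \<Sum>\<^sub>\<infinity>k. a k * b (m - k))"
proof -
  obtain \<rho> where \<rho>: "\<rho> > (1::real)" and u: "(\<lambda>k. norm (a k) * \<rho> ^ nat \<bar>k\<bar>) summable_on UNIV"
    and v: "(\<lambda>k. norm (b k) * \<rho> ^ nat \<bar>k\<bar>) summable_on UNIV"
    using assms by (rule decaying_common)
  define h where "h k l = (norm (a k) * \<rho> ^ nat \<bar>k\<bar>) * (norm (b l) * \<rho> ^ nat \<bar>l\<bar>)" for k l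
  have h: "norm (h k l) \<le> (norm (a k) * \<rho> ^ nat \<bar>k\<bar>) * (norm (b l) * \<rho> ^ nat \<bar>l\<bar>)" for k l
    using \<rho> by (simp add: h_def abs_mult)
  note conv = summable_convolution[where h = h, OF u _ v _ h]
  have le: "norm (\<Sum>\<^sub>\<infinity>k. a k * b (m - k)) * \<rho> ^ nat \<bar>m\<bar> \<le> (\<Sum>\<^sub>\<infinity>k. h k (m - k))" for m
  proof -
    have "norm (\<Sum>\<^sub>\<infinity>k. \<rho> ^ nat \<bar>m\<bar> *\<^sub>R (a k * b (m - k))) \<le> (\<Sum>\<^sub>\<infinity>k. h k (m - k))"
    proof (rule norm_infsum_le)
      show "((\<lambda>k. h k (m - k)) has_sum (\<Sum>\<^sub>\<infinity>k. h k (m - k))) UNIV"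
        by (intro has_sum_infsum conv(1)) (use \<rho> in auto)
      have "(\<lambda>k. a k * b (m - k)) summable_on UNIV"
        by (rule summable_convolution(1)[OF decaying_abs_summable[OF assms(1)] _
              decaying_abs_summable[OF assms(2)]]) (auto simp: norm_mult)
      then show "((\<lambda>k. \<rho> ^ nat \<bar>m\<bar> *\<^sub>R (a k * b (m - k))) has_sum
          (\<Sum>\<^sub>\<infinity>k. \<rho> ^ nat \<bar>m\<bar> *\<^sub>R (a k * b (m - k)))) UNIV"
        by (intro has_sum_infsum summable_on_scaleR_right)
      show "norm (\<rho> ^ nat \<bar>m\<bar> *\<^sub>R (a k * b (m - k))) \<le> h k (m - k)" for k
      proof -
        have "\<rho> ^ nat \<bar>m\<bar> \<le> \<rho> ^ (nat \<bar>k\<bar> + nat \<bar>m - k\<bar>)"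
          using \<rho> by (intro power_increasing) auto
        then have "norm (a k) * norm (b (m - k)) * \<rho> ^ nat \<bar>m\<bar>
            \<le> norm (a k) * norm (b (m - k)) * (\<rho> ^ nat \<bar>k\<bar> * \<rho> ^ nat \<bar>m - k\<bar>)"
          unfolding power_add by (intro mult_left_mono) auto
        then show ?thesis using \<rho> by (simp add: h_def norm_mult mult_ac)
      qed
    qed
    then show ?thesis using \<rho> by (simp add: infsum_scaleR_right mult_ac)
  qed
  have "(\<lambda>m. norm (\<Sum>\<^sub>\<infinity>k. a k * b (m - k)) * \<rho> ^ nat \<bar>m\<bar>) summable_on UNIV"
    by (rule summable_on_comparison_test[OF has_sum_imp_summable[OF conv(2)]])
      (use \<rho> le in auto)
  with \<rho> show ?thesis by (auto simp: decaying_def)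
qed

text \<open>The series represents the function on the circle only; the decay makes it converge in an annulus
around the circle.\<close>

definition laurent_series :: "(complex \<Rightarrow> complex) \<Rightarrow> (int \<Rightarrow> complex) \<Rightarrow> bool" where
  "laurent_series f a \<longleftrightarrow>
     decaying a \<and> (\<forall>t\<in>sphere 0 1. ((\<lambda>k. a k * t powi k) has_sum f t) UNIV)"

lemma laurent_series_cong:
  "laurent_series f a \<Longrightarrow> (\<And>t. t \<in> sphere 0 1 \<Longrightarrow> f t = g t) \<Longrightarrow> laurent_series g a"
  by (auto simp: laurent_series_def)

lemma norm_powi_circle: "t \<in> sphere 0 1 \<Longrightarrow> norm ((t::complex) powi k) = 1"
  by (simp add: norm_power_int)

lemma laurent_series_monomial:
  "laurent_series (\<lambda>t. c * t powi m) (\<lambda>k. if k = m then c else 0)"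
  unfolding laurent_series_def
proof (intro conjI ballI)
  show "decaying (\<lambda>k. if k = m then c else 0)"
    by (rule decaying_finite_support, rule finite_subset[of _ "{m}"]) auto
  show "((\<lambda>k. (if k = m then c else 0) * t powi k) has_sum c * t powi m) UNIV" for t
    by (rule has_sum_finite_neutralI[of "{m}"]) auto
qed

lemma laurent_series_sum:
  assumes "\<And>i. i \<in> I \<Longrightarrow> laurent_series (f i) (a i)" "finite I"
  shows "laurent_series (\<lambda>t. \<Sum>i\<in>I. f i t) (\<lambda>k. \<Sum>i\<in>I. a i k)"
proof -
  have "((\<lambda>k. \<Sum>i\<in>I. a i k * t powi k) has_sum (\<Sum>i\<in>I. f i t)) UNIV" if "t \<in> sphere 0 1" for t
    using assms(2,1) that
    by (induction I) (auto simp: laurent_series_def intro!: has_sum_add)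
  then show ?thesis
    using assms(1) by (auto simp: laurent_series_def sum_distrib_right intro!: decaying_sum)
qed

lemma laurent_series_mult:
  assumes f: "laurent_series f a" and g: "laurent_series g b"
  shows "laurent_series (\<lambda>t. f t * g t) (\<lambda>m. \<Sum>\<^sub>\<infinity>k. a k * b (m - k))"
  unfolding laurent_series_def
proof (intro conjI ballI)
  have d: "decaying a" "decaying b" using f g by (auto simp: laurent_series_def)
  then show "decaying (\<lambda>m. \<Sum>\<^sub>\<infinity>k. a k * b (m - k))" by (rule decaying_convolution)
  fix t :: complex assume t: "t \<in> sphere 0 1"
  then have "t \<noteq> 0" by auto
  define h where "h k l = (a k * t powi k) * (b l * t powi l)" for k l
  have "norm (h k l) \<le> norm (a k) * norm (b l)" for k l
    by (simp add: h_def norm_mult norm_powi_circle[OF t])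
  then have "((\<lambda>m. \<Sum>\<^sub>\<infinity>k. h k (m - k)) has_sum (\<Sum>\<^sub>\<infinity>k. \<Sum>\<^sub>\<infinity>l. h k l)) UNIV"
    by (intro summable_convolution(2)[where h = h and u = "\<lambda>k. norm (a k)" and v = "\<lambda>l. norm (b l)"]
        decaying_abs_summable d) auto
  moreover have "(\<Sum>\<^sub>\<infinity>k. h k (m - k)) = (\<Sum>\<^sub>\<infinity>k. a k * b (m - k)) * t powi m" for m
  proof -
    have "(\<Sum>\<^sub>\<infinity>k. h k (m - k)) = (\<Sum>\<^sub>\<infinity>k. (a k * b (m - k)) * t powi m)"
      using \<open>t \<noteq> 0\<close> by (intro infsum_cong) (simp add: h_def power_int_diff)
    then show ?thesis by (simp add: infsum_cmult_left')
  qed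
  moreover have "(\<Sum>\<^sub>\<infinity>k. \<Sum>\<^sub>\<infinity>l. h k l) = f t * g t"
  proof -
    have "infsum (\<lambda>k. a k * t powi k) UNIV = f t" "infsum (\<lambda>l. b l * t powi l) UNIV = g t"
      using f g t by (auto simp: laurent_series_def intro!: infsumI)
    then show ?thesis by (simp add: h_def infsum_cmult_left' infsum_cmult_right')
  qed
  ultimately show "((\<lambda>m. (\<Sum>\<^sub>\<infinity>k. a k * b (m - k)) * t powi m) has_sum f t * g t) UNIV" by simp
qed

lemma laurent_series_reflect:
  assumes "laurent_series f a"
  shows "laurent_series (\<lambda>t. f (1 / t)) (\<lambda>k. a (- k))"
  unfolding laurent_series_def
proof (intro conjI ballI)
  show "decaying (\<lambda>k. a (- k))" using assms by (auto simp: laurent_series_def intro: decaying_reflect)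
  fix t :: complex assume t: "t \<in> sphere 0 1"
  then have "((\<lambda>k. a k * (1 / t) powi k) has_sum f (1 / t)) UNIV"
    using assms by (auto simp: laurent_series_def norm_divide)
  then show "((\<lambda>k. a (- k) * t powi k) has_sum f (1 / t)) UNIV"
    by (subst has_sum_reindex_bij_witness[of UNIV uminus uminus UNIV "\<lambda>k. a k * (1 / t) powi k"])
      (auto simp: power_int_minus power_int_one_over power_int_inverse field_simps)
qed

lemma laurent_series_geometric:
  assumes w: "norm w < 1"
  shows "laurent_series (\<lambda>t. 1 / (1 - w * t)) (\<lambda>k. if k \<ge> 0 then w ^ nat k else 0)"
  unfolding laurent_series_def
proof (intro conjI ballI)
  \<comment> \<open>Chosen between \<open>1\<close> and \<open>1 / norm w\<close>, so that the weighted series is still geometric.\<close>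
  define \<rho> where "\<rho> = 2 / (1 + norm w)"
  have \<rho>: "\<rho> > 1" "norm w * \<rho> < 1" "\<rho> > 0"
    using w by (auto simp: \<rho>_def add_pos_nonneg field_simps)
  have nat_int: "((\<lambda>k. if k \<ge> 0 then F (nat k) else 0) has_sum S) UNIV"
    if "(F has_sum S) UNIV" for F :: "nat \<Rightarrow> 'a::{real_normed_vector}" and S
  proof -
    have "((\<lambda>k. F (nat k)) has_sum S) {0..}"
      using that by (subst has_sum_reindex_bij_witness[of "{0..}" int nat UNIV F]) auto
    then show ?thesis by (subst has_sum_cong_neutral[of "{0..}" UNIV "\<lambda>k. F (nat k)"]) auto
  qed
  have "((\<lambda>k. (norm w * \<rho>) ^ k) has_sum (1 / (1 - norm w * \<rho>))) UNIV"
    by (rule sums_nonneg_imp_has_sum) (use \<rho> in \<open>auto intro!: geometric_sums\<close>)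
  from nat_int[OF this] have "(\<lambda>k::int. if k \<ge> 0 then (norm w * \<rho>) ^ nat k else 0) summable_on UNIV"
    by (rule has_sum_imp_summable)
  then have "(\<lambda>k. norm (if k \<ge> 0 then w ^ nat k else 0) * \<rho> ^ nat \<bar>k\<bar>) summable_on UNIV"
    by (rule summable_on_cong[THEN iffD1, rotated]) (auto simp: norm_power power_mult_distrib)
  with \<rho>(1) show "decaying (\<lambda>k. if k \<ge> 0 then w ^ nat k else 0)" unfolding decaying_def by blast
  fix t :: complex assume t: "t \<in> sphere 0 1"
  then have wt: "norm (w * t) < 1" using w by (simp add: norm_mult)
  have "((\<lambda>k. (w * t) ^ k) has_sum (1 / (1 - w * t))) UNIV"
    by (rule norm_summable_imp_has_sum)
      (use wt in \<open>auto simp: norm_power intro!: geometric_sums summable_geometric\<close>)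
  from nat_int[OF this]
  show "((\<lambda>k. (if k \<ge> 0 then w ^ nat k else 0) * t powi k) has_sum 1 / (1 - w * t)) UNIV"
    by (rule has_sum_cong[THEN iffD1, rotated]) (auto simp: power_int_def power_mult_distrib)
qed

text \<open>Poles inside the circle give a geometric series in \<open>1 / t\<close>, poles outside one in \<open>t\<close>.\<close>

lemma laurent_series_inverse_linear:
  assumes "z \<notin> sphere 0 1"
  shows "\<exists>a. laurent_series (\<lambda>t. 1 / (t - z)) a"
proof (cases "norm z < 1")
  case True
  have "\<exists>a. laurent_series (\<lambda>t. (1 * t powi (- 1)) * (1 / (1 - z * (1 / t)))) a"
    using laurent_series_mult[OF laurent_series_monomial
        laurent_series_reflect[OF laurent_series_geometric[OF True]]] by blast
  then show ?thesis
  proof (rule ex_forward, elim laurent_series_cong)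
    show "1 * t powi (- 1) * (1 / (1 - z * (1 / t))) = 1 / (t - z)" if "t \<in> sphere 0 1" for t
      using that by (auto simp: power_int_minus field_simps)
  qed
next
  case False
  then have "norm z > 1" using assms by auto
  then have z: "norm (1 / z) < 1" "z \<noteq> 0" by (auto simp: norm_divide divide_less_eq)
  have "\<exists>a. laurent_series (\<lambda>t. (- 1 / z * t powi 0) * (1 / (1 - 1 / z * t))) a"
    using laurent_series_mult[OF laurent_series_monomial laurent_series_geometric[OF z(1)]] by blast
  then show ?thesis
  proof (rule ex_forward, elim laurent_series_cong)
    show "- 1 / z * t powi 0 * (1 / (1 - 1 / z * t)) = 1 / (t - z)" if "t \<in> sphere 0 1" for t
    proof -
      have "t \<noteq> z" using that assms by auto
      then have "t - z \<noteq> 0" "z - t \<noteq> 0" by auto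
      with z show ?thesis by (simp add: divide_simps)
    qed
  qed
qed

lemma laurent_series_poly: "\<exists>a. laurent_series (poly p) a"
proof -
  have "laurent_series (\<lambda>t. \<Sum>i\<le>degree p. coeff p i * t powi int i)
      (\<lambda>k. \<Sum>i\<le>degree p. if k = int i then coeff p i else 0)"
    by (intro laurent_series_sum laurent_series_monomial) auto
  then have "laurent_series (poly p) (\<lambda>k. \<Sum>i\<le>degree p. if k = int i then coeff p i else 0)"
    by (rule laurent_series_cong) (simp add: poly_altdef)
  then show ?thesis by blast
qed

lemma laurent_series_prod:
  assumes "finite I" "\<And>i. i \<in> I \<Longrightarrow> \<exists>a. laurent_series (f i) a"
  shows "\<exists>a. laurent_series (\<lambda>t. \<Prod>i\<in>I. f i t) a"
  using assms
proof (induction I)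
  case empty
  show ?case using laurent_series_monomial[of 1 0] by auto
next
  case (insert i I)
  then obtain a b where "laurent_series (f i) a" "laurent_series (\<lambda>t. \<Prod>i\<in>I. f i t) b" by blast
  from laurent_series_mult[OF this] insert.hyps show ?case by auto
qed

text \<open>By the fundamental theorem of algebra the denominator splits into linear factors whose roots avoid
the circle; their inverses have exponentially decaying Laurent series, and such functions form an
algebra.\<close>

lemma laurent_series_rational:
  assumes "rational_on_circle f"
  shows "\<exists>a. laurent_series f a"
proof -
  obtain p q where q: "\<And>t. t \<in> sphere 0 1 \<Longrightarrow> poly q t \<noteq> 0"
    and f: "\<And>t. t \<in> sphere 0 1 \<Longrightarrow> f t = poly p t / poly q t"
    using assms unfolding rational_on_circle_def by blast
  obtain root where "smult (lead_coeff q) (\<Prod>i<degree q. [:- root i, 1:]) = q"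
    by (rule complex_poly_decompose')
  from arg_cong[OF this, of poly]
  have q_eq: "poly q t = lead_coeff q * (\<Prod>i<degree q. t - root i)" for t
    by (auto simp: poly_prod fun_eq_iff algebra_simps)
  have "root i \<notin> sphere 0 1" if "i < degree q" for i
    using q[of "root i"] that by (force simp: q_eq prod_zero_iff)
  then have "\<exists>a. laurent_series (\<lambda>t. \<Prod>i<degree q. 1 / (t - root i)) a"
    by (intro laurent_series_prod laurent_series_inverse_linear) auto
  then obtain a where a: "laurent_series (\<lambda>t. \<Prod>i<degree q. 1 / (t - root i)) a" ..
  obtain b where b: "laurent_series (poly p) b" using laurent_series_poly by blast
  have "\<exists>c. laurent_series (\<lambda>t. (1 / lead_coeff q * t powi 0) *
      (poly p t * (\<Prod>i<degree q. 1 / (t - root i)))) c"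
    using laurent_series_mult[OF laurent_series_monomial laurent_series_mult[OF b a]] by blast
  then show ?thesis
  proof (rule ex_forward, elim laurent_series_cong)
    show "1 / lead_coeff q * t powi 0 * (poly p t * (\<Prod>i<degree q. 1 / (t - root i))) = f t"
      if "t \<in> sphere 0 1" for t
      using f[OF that] by (simp add: q_eq prod_dividef)
  qed
qed

lemma integral_character:
  "((\<lambda>\<theta>. exp (\<i> * of_int k * of_real \<theta>)) has_integral (if k = 0 then 2 * of_real pi else 0)) {0..2 * pi}"
proof (cases "k = 0")
  case True
  then show ?thesis using has_integral_const_real[of "1::complex" 0 "2 * pi"]
    by (simp add: scaleR_conv_of_real)
next
  case False
  let ?F = "\<lambda>\<theta>. exp (\<i> * of_int k * of_real \<theta>) / (\<i> * of_int k)"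
  have "((\<lambda>\<theta>. exp (\<i> * of_int k * of_real \<theta>)) has_integral ?F (2 * pi) - ?F 0) {0..2 * pi}"
  proof (rule fundamental_theorem_of_calculus)
    show "(?F has_vector_derivative exp (\<i> * of_int k * of_real \<theta>)) (at \<theta> within {0..2 * pi})" for \<theta>
      using False
      by (auto intro!: derivative_eq_intros has_vector_derivative_real_field simp: field_simps)
  qed simp
  moreover have "exp (\<i> * of_int k * of_real (2 * pi)) = 1"
    using exp_integer_2pi[of "of_int k"] by (simp add: mult_ac)
  ultimately show ?thesis using False by simp
qed

text \<open>The series converges uniformly on the circle, so it may be integrated term by term against a
character.\<close>

lemma laurent_series_coeff:
  assumes "laurent_series f a"
  shows "a m = 1 / (2 * of_real pi) *
    integral {0..2 * pi} (\<lambda>\<theta>. f (exp (\<i> * of_real \<theta>)) * exp (- (\<i> * of_int m * of_real \<theta>)))"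
proof -
  define g where "g k \<theta> = a k * exp (\<i> * of_int (k - m) * of_real \<theta>)" for k and \<theta> :: real
  let ?G = "\<lambda>\<theta>. f (exp (\<i> * of_real \<theta>)) * exp (- (\<i> * of_int m * of_real \<theta>))"
  have circ: "exp (\<i> * of_real \<theta>) \<in> sphere 0 1" for \<theta> by simp
  have sum: "((\<lambda>k. g k \<theta>) has_sum ?G \<theta>) UNIV" for \<theta>
  proof -
    have "((\<lambda>k. a k * exp (\<i> * of_real \<theta>) powi k) has_sum f (exp (\<i> * of_real \<theta>))) UNIV"
      using assms circ by (auto simp: laurent_series_def)
    from has_sum_cmult_left[OF this, of "exp (- (\<i> * of_int m * of_real \<theta>))"] show ?thesis
      by (rule has_sum_cong[THEN iffD1, rotated])
        (simp add: g_def exp_power_int exp_add[symmetric] exp_diff algebra_simps)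
  qed
  have unif: "uniform_limit {0..2 * pi} (\<lambda>X \<theta>. \<Sum>k\<in>X. g k \<theta>) ?G (finite_subsets_at_top UNIV)"
  proof (rule Weierstrass_m_test_general'[where M = "\<lambda>k. norm (a k)"])
    show "(\<lambda>k. norm (a k)) summable_on UNIV"
      using assms by (auto simp: laurent_series_def intro: decaying_abs_summable)
    show "norm (g k \<theta>) \<le> norm (a k)" for k \<theta>
      using norm_exp_i_times[of "of_int (k - m) * \<theta>"] by (simp add: g_def norm_mult mult.assoc)
  qed (rule sum)
  have cont: "continuous_on {0..2 * pi} (\<lambda>\<theta>. \<Sum>k\<in>X. g k \<theta>)" for X
    unfolding g_def by (intro continuous_intros)
  obtain I J where IJ: "\<And>X. ((\<lambda>\<theta>. \<Sum>k\<in>X. g k \<theta>) has_integral I X) {0..2 * pi}"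
    "(?G has_integral J) {0..2 * pi}" "(I \<longlongrightarrow> J) (finite_subsets_at_top UNIV)"
    by (rule uniform_limit_integral[OF unif cont finite_subsets_at_top_neq_bot], rule that)
  have I_eq: "I X = (\<Sum>k\<in>X. if k = m then 2 * of_real pi * a m else 0)" if "finite X" for X
  proof (rule has_integral_unique[OF IJ(1)], rule has_integral_sum[OF that])
    show "(g k has_integral (if k = m then 2 * of_real pi * a m else 0)) {0..2 * pi}" for k
      using has_integral_mult_right[OF integral_character[of "k - m"], of "a k"]
      unfolding g_def by (auto simp: mult_ac)
  qed
  have "((\<lambda>k. if k = m then 2 * of_real pi * a m else 0) has_sum J) UNIV"
    unfolding has_sum_def
    using IJ(3) by (rule Lim_transform_eventually)
      (auto intro!: eventually_finite_subsets_at_top_weakI simp: I_eq)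
  moreover have "((\<lambda>k. if k = m then 2 * of_real pi * a m else 0) has_sum 2 * of_real pi * a m) UNIV"
    by (rule has_sum_finite_neutralI[of "{m}"]) auto
  ultimately have "J = 2 * of_real pi * a m" by (rule has_sum_unique)
  then show ?thesis using IJ(2) by (simp add: integral_unique)
qed

lemma laurent_series_unique:
  assumes "laurent_series f a" "laurent_series f b"
  shows "a = b"
  using laurent_series_coeff[OF assms(1)] laurent_series_coeff[OF assms(2)] by (auto simp: fun_eq_iff)

lemma rational_on_circle_const: "rational_on_circle (\<lambda>_. c)"
  unfolding rational_on_circle_def by (intro exI[of _ "[:c:]"] exI[of _ 1]) simp

lemma rational_on_circle_add:
  assumes "rational_on_circle f" "rational_on_circle g"
  shows "rational_on_circle (\<lambda>t. f t + g t)"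
proof -
  obtain p q p' q' where "\<forall>t\<in>sphere 0 1. poly q t \<noteq> 0 \<and> f t = poly p t / poly q t"
    "\<forall>t\<in>sphere 0 1. poly q' t \<noteq> 0 \<and> g t = poly p' t / poly q' t"
    using assms unfolding rational_on_circle_def by blast
  then show ?thesis unfolding rational_on_circle_def
    by (intro exI[of _ "p * q' + p' * q"] exI[of _ "q * q'"]) (simp add: add_frac_eq)
qed

lemma rational_on_circle_mult:
  assumes "rational_on_circle f" "rational_on_circle g"
  shows "rational_on_circle (\<lambda>t. f t * g t)"
proof -
  obtain p q p' q' where "\<forall>t\<in>sphere 0 1. poly q t \<noteq> 0 \<and> f t = poly p t / poly q t"
    "\<forall>t\<in>sphere 0 1. poly q' t \<noteq> 0 \<and> g t = poly p' t / poly q' t"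
    using assms unfolding rational_on_circle_def by blast
  then show ?thesis unfolding rational_on_circle_def
    by (intro exI[of _ "p * p'"] exI[of _ "q * q'"]) simp
qed

lemma rational_on_circle_inverse:
  assumes "rational_on_circle f" "\<And>t. t \<in> sphere 0 1 \<Longrightarrow> f t \<noteq> 0"
  shows "rational_on_circle (\<lambda>t. 1 / f t)"
proof -
  obtain p q where pq: "\<forall>t\<in>sphere 0 1. poly q t \<noteq> 0 \<and> f t = poly p t / poly q t"
    using assms unfolding rational_on_circle_def by blast
  then have "poly p t \<noteq> 0" if "t \<in> sphere 0 1" for t using assms(2)[OF that] that by auto
  with pq show ?thesis unfolding rational_on_circle_def
    by (intro exI[of _ q] exI[of _ p]) simp
qed

lemma rational_on_circle_sum:
  "(\<And>i. i \<in> I \<Longrightarrow> rational_on_circle (f i)) \<Longrightarrow> rational_on_circle (\<lambda>t. \<Sum>i\<in>I. f i t)"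
  by (induction I rule: infinite_finite_induct)
    (auto intro: rational_on_circle_const rational_on_circle_add)

lemma rational_on_circle_prod:
  "(\<And>i. i \<in> I \<Longrightarrow> rational_on_circle (f i)) \<Longrightarrow> rational_on_circle (\<lambda>t. \<Prod>i\<in>I. f i t)"
  by (induction I rule: infinite_finite_induct)
    (auto intro: rational_on_circle_const rational_on_circle_mult)

lemma rational_on_circle_det:
  assumes "\<And>i j. rational_on_circle (\<lambda>t. M t $ i $ j)"
  shows "rational_on_circle (\<lambda>t. det (M t))"
  unfolding det_def
  by (intro rational_on_circle_sum rational_on_circle_mult rational_on_circle_prod
      rational_on_circle_const assms)

lemma matrix_vector_mult_axis: "((M :: complex ^ 'n ^ 'm) *v axis j 1) $ i = M $ i $ j"
  by (simp add: matrix_vector_mult_def axis_def if_distrib cong: if_cong)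

text \<open>Cramer's rule expresses the entries of the inverse as quotients of determinants, and the denominator
has no zeros on the circle.\<close>

lemma inverse_symbol_rational:
  assumes "A \<in> GR"
  obtains B where "\<And>i j. rational_on_circle (\<lambda>t. B t $ i $ j)"
    "\<And>t. t \<in> sphere 0 1 \<Longrightarrow> A t ** B t = mat 1" "\<And>t. t \<in> sphere 0 1 \<Longrightarrow> B t ** A t = mat 1"
proof -
  have A: "\<And>i j. rational_on_circle (\<lambda>t. A t $ i $ j)" "\<And>t. t \<in> sphere 0 1 \<Longrightarrow> det (A t) \<noteq> 0"
    using assms by (auto simp: GR_def)
  define B where "B t = (\<chi> k j. det (\<chi> i l. if l = k then axis j 1 $ i else A t $ i $ l) * (1 / det (A t)))" for t
  have AB: "A t ** B t = mat 1" if "t \<in> sphere 0 1" for t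
  proof -
    have "A t *v (B t *v axis j 1) = axis j 1" for j
      unfolding cramer[OF A(2)[OF that]]
      by (simp add: vec_eq_iff matrix_vector_mult_axis) (simp add: B_def)
    then have "((A t ** B t) *v axis j 1) $ i = (mat 1 *v axis j 1) $ i" for i j
      by (simp add: matrix_vector_mul_assoc)
    then have "(A t ** B t) $ i $ j = mat 1 $ i $ j" for i j
      unfolding matrix_vector_mult_axis .
    then show ?thesis by (simp add: vec_eq_iff)
  qed
  show thesis
  proof (rule that[of B])
    show "rational_on_circle (\<lambda>t. B t $ k $ j)" for k j
    proof -
      have "rational_on_circle (\<lambda>t. det (\<chi> i l. if l = k then axis j 1 $ i else A t $ i $ l))"
      proof (rule rational_on_circle_det)
        show "rational_on_circle (\<lambda>t. (\<chi> i l. if l = k then axis j 1 $ i else A t $ i $ l) $ i $ l)" for i l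
          by (cases "l = k") (auto intro: rational_on_circle_const A)
      qed
      from rational_on_circle_mult[OF this rational_on_circle_inverse[OF rational_on_circle_det[OF A(1)] A(2)]]
      show ?thesis by (simp add: B_def)
    qed
    show "B t ** A t = mat 1" if "t \<in> sphere 0 1" for t
      using AB[OF that] matrix_left_right_inverse by blast
  qed (rule AB)
qed

lemma has_sum_vec:
  fixes f :: "'a \<Rightarrow> 'b::real_normed_vector ^ 'n"
  assumes "\<And>i. ((\<lambda>k. f k $ i) has_sum S $ i) X"
  shows "(f has_sum S) X"
  using assms unfolding has_sum_def by (auto intro!: vec_tendstoI simp: sum_component)

lemma has_sum_finite_sum:
  fixes f :: "'i \<Rightarrow> 'a \<Rightarrow> 'b::topological_comm_monoid_add"
  assumes "\<And>i. i \<in> I \<Longrightarrow> (f i has_sum S i) X"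
  shows "((\<lambda>k. \<Sum>i\<in>I. f i k) has_sum (\<Sum>i\<in>I. S i)) X"
  using assms
  by (induction I rule: infinite_finite_induct) (auto intro!: has_sum_add)

lemma decaying_matrix:
  fixes a :: "int \<Rightarrow> complex ^ 'n ^ 'm"
  assumes "\<And>i j. decaying (\<lambda>k. a k $ i $ j)"
  shows "decaying a"
proof (rule decaying_mono)
  show "decaying (\<lambda>k. \<Sum>i\<in>UNIV. \<Sum>j\<in>UNIV. norm (a k $ i $ j))"
    using assms by (intro decaying_sum) (simp add: decaying_def)
  show "norm (a k) \<le> norm (\<Sum>i\<in>UNIV. \<Sum>j\<in>UNIV. norm (a k $ i $ j))" for k
  proof -
    have "norm (a k) \<le> (\<Sum>i\<in>UNIV. norm (a k $ i))" by (simp add: norm_vec_def L2_set_le_sum)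
    also have "\<dots> \<le> (\<Sum>i\<in>UNIV. \<Sum>j\<in>UNIV. norm (a k $ i $ j))"
      by (intro sum_mono) (simp add: norm_vec_def L2_set_le_sum)
    finally show ?thesis by simp
  qed
qed

text \<open>Entrywise, the convolution is the coefficient sequence of the product of the symbols, which is
constant on the circle; coefficients are unique.\<close>

lemma convolution_inverse_of_symbols:
  assumes a: "\<And>i j. laurent_series (\<lambda>t. A t $ i $ j) (\<lambda>k. a k $ i $ j)"
    and b: "\<And>i j. laurent_series (\<lambda>t. B t $ i $ j) (\<lambda>k. b k $ i $ j)"
    and AB: "\<And>t. t \<in> sphere 0 1 \<Longrightarrow> A t ** B t = mat 1"
  shows "convolution_inverse a b"
  unfolding convolution_inverse_def
proof (intro allI has_sum_vec)
  fix m i j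
  have da: "decaying (\<lambda>k. a k $ i $ l)" and db: "decaying (\<lambda>k. b k $ l $ j)" for l
    using a b by (auto simp: laurent_series_def)
  let ?c = "\<lambda>m. \<Sum>l\<in>UNIV. \<Sum>\<^sub>\<infinity>k. a k $ i $ l * b (m - k) $ l $ j"
  have "((\<lambda>k. \<Sum>l\<in>UNIV. a k $ i $ l * b (m - k) $ l $ j) has_sum ?c m) UNIV"
    by (intro has_sum_finite_sum has_sum_infsum
        summable_convolution(1)[OF decaying_abs_summable[OF da] _ decaying_abs_summable[OF db],
          where h = "\<lambda>k l'. a k $ i $ _ * b l' $ _ $ j"]) (auto simp: norm_mult)
  moreover have "?c = (\<lambda>k. if k = 0 then (if i = j then 1 else 0) else 0)"
  proof (rule laurent_series_unique)
    show "laurent_series (\<lambda>t. \<Sum>l\<in>UNIV. A t $ i $ l * B t $ l $ j) ?c"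
      by (intro laurent_series_sum laurent_series_mult a b) auto
    show "laurent_series (\<lambda>t. \<Sum>l\<in>UNIV. A t $ i $ l * B t $ l $ j)
        (\<lambda>k. if k = 0 then (if i = j then 1 else 0) else 0)"
    proof (rule laurent_series_cong[OF laurent_series_monomial])
      fix t :: complex assume "t \<in> sphere 0 1"
      from arg_cong[OF AB[OF this], of "\<lambda>M. M $ i $ j"]
      show "(if i = j then 1 else 0) * t powi 0 = (\<Sum>l\<in>UNIV. A t $ i $ l * B t $ l $ j)"
        by (simp add: matrix_matrix_mult_def mat_def)
    qed
  qed
  ultimately show "((\<lambda>k. (a k ** b (m - k)) $ i $ j) has_sum
      (if m = 0 then mat 1 else 0) $ i $ j) UNIV"
    by (simp add: matrix_matrix_mult_def mat_def fun_eq_iff split: if_splits)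
qed

lemma fourier_coeff_laurent_series:
  assumes "\<And>i j. rational_on_circle (\<lambda>t. A t $ i $ j)"
  shows "laurent_series (\<lambda>t. A t $ i $ j) (\<lambda>k. fourier_coeff A k $ i $ j)"
proof -
  obtain a where a: "laurent_series (\<lambda>t. A t $ i $ j) a"
    using laurent_series_rational[OF assms] by blast
  have "fourier_coeff A k $ i $ j = a k" for k
    unfolding fourier_coeff_def laurent_series_coeff[OF a] by simp
  with a show ?thesis by simp
qed

text \<open>This collects everything that the operator theory below uses about the class of symbols.\<close>

lemma GR_fourier_coeff:
  assumes "A \<in> GR"
  shows "decaying (fourier_coeff A)"
    and "fourier_coeff (reflected A) k = fourier_coeff A (- k)"
    and "\<exists>b. decaying b \<and> convolution_inverse (fourier_coeff A) b \<and> convolution_inverse b (fourier_coeff A)"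
proof -
  have A: "\<And>i j. rational_on_circle (\<lambda>t. A t $ i $ j)" using assms by (auto simp: GR_def)
  note a = fourier_coeff_laurent_series[OF A]
  show "decaying (fourier_coeff A)" using a by (intro decaying_matrix) (auto simp: laurent_series_def)
  have "fourier_coeff (reflected A) k $ i $ j = fourier_coeff A (- k) $ i $ j" for i j
    using laurent_series_coeff[OF laurent_series_reflect[OF a[of i j]], of k]
    by (simp add: fourier_coeff_def reflected_def)
  then show "fourier_coeff (reflected A) k = fourier_coeff A (- k)" by (simp add: vec_eq_iff)
  obtain B where B: "\<And>i j. rational_on_circle (\<lambda>t. B t $ i $ j)"
    and AB: "\<And>t. t \<in> sphere 0 1 \<Longrightarrow> A t ** B t = mat 1"
    and BA: "\<And>t. t \<in> sphere 0 1 \<Longrightarrow> B t ** A t = mat 1"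
    using inverse_symbol_rational[OF assms] by metis
  note b = fourier_coeff_laurent_series[OF B]
  have "decaying (fourier_coeff B)" using b by (intro decaying_matrix) (auto simp: laurent_series_def)
  with convolution_inverse_of_symbols[OF a b AB] convolution_inverse_of_symbols[OF b a BA]
  show "\<exists>b. decaying b \<and> convolution_inverse (fourier_coeff A) b \<and> convolution_inverse b (fourier_coeff A)"
    by blast
qed

section \<open>Finite block matrices\<close>

definition block_mult :: "nat \<Rightarrow> 'n::finite block_matrix \<Rightarrow> (nat \<Rightarrow> complex ^ 'n) \<Rightarrow> nat \<Rightarrow> complex ^ 'n" where
  "block_mult n M x j = (\<Sum>k<n. M j k *v x k)"

definition block_vec_norm :: "nat \<Rightarrow> (nat \<Rightarrow> complex ^ 'n) \<Rightarrow> real" where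
  "block_vec_norm n x = L2_set (\<lambda>k. norm (x k)) {..<n}"

lemma block_vec_norm_nonneg [simp]: "0 \<le> block_vec_norm n x"
  by (simp add: block_vec_norm_def)

lemma norm_le_block_vec_norm: "k < n \<Longrightarrow> norm (x k) \<le> block_vec_norm n x"
  unfolding block_vec_norm_def by (rule member_le_L2_set) auto

lemma block_vec_norm_eq_0_iff: "block_vec_norm n x = 0 \<longleftrightarrow> (\<forall>k<n. x k = 0)"
  by (simp add: block_vec_norm_def L2_set_eq_0_iff) auto

lemma block_vec_norm_cong: "(\<And>k. k < n \<Longrightarrow> x k = y k) \<Longrightarrow> block_vec_norm n x = block_vec_norm n y"
  by (simp add: block_vec_norm_def L2_set_def)

lemma block_vec_norm_scaleR: "block_vec_norm n (\<lambda>k. c *\<^sub>R x k) = \<bar>c\<bar> * block_vec_norm n x"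
  by (simp add: block_vec_norm_def L2_set_right_distrib)

lemma block_mult_scaleR: "block_mult n M (\<lambda>k. c *\<^sub>R x k) = (\<lambda>j. c *\<^sub>R block_mult n M x j)"
  by (simp add: block_mult_def matrix_vector_mult_scaleR scaleR_sum_right fun_eq_iff)

lemma block_mult_diff: "block_mult n M (\<lambda>k. x k - y k) j = block_mult n M x j - block_mult n M y j"
  by (simp add: block_mult_def matrix_vector_mult_diff_distrib sum_subtractf)

lemma block_mult_single:
  "k < n \<Longrightarrow> block_mult n M (\<lambda>i. if i = k then v else 0) j = M j k *v v"
  unfolding block_mult_def by (subst sum.remove[of _ k]) (auto intro!: sum.neutral)

lemma block_vec_norm_single: "k < n \<Longrightarrow> block_vec_norm n (\<lambda>i. if i = k then v else 0) = norm v"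
  unfolding block_vec_norm_def L2_set_def
  by (subst sum.remove[of _ k]) auto

lemma block_norm_alt: "block_norm n M =
    Sup {block_vec_norm n (block_mult n M x) | x. block_vec_norm n x \<le> 1}"
  by (simp add: block_norm_def block_vec_norm_def block_mult_def)

lemma bdd_above_block_norm:
  "bdd_above {block_vec_norm n (block_mult n M x) | x. block_vec_norm n x \<le> 1}"
proof (rule bdd_aboveI)
  fix r assume "r \<in> {block_vec_norm n (block_mult n M x) | x. block_vec_norm n x \<le> 1}"
  then obtain x where x: "r = block_vec_norm n (block_mult n M x)" "block_vec_norm n x \<le> 1" by blast
  have "r \<le> (\<Sum>j<n. norm (block_mult n M x j))"
    unfolding x(1) block_vec_norm_def by (rule L2_set_le_sum) simp
  also have "\<dots> \<le> (\<Sum>j<n. \<Sum>k<n. norm (M j k))"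
  proof (rule sum_mono)
    fix j
    have "norm (M j k *v x k) \<le> norm (M j k)" if "k < n" for k
    proof -
      have "norm (M j k *v x k) \<le> norm (M j k) * norm (x k)" by (rule norm_matrix_vector_mult_le)
      also have "\<dots> \<le> norm (M j k) * 1"
        using norm_le_block_vec_norm[OF that, of x] x(2) by (intro mult_left_mono) auto
      finally show ?thesis by simp
    qed
    then show "norm (block_mult n M x j) \<le> (\<Sum>k<n. norm (M j k))"
      unfolding block_mult_def by (intro sum_norm_le) auto
  qed
  finally show "r \<le> (\<Sum>j<n. \<Sum>k<n. norm (M j k))" .
qed

lemma block_norm_upper: "block_vec_norm n x \<le> 1 \<Longrightarrow> block_vec_norm n (block_mult n M x) \<le> block_norm n M"
  unfolding block_norm_alt by (rule cSup_upper[OF _ bdd_above_block_norm]) blast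

lemma block_norm_nonneg: "0 \<le> block_norm n M"
  using order_trans[OF block_vec_norm_nonneg block_norm_upper[of n "\<lambda>_. 0" M]]
  by (simp add: block_vec_norm_def L2_set_def)

lemma block_vec_norm_mult_le: "block_vec_norm n (block_mult n M x) \<le> block_norm n M * block_vec_norm n x"
proof (cases "block_vec_norm n x = 0")
  case True
  then have "block_mult n M x j = 0" for j
    by (simp add: block_vec_norm_eq_0_iff block_mult_def)
  then have "block_vec_norm n (block_mult n M x) = 0" by (simp add: block_vec_norm_eq_0_iff)
  then show ?thesis using True by simp
next
  case False
  then have pos: "block_vec_norm n x > 0" using block_vec_norm_nonneg[of n x] by linarith
  have "block_vec_norm n (block_mult n M (\<lambda>k. (1 / block_vec_norm n x) *\<^sub>R x k)) \<le> block_norm n M"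
    using pos by (intro block_norm_upper) (simp only: block_vec_norm_scaleR, simp)
  then show ?thesis
    using pos by (simp only: block_mult_scaleR block_vec_norm_scaleR) (simp add: field_simps)
qed

lemma block_norm_le:
  assumes "\<And>x. block_vec_norm n (block_mult n M x) \<le> K * block_vec_norm n x" "0 \<le> K"
  shows "block_norm n M \<le> K"
  unfolding block_norm_alt
proof (rule cSup_least)
  show "{block_vec_norm n (block_mult n M x) | x. block_vec_norm n x \<le> 1} \<noteq> {}"
    by (auto intro!: exI[of _ "\<lambda>_. 0"] simp: block_vec_norm_def L2_set_def)
  fix r assume "r \<in> {block_vec_norm n (block_mult n M x) | x. block_vec_norm n x \<le> 1}"
  then obtain x where x: "r = block_vec_norm n (block_mult n M x)" "block_vec_norm n x \<le> 1" by blast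
  have "r \<le> K * block_vec_norm n x" unfolding x(1) by (rule assms(1))
  also have "\<dots> \<le> K * 1" by (intro mult_left_mono x assms(2))
  finally show "r \<le> K" by simp
qed

lemma norm_block_le_block_norm:
  assumes "j < n" "k < n" "norm v \<le> 1"
  shows "norm (M j k *v v) \<le> block_norm n M"
proof -
  let ?x = "\<lambda>i. if i = k then v else 0"
  have "norm (M j k *v v) = norm (block_mult n M ?x j)" using assms by (simp add: block_mult_single)
  also have "\<dots> \<le> block_vec_norm n (block_mult n M ?x)" by (rule norm_le_block_vec_norm[OF assms(1)])
  also have "\<dots> \<le> block_norm n M"
    by (rule block_norm_upper) (simp add: block_vec_norm_single assms)
  finally show ?thesis .
qed

lemma matrix_vector_mult_sum: "M *v (\<Sum>i\<in>I. f i) = (\<Sum>i\<in>I. M *v (f i :: complex ^ 'n))"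
  by (induction I rule: infinite_finite_induct) (simp_all add: matrix_vector_right_distrib)

lemma sum_matrix_vector_mult: "(\<Sum>i\<in>I. M i) *v x = (\<Sum>i\<in>I. M i *v (x :: complex ^ 'n))"
  by (induction I rule: infinite_finite_induct) (simp_all add: matrix_vector_mult_add_rdistrib)

lemma block_mult_block_mult:
  "block_mult n M (block_mult n B x) j = (\<Sum>k<n. (\<Sum>l<n. M j l ** B l k) *v x k)"
  unfolding block_mult_def matrix_vector_mult_sum sum_matrix_vector_mult matrix_vector_mul_assoc
  by (rule sum.swap)

text \<open>A product of block matrices is determined by its action on vectors with one nonzero block that is a
unit vector.\<close>

lemma block_product_identity_iff:
  "(\<forall>j<n. \<forall>k<n. (\<Sum>l<n. M j l ** B l k) = (if j = k then mat 1 else 0)) \<longleftrightarrow>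
   (\<forall>x. \<forall>j<n. block_mult n M (block_mult n B x) j = x j)"
proof (intro iffI allI impI)
  fix x j
  assume id: "\<forall>j<n. \<forall>k<n. (\<Sum>l<n. M j l ** B l k) = (if j = k then mat 1 else 0)" and j: "j < n"
  have "block_mult n M (block_mult n B x) j = (\<Sum>k<n. if j = k then x k else 0)"
    unfolding block_mult_block_mult using id j by (intro sum.cong) auto
  then show "block_mult n M (block_mult n B x) j = x j" using j by simp
next
  fix j k
  assume id: "\<forall>x. \<forall>j<n. block_mult n M (block_mult n B x) j = x j" and jk: "j < n" "k < n"
  have "(\<Sum>l<n. M j l ** B l k) $ r $ c = (if j = k then mat 1 else 0) $ r $ c" for r c
  proof -
    let ?x = "\<lambda>i. if i = k then axis c 1 else 0"
    have "((\<Sum>l<n. M j l ** B l k) *v axis c 1) = block_mult n M (block_mult n B ?x) j"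
      unfolding block_mult_block_mult using jk by (subst sum.remove[of _ k]) (auto intro!: sum.neutral)
    also have "\<dots> = (if j = k then axis c 1 else 0)" using id jk by auto
    finally show ?thesis
      unfolding matrix_vector_mult_axis[symmetric] by simp
  qed
  then show "(\<Sum>l<n. M j l ** B l k) = (if j = k then mat 1 else 0)" by (simp add: vec_eq_iff)
qed

lemma block_inverse_iff:
  "block_inverse n M B \<longleftrightarrow> (\<forall>x. \<forall>j<n. block_mult n M (block_mult n B x) j = x j) \<and>
     (\<forall>x. \<forall>j<n. block_mult n B (block_mult n M x) j = x j)"
  unfolding block_product_identity_iff[symmetric] block_inverse_def by blast

text \<open>The columns of the inverse are preimages of the unit vectors.  The lower bound makes the matrix
injective, which turns the right inverse into a two-sided one.\<close>

lemma block_inverse_exists: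
  assumes \<eta>: "\<eta> > 0" "\<And>x. \<eta> * block_vec_norm n x \<le> block_vec_norm n (block_mult n M x)"
    and surj: "\<And>y. \<exists>x. \<forall>j<n. block_mult n M x j = y j"
  shows "\<exists>B. block_inverse n M B"
proof -
  have "\<forall>k c. \<exists>x. \<forall>j<n. block_mult n M x j = (if j = k then axis c 1 else 0)"
    using surj by (intro allI) (rule surj)
  then obtain X where X: "\<And>k c j. j < n \<Longrightarrow> block_mult n M (X k c) j = (if j = k then axis c 1 else 0)"
    by metis
  define B where "B l k = (\<chi> i c. X k c l $ i)" for l k
  have "(\<Sum>l<n. M j l ** B l k) = (if j = k then mat 1 else 0)" if "j < n" "k < n" for j k
  proof -
    have "(\<Sum>l<n. M j l ** B l k) $ r $ c = (if j = k then mat 1 else 0) $ r $ c" for r c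
    proof -
      have col: "B l k *v axis c 1 = X k c l" for l
        by (simp add: vec_eq_iff matrix_vector_mult_axis) (simp add: B_def)
      have "(\<Sum>l<n. M j l ** B l k) *v axis c 1 = block_mult n M (X k c) j"
        by (simp add: sum_matrix_vector_mult block_mult_def matrix_vector_mul_assoc[symmetric] col)
      then show ?thesis unfolding matrix_vector_mult_axis[symmetric] using X[OF that(1)] by simp
    qed
    then show ?thesis by (simp add: vec_eq_iff)
  qed
  then have MB: "\<forall>x. \<forall>j<n. block_mult n M (block_mult n B x) j = x j"
    by (subst block_product_identity_iff[symmetric]) blast
  have "block_mult n B (block_mult n M x) j = x j" if "j < n" for x j
  proof -
    let ?d = "\<lambda>j. block_mult n B (block_mult n M x) j - x j"
    have "block_vec_norm n (block_mult n M ?d) = 0"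
      unfolding block_vec_norm_eq_0_iff block_mult_diff using MB by simp
    then have "block_vec_norm n ?d = 0"
      using \<eta>(2)[of ?d] \<eta>(1) block_vec_norm_nonneg[of n ?d]
      by (metis mult_le_0_iff order_antisym order_less_le_trans less_irrefl)
    then show ?thesis using that by (simp add: block_vec_norm_eq_0_iff)
  qed
  with MB have "block_inverse n M B" unfolding block_inverse_iff by blast
  then show ?thesis by blast
qed

lemma block_inverse_norm_le:
  assumes \<eta>: "\<eta> > 0" "\<And>x. \<eta> * block_vec_norm n x \<le> block_vec_norm n (block_mult n M x)"
    and B: "block_inverse n M B"
  shows "block_norm n B \<le> 1 / \<eta>"
proof (rule block_norm_le)
  fix x
  have "\<eta> * block_vec_norm n (block_mult n B x) \<le> block_vec_norm n (block_mult n M (block_mult n B x))"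
    by (rule \<eta>)
  also have "\<dots> = block_vec_norm n x"
    using B by (intro block_vec_norm_cong) (simp add: block_inverse_iff)
  finally show "block_vec_norm n (block_mult n B x) \<le> 1 / \<eta> * block_vec_norm n x"
    using \<eta>(1) by (simp add: field_simps)
qed (use \<eta> in simp)

section \<open>Toeplitz operators and sections as compressions\<close>

definition block_embed :: "nat \<Rightarrow> (nat \<Rightarrow> complex ^ 'n) \<Rightarrow> (int, complex ^ 'n) l2" where
  "block_embed n x = (\<Sum>k<n. single (int k) (x k))"

lemma coord_block_embed [simp]:
  "coord (block_embed n x) i = (if 0 \<le> i \<and> i < int n then x (nat i) else 0)"
proof -
  have "coord (block_embed n x) i = (\<Sum>k<n. coord (single (int k) (x k)) i)"
    unfolding block_embed_def by (rule linear_sum[OF bounded_linear.linear[OF bounded_linear_coord]])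
  also have "\<dots> = (if 0 \<le> i \<and> i < int n then x (nat i) else 0)"
  proof (cases "0 \<le> i \<and> i < int n")
    case True
    then show ?thesis by (subst sum.remove[of _ "nat i"]) (auto intro!: sum.neutral split: if_splits)
  qed (auto intro!: sum.neutral)
  finally show ?thesis .
qed

lemma norm_block_embed [simp]: "norm (block_embed n x) = block_vec_norm n x"
proof -
  have "(norm (block_embed n x))\<^sup>2 = (\<Sum>i\<in>int ` {..<n}. (norm (coord (block_embed n x) i))\<^sup>2)"
    unfolding norm_l2_square
  proof (rule infsumI, rule has_sum_finite_neutralI)
    show "(norm (coord (block_embed n x) i))\<^sup>2 = 0" if "i \<in> UNIV - int ` {..<n}" for i
    proof -
      have "\<not> (0 \<le> i \<and> i < int n)" using that by (auto simp: image_iff) (metis lessThan_iff nat_less_iff nat_0_le)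
      then show ?thesis by auto
    qed
  qed auto
  also have "\<dots> = (\<Sum>k<n. (norm (x k))\<^sup>2)" by (subst sum.reindex) auto
  also have "\<dots> = (block_vec_norm n x)\<^sup>2" by (simp add: block_vec_norm_def L2_set_def sum_nonneg)
  finally show ?thesis by (simp add: power2_eq_iff_nonneg)
qed

lemma cutoff_block_embed [simp]: "cutoff {0..<int n} (block_embed n x) = block_embed n x"
  by (intro l2_eqI) auto

lemma block_embed_coord: "cutoff {0..<int n} \<xi> = \<xi> \<Longrightarrow> block_embed n (\<lambda>k. coord \<xi> (int k)) = \<xi>"
proof (intro l2_eqI)
  fix i assume "cutoff {0..<int n} \<xi> = \<xi>"
  from arg_cong[OF this, of "\<lambda>z. coord z i"]
  show "coord (block_embed n (\<lambda>k. coord \<xi> (int k))) i = coord \<xi> i" by (auto split: if_splits)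
qed

lemma block_embed_mult:
  assumes "decaying a"
  shows "block_embed n (block_mult n (\<lambda>j k. a (int j - int k)) x)
    = compress {0..<int n} (laurent_op a) (block_embed n x)"
proof (rule l2_eqI)
  fix i
  show "coord (block_embed n (block_mult n (\<lambda>j k. a (int j - int k)) x)) i
    = coord (compress {0..<int n} (laurent_op a) (block_embed n x)) i"
  proof (cases "0 \<le> i \<and> i < int n")
    case True
    have "((\<lambda>k. a (i - k) *v coord (block_embed n x) k) has_sum
        (\<Sum>k\<in>int ` {..<n}. a (i - k) *v coord (block_embed n x) k)) UNIV"
    proof (rule has_sum_finite_neutralI)
      show "a (i - k) *v coord (block_embed n x) k = 0" if "k \<in> UNIV - int ` {..<n}" for k
      proof -
        have "\<not> (0 \<le> k \<and> k < int n)" using that by (auto simp: image_iff) (metis lessThan_iff nat_less_iff nat_0_le)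
        then show ?thesis by auto
      qed
    qed auto
    from has_sum_unique[OF coord_laurent_op[OF assms] this]
    have "coord (laurent_op a (block_embed n x)) i = (\<Sum>k<n. a (i - int k) *v x k)"
      by (simp add: sum.reindex)
    with True show ?thesis by (simp add: compress_def block_mult_def)
  qed (auto simp: compress_def)
qed

definition half_line_embed :: "(nat \<Rightarrow> complex ^ 'n) \<Rightarrow> (int, complex ^ 'n) l2" where
  "half_line_embed x = Abs_l2 (\<lambda>i. if 0 \<le> i then x (nat i) else 0)"

lemma has_sum_half_line:
  fixes f :: "nat \<Rightarrow> 'a::real_normed_vector"
  shows "((\<lambda>i. if 0 \<le> i then f (nat i) else 0) has_sum S) (UNIV :: int set) \<longleftrightarrow> (f has_sum S) UNIV"
proof -
  have "((\<lambda>i. if 0 \<le> i then f (nat i) else 0) has_sum S) (UNIV :: int set) \<longleftrightarrow>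
      ((\<lambda>i. f (nat i)) has_sum S) {0..}"
    by (rule has_sum_cong_neutral) auto
  also have "\<dots> \<longleftrightarrow> (f has_sum S) UNIV"
    by (rule has_sum_reindex_bij_witness[of "{0..}" int nat UNIV]) auto
  finally show ?thesis .
qed

lemma coord_half_line_embed:
  assumes "x \<in> ell2"
  shows "coord (half_line_embed x) i = (if 0 \<le> i then x (nat i) else 0)"
    and "norm (half_line_embed x) = ell2_norm x"
proof -
  have "((\<lambda>j. (norm (x j))\<^sup>2) has_sum (\<Sum>j. (norm (x j))\<^sup>2)) UNIV"
    using assms by (intro sums_nonneg_imp_has_sum summable_sums) (auto simp: ell2_def)
  then have *: "((\<lambda>i::int. if 0 \<le> i then (norm (x (nat i)))\<^sup>2 else 0) has_sum (\<Sum>j. (norm (x j))\<^sup>2)) UNIV"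
    by (rule has_sum_half_line[of "\<lambda>j. (norm (x j))\<^sup>2", THEN iffD2])
  have "(\<lambda>i::int. if 0 \<le> i then (norm (x (nat i)))\<^sup>2 else 0)
      = (\<lambda>i. (norm (if 0 \<le> i then x (nat i) else 0))\<^sup>2)" by auto
  note * = *[unfolded this]
  then show c: "coord (half_line_embed x) i = (if 0 \<le> i then x (nat i) else 0)" for i
    unfolding half_line_embed_def by (subst Abs_l2_inverse) (auto dest: has_sum_imp_summable)
  have "(norm (half_line_embed x))\<^sup>2 = (\<Sum>j. (norm (x j))\<^sup>2)"
    unfolding norm_l2_square c using * by (rule infsumI)
  then show "norm (half_line_embed x) = ell2_norm x"
    unfolding ell2_norm_def by (metis norm_ge_zero real_sqrt_unique)
qed

lemma coord_in_ell2: "(\<lambda>j. coord \<xi> (int j)) \<in> ell2"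
  and half_line_embed_coord: "half_line_embed (\<lambda>j. coord \<xi> (int j)) = cutoff {0..} \<xi>"
proof -
  have "(\<lambda>i. if 0 \<le> i then (norm (coord \<xi> (int (nat i))))\<^sup>2 else 0) = (\<lambda>i. (norm (coord (cutoff {0..} \<xi>) i))\<^sup>2)"
    by (auto simp: fun_eq_iff)
  then have "((\<lambda>j. (norm (coord \<xi> (int j)))\<^sup>2) has_sum (norm (cutoff {0..} \<xi>))\<^sup>2) UNIV"
    using has_sum_infsum[OF summable_norm_coord[of "cutoff {0..} \<xi>"]]
    unfolding has_sum_half_line[symmetric] norm_l2_square by simp
  then show e: "(\<lambda>j. coord \<xi> (int j)) \<in> ell2"
    unfolding ell2_def by (auto dest!: has_sum_imp_sums sums_summable)
  show "half_line_embed (\<lambda>j. coord \<xi> (int j)) = cutoff {0..} \<xi>"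
    by (intro l2_eqI) (simp add: coord_half_line_embed[OF e])
qed

lemma cutoff_half_line_embed: "x \<in> ell2 \<Longrightarrow> cutoff {0..} (half_line_embed x) = half_line_embed x"
  by (intro l2_eqI) (simp add: coord_half_line_embed)

lemma toeplitz_operator_eq:
  assumes a: "decaying (fourier_coeff A)" and x: "x \<in> ell2"
  shows "toeplitz_operator A x = (\<lambda>j. coord (laurent_op (fourier_coeff A) (half_line_embed x)) (int j))"
proof
  fix j
  have "(\<lambda>k. fourier_coeff A (int j - k) *v coord (half_line_embed x) k)
      = (\<lambda>k. if 0 \<le> k then fourier_coeff A (int j - int (nat k)) *v x (nat k) else 0)"
    by (auto simp: coord_half_line_embed[OF x])
  note coord_laurent_op[OF a, of "int j" "half_line_embed x", unfolded this]
  then have "((\<lambda>k. fourier_coeff A (int j - int k) *v x k) has_sum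
      coord (laurent_op (fourier_coeff A) (half_line_embed x)) (int j)) UNIV"
    by (rule has_sum_half_line[of "\<lambda>k. fourier_coeff A (int j - int k) *v x k", THEN iffD1])
  then show "toeplitz_operator A x j = coord (laurent_op (fourier_coeff A) (half_line_embed x)) (int j)"
    unfolding toeplitz_operator_def toeplitz_array_def
    by (intro sums_unique[symmetric] has_sum_imp_sums)
qed

lemma toeplitz_operator_in_ell2:
  assumes "decaying (fourier_coeff A)" "x \<in> ell2"
  shows "toeplitz_operator A x \<in> ell2"
  unfolding toeplitz_operator_eq[OF assms] by (rule coord_in_ell2)

lemma half_line_embed_toeplitz:
  assumes "decaying (fourier_coeff A)" "x \<in> ell2"
  shows "half_line_embed (toeplitz_operator A x) = compress {0..} (laurent_op (fourier_coeff A)) (half_line_embed x)"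
  unfolding toeplitz_operator_eq[OF assms] half_line_embed_coord compress_def
  by (simp add: cutoff_half_line_embed[OF assms(2)])

lemma half_line_embed_inj: "x \<in> ell2 \<Longrightarrow> y \<in> ell2 \<Longrightarrow> half_line_embed x = half_line_embed y \<Longrightarrow> x = y"
proof
  fix j assume x: "x \<in> ell2" and y: "y \<in> ell2" and "half_line_embed x = half_line_embed y"
  from arg_cong[OF this(3), of "\<lambda>z. coord z (int j)"]
  show "x j = y j" by (simp add: coord_half_line_embed[OF x] coord_half_line_embed[OF y])
qed

lemma norm_scalar_mult: "norm (c *s v) = norm c * norm (v :: complex ^ 'n)"
  by (simp add: norm_vec_def norm_mult L2_set_right_distrib)

lemma ell2_add: "x \<in> ell2 \<Longrightarrow> y \<in> ell2 \<Longrightarrow> (\<lambda>j. x j + y j) \<in> ell2"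
  and half_line_embed_add: "x \<in> ell2 \<Longrightarrow> y \<in> ell2 \<Longrightarrow>
    half_line_embed (\<lambda>j. x j + y j) = half_line_embed x + half_line_embed y"
proof -
  assume x: "x \<in> ell2" and y: "y \<in> ell2"
  have *: "(\<lambda>j. x j + y j) = (\<lambda>j. coord (half_line_embed x + half_line_embed y) (int j))"
    by (simp add: coord_half_line_embed[OF x] coord_half_line_embed[OF y])
  show "(\<lambda>j. x j + y j) \<in> ell2" unfolding * by (rule coord_in_ell2)
  show "half_line_embed (\<lambda>j. x j + y j) = half_line_embed x + half_line_embed y"
    unfolding * half_line_embed_coord
    by (intro l2_eqI) (simp add: coord_half_line_embed[OF x] coord_half_line_embed[OF y])
qed

lemma ell2_scale:
  assumes "x \<in> ell2"
  shows "(\<lambda>j. c *s x j) \<in> ell2" "ell2_norm (\<lambda>j. c *s x j) = norm c * ell2_norm x"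
  using assms summable_mult[of "\<lambda>j. (norm (x j))\<^sup>2" "(norm c)\<^sup>2"] suminf_mult[of "\<lambda>j. (norm (x j))\<^sup>2" "(norm c)\<^sup>2"]
  by (auto simp: ell2_def ell2_norm_def norm_scalar_mult power_mult_distrib real_sqrt_mult)

lemma bounded_linear_scalar_mult: "bounded_linear (\<lambda>v :: complex ^ 'n. c *s v)"
  by (rule bounded_linear_intro[where K = "norm c"])
    (auto simp: norm_scalar_mult vec_eq_iff algebra_simps)

lemma bounded_operator_toeplitz:
  assumes a: "decaying (fourier_coeff A)"
  shows "bounded_operator_ell2 (toeplitz_operator A)"
  unfolding bounded_operator_ell2_def
proof (intro conjI ballI allI)
  let ?L = "laurent_op (fourier_coeff A)"
  note L = bounded_linear_laurent_op[OF a]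
  show "toeplitz_operator A x \<in> ell2" if "x \<in> ell2" for x
    by (rule toeplitz_operator_in_ell2[OF a that])
  show "toeplitz_operator A (\<lambda>j. x j + y j) = (\<lambda>j. toeplitz_operator A x j + toeplitz_operator A y j)"
    if "x \<in> ell2" "y \<in> ell2" for x y
    using that by (simp add: toeplitz_operator_eq[OF a] ell2_add half_line_embed_add bl_add[OF L])
  show "toeplitz_operator A (\<lambda>j. c *s x j) = (\<lambda>j. c *s toeplitz_operator A x j)" if x: "x \<in> ell2" for c x
  proof
    fix j
    have "((\<lambda>k. c *s (fourier_coeff A (int j - k) *v coord (half_line_embed x) k)) has_sum
        c *s coord (?L (half_line_embed x)) (int j)) UNIV"
      by (rule has_sum_bounded_linear[OF bounded_linear_scalar_mult coord_laurent_op[OF a]])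
    moreover have "coord (half_line_embed (\<lambda>j. c *s x j)) k = c *s coord (half_line_embed x) k" for k
      by (simp add: coord_half_line_embed[OF x] coord_half_line_embed[OF ell2_scale(1)[OF x]])
    ultimately have "c *s coord (?L (half_line_embed x)) (int j)
        = coord (?L (half_line_embed (\<lambda>j. c *s x j))) (int j)"
      using has_sum_unique[OF coord_laurent_op[OF a, of "int j" "half_line_embed (\<lambda>j. c *s x j)"]]
      by (simp add: vector_scalar_commute)
    then show "toeplitz_operator A (\<lambda>j. c *s x j) j = c *s toeplitz_operator A x j"
      by (simp add: toeplitz_operator_eq[OF a] x ell2_scale(1))
  qed
  obtain K where K: "\<And>x. norm (?L x) \<le> norm x * K"
    using bounded_linear.nonneg_bounded[OF L] by blast
  show "\<exists>K. \<forall>x\<in>ell2. ell2_norm (toeplitz_operator A x) \<le> K * ell2_norm x"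
  proof (intro exI[of _ K] ballI)
    fix x :: "nat \<Rightarrow> complex ^ 'a" assume x: "x \<in> ell2"
    have "ell2_norm (toeplitz_operator A x) = norm (compress {0..} ?L (half_line_embed x))"
      by (simp add: coord_half_line_embed(2)[symmetric] half_line_embed_toeplitz a x toeplitz_operator_in_ell2)
    also have "\<dots> \<le> norm (half_line_embed x) * K"
      unfolding compress_def cutoff_half_line_embed[OF x] by (intro order_trans[OF norm_cutoff_le] K)
    finally show "ell2_norm (toeplitz_operator A x) \<le> K * ell2_norm x"
      by (simp add: coord_half_line_embed(2)[OF x] mult.commute)
  qed
qed

lemma ell2_norm_nonneg: "x \<in> ell2 \<Longrightarrow> 0 \<le> ell2_norm x"
  by (simp add: coord_half_line_embed(2)[symmetric])

text \<open>The set-theoretic inverse inherits additivity and complex homogeneity from \<open>S\<close> by injectivity.\<close>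

lemma bounded_below_surj_imp_invertible:
  assumes S: "bounded_operator_ell2 S"
    and \<delta>: "\<delta> > 0" "\<And>x. x \<in> ell2 \<Longrightarrow> \<delta> * ell2_norm x \<le> ell2_norm (S x)"
    and surj: "\<And>y. y \<in> ell2 \<Longrightarrow> \<exists>x\<in>ell2. S x = y"
  shows "invertible_operator_ell2 S"
proof -
  have S_ell2: "\<And>x. x \<in> ell2 \<Longrightarrow> S x \<in> ell2"
    and S_add: "\<And>x y. x \<in> ell2 \<Longrightarrow> y \<in> ell2 \<Longrightarrow> S (\<lambda>j. x j + y j) = (\<lambda>j. S x j + S y j)"
    and S_scale: "\<And>c x. x \<in> ell2 \<Longrightarrow> S (\<lambda>j. c *s x j) = (\<lambda>j. c *s S x j)"
    using S unfolding bounded_operator_ell2_def by blast+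
  have inj: "x = y" if x: "x \<in> ell2" and y: "y \<in> ell2" and eq: "S x = S y" for x y
  proof -
    let ?d = "\<lambda>j. x j + (- 1) *s y j"
    have d: "?d \<in> ell2" by (intro ell2_add ell2_scale x y)
    have "S ?d = (\<lambda>j. 0)"
      using eq by (simp only: S_add[OF x ell2_scale(1)[OF y]] S_scale[OF y]) (simp add: vec_eq_iff)
    then have "\<delta> * ell2_norm ?d \<le> 0" using \<delta>(2)[OF d] by (simp add: ell2_norm_def)
    then have "ell2_norm ?d = 0"
      using \<delta>(1) ell2_norm_nonneg[OF d] by (simp add: mult_le_0_iff)
    then have "half_line_embed ?d = 0" using coord_half_line_embed(2)[OF d] by simp
    show ?thesis
    proof
      fix j
      from arg_cong[OF \<open>half_line_embed ?d = 0\<close>, of "\<lambda>z. coord z (int j)"]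
      have "x j + (- 1) *s y j = 0" unfolding coord_half_line_embed(1)[OF d] by simp
      then show "x j = y j" by (simp add: vec_eq_iff)
    qed
  qed
  define R where "R y = (SOME x. x \<in> ell2 \<and> S x = y)" for y
  have R: "R y \<in> ell2" "S (R y) = y" if "y \<in> ell2" for y
    using someI_ex[of "\<lambda>x. x \<in> ell2 \<and> S x = y"] surj[OF that] by (auto simp: R_def)
  have "bounded_operator_ell2 R"
    unfolding bounded_operator_ell2_def
  proof (intro conjI ballI allI)
    show "R y \<in> ell2" if "y \<in> ell2" for y by (rule R[OF that])
    show "R (\<lambda>j. x j + y j) = (\<lambda>j. R x j + R y j)" if "x \<in> ell2" "y \<in> ell2" for x y
      by (rule inj) (simp_all add: R ell2_add that S_add)
    show "R (\<lambda>j. c *s x j) = (\<lambda>j. c *s R x j)" if "x \<in> ell2" for c x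
      by (rule inj) (simp_all add: R ell2_scale that S_scale)
    show "\<exists>K. \<forall>x\<in>ell2. ell2_norm (R x) \<le> K * ell2_norm x"
    proof (intro exI[of _ "1 / \<delta>"] ballI)
      show "ell2_norm (R x) \<le> 1 / \<delta> * ell2_norm x" if "x \<in> ell2" for x
        using \<delta>(2)[OF R(1)[OF that]] \<delta>(1) by (simp add: R(2)[OF that] field_simps)
    qed
  qed
  moreover have "R (S x) = x \<and> S (R x) = x" if "x \<in> ell2" for x
    using inj[of "R (S x)" x] R that S_ell2 by blast
  ultimately show ?thesis unfolding invertible_operator_ell2_def using S by blast
qed

section \<open>Mutually inverse symbols\<close>

lemma inner_laurent_op_right:
  "decaying a \<Longrightarrow> inner x (laurent_op a y) = inner (laurent_op (adjoint_coeff a) x) y"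
  by (metis inner_laurent_op inner_commute)

lemma inner_compress_laurent_op:
  assumes "decaying a"
  shows "inner x (compress S (laurent_op a) y) = inner (compress S (laurent_op (adjoint_coeff a)) x) y"
proof -
  have "inner x (compress S (laurent_op a) y) = inner (cutoff S x) (laurent_op a (cutoff S y))"
    by (simp only: compress_def inner_cutoff)
  also have "\<dots> = inner (laurent_op (adjoint_coeff a) (cutoff S x)) (cutoff S y)"
    by (rule inner_laurent_op_right[OF assms])
  also have "\<dots> = inner (compress S (laurent_op (adjoint_coeff a)) x) y"
    by (simp only: compress_def inner_cutoff)
  finally show ?thesis .
qed

text \<open>Both products are recorded, because passing to adjoints reverses the order of the factors.\<close>

definition inverse_symbols :: "(int \<Rightarrow> complex ^ 'n ^ 'n) \<Rightarrow> (int \<Rightarrow> complex ^ 'n ^ 'n) \<Rightarrow> bool" where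
  "inverse_symbols a b \<longleftrightarrow> decaying a \<and> decaying b \<and>
     (\<forall>x. laurent_op b (laurent_op a x) = x) \<and> (\<forall>x. laurent_op a (laurent_op b x) = x)"

lemma GR_inverse_symbols: "A \<in> GR \<Longrightarrow> \<exists>b. inverse_symbols (fourier_coeff A) b"
  using GR_fourier_coeff(1,3)[of A] laurent_op_inverse unfolding inverse_symbols_def by blast

lemma inverse_symbols_reflect:
  assumes "inverse_symbols a b"
  shows "inverse_symbols (\<lambda>k. a (- k)) (\<lambda>k. b (- k))"
proof -
  have d: "decaying a" "decaying b" using assms by (auto simp: inverse_symbols_def)
  have "laurent_op (\<lambda>k. c (- k)) x = flip 0 (laurent_op c (flip 0 x))" if "decaying c"
    for c :: "int \<Rightarrow> complex ^ 'a ^ 'a" and x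
    by (simp add: flip_laurent_op[OF that])
  then show ?thesis
    using assms by (simp add: inverse_symbols_def decaying_reflect)
qed

text \<open>Adjoints of mutually inverse operators are mutually inverse, which avoids computing with the
convolution of the adjoint coefficients.\<close>

lemma inverse_symbols_adjoint:
  assumes "inverse_symbols a b"
  shows "inverse_symbols (adjoint_coeff a) (adjoint_coeff b)"
proof -
  have d: "decaying a" "decaying b" using assms by (auto simp: inverse_symbols_def)
  have "inner (y - x) z = 0"
    if "y = laurent_op (adjoint_coeff b) (laurent_op (adjoint_coeff a) x)
      \<or> y = laurent_op (adjoint_coeff a) (laurent_op (adjoint_coeff b) x)" for x y z
  proof -
    have "inner z y = inner z x"
      using that assms by (auto simp: inverse_symbols_def inner_laurent_op[OF d(1), symmetric]
          inner_laurent_op[OF d(2), symmetric])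
    then show ?thesis by (simp add: inner_commute[of _ z] inner_diff_right)
  qed
  from this[of _ _ "_ - _"] show ?thesis
    by (simp add: inverse_symbols_def d decaying_adjoint_coeff) (metis eq_iff_diff_eq_0 inner_eq_zero_iff)
qed

lemma inverse_symbols_nonzero:
  assumes "inverse_symbols a b"
  shows "\<exists>k. a k \<noteq> 0"
proof (rule ccontr)
  assume "\<not> ?thesis"
  then have a: "a k = 0" for k by simp
  define x :: "(int, complex ^ 'a) l2" where "x = single 0 (axis undefined 1)"
  have "coord (laurent_op a x) j = 0" for j
    using has_sum_unique[OF coord_laurent_op[of a j x] has_sum_0] assms
    by (simp add: inverse_symbols_def a)
  then have "laurent_op a x = 0" by (intro l2_eqI) simp
  then have "laurent_op b (laurent_op a x) = 0"
    using assms bl_zero[OF bounded_linear_laurent_op, of b] by (simp add: inverse_symbols_def)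
  then have "x = 0" using assms by (simp add: inverse_symbols_def)
  then have "norm x = 0" by simp
  then show False by (simp add: x_def norm_axis_1)
qed

section \<open>Invertibility of Toeplitz operators\<close>

text \<open>If both kernels are trivial, then the compression and its adjoint are bounded below, so the
compression is injective with closed range, and onto.\<close>

lemma not_invertible_imp_kernel:
  assumes sym: "inverse_symbols (fourier_coeff A) b"
    and not_inv: "\<not> invertible_operator_ell2 (toeplitz_operator A)"
  shows "\<exists>x. cutoff {0..} x = x \<and> x \<noteq> 0 \<and>
    (compress {0..} (laurent_op (fourier_coeff A)) x = 0 \<or>
     compress {0..} (laurent_op (adjoint_coeff (fourier_coeff A))) x = 0)"
proof (rule ccontr)
  assume neg: "\<not> ?thesis"
  let ?a = "fourier_coeff A"
  note sym' = inverse_symbols_adjoint[OF sym]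
  have d: "decaying ?a" and d': "decaying (adjoint_coeff ?a)"
    using sym sym' by (auto simp: inverse_symbols_def)
  have "\<exists>\<delta>>0. \<forall>x. cutoff {0..} x = x \<longrightarrow> \<delta> * norm x \<le> norm (compress {0..} (laurent_op ?a) x)"
    by (rule half_line_bounded_below[of _ "laurent_op b"])
      (use sym neg in \<open>auto simp: inverse_symbols_def intro: localized_laurent_op\<close>)
  then obtain \<delta> where \<delta>: "\<delta> > 0"
    "\<And>x. cutoff {0..} x = x \<Longrightarrow> \<delta> * norm x \<le> norm (compress {0..} (laurent_op ?a) x)" by blast
  have "\<exists>\<delta>>0. \<forall>x. cutoff {0..} x = x \<longrightarrow>
      \<delta> * norm x \<le> norm (compress {0..} (laurent_op (adjoint_coeff ?a)) x)"
    by (rule half_line_bounded_below[of _ "laurent_op (adjoint_coeff b)"])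
      (use sym' neg in \<open>auto simp: inverse_symbols_def intro: localized_laurent_op\<close>)
  then obtain \<delta>' where \<delta>': "\<delta>' > 0" "\<And>x. cutoff {0..} x = x \<Longrightarrow>
      \<delta>' * norm x \<le> norm (compress {0..} (laurent_op (adjoint_coeff ?a)) x)" by blast
  have "invertible_operator_ell2 (toeplitz_operator A)"
  proof (rule bounded_below_surj_imp_invertible[OF bounded_operator_toeplitz[OF d] \<delta>(1)])
    show "\<delta> * ell2_norm x \<le> ell2_norm (toeplitz_operator A x)" if "x \<in> ell2" for x
      using \<delta>(2)[OF cutoff_half_line_embed[OF that]]
      by (simp add: coord_half_line_embed(2)[symmetric] half_line_embed_toeplitz[OF d] that
          toeplitz_operator_in_ell2[OF d])
    show "\<exists>x\<in>ell2. toeplitz_operator A x = y" if y: "y \<in> ell2" for y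
    proof -
      obtain \<xi> where \<xi>: "cutoff {0..} \<xi> = \<xi>" "compress {0..} (laurent_op ?a) \<xi> = half_line_embed y"
      proof (rule compress_surj[OF bounded_linear_laurent_op[OF d] bounded_linear_laurent_op[OF d'] _ \<delta>'])
        show "inner (laurent_op (adjoint_coeff ?a) x) y = inner x (laurent_op ?a y)" for x y
          by (rule inner_laurent_op_right[OF d, symmetric])
      qed (auto simp: cutoff_half_line_embed[OF y])
      let ?x = "\<lambda>j. coord \<xi> (int j)"
      have x: "?x \<in> ell2" by (rule coord_in_ell2)
      have "half_line_embed (toeplitz_operator A ?x) = half_line_embed y"
        by (simp add: half_line_embed_toeplitz[OF d x] half_line_embed_coord \<xi>)
      then have "toeplitz_operator A ?x = y"
        by (intro half_line_embed_inj toeplitz_operator_in_ell2[OF d] x y)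
      with x show ?thesis by blast
    qed
  qed
  with not_inv show False by blast
qed

text \<open>For the adjoint \<open>T'\<close> of \<open>T\<close> and the inverse \<open>R\<close> of \<open>T\<close>, the identity
\<open>\<parallel>x\<parallel>\<^sup>2 = \<langle>x, T R x\<rangle> = \<langle>T' x, R x\<rangle>\<close> bounds \<open>\<parallel>x\<parallel>\<close> by \<open>\<parallel>R\<parallel> \<parallel>T' x\<parallel>\<close>.\<close>

lemma invertible_imp_bounded_below:
  assumes d: "decaying (fourier_coeff A)"
    and inv: "invertible_operator_ell2 (toeplitz_operator A)"
  shows "\<exists>\<delta>>0. \<forall>x. cutoff {0..} x = x \<longrightarrow>
    \<delta> * norm x \<le> norm (compress {0..} (laurent_op (fourier_coeff A)) x) \<and>
    \<delta> * norm x \<le> norm (compress {0..} (laurent_op (adjoint_coeff (fourier_coeff A))) x)"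
proof -
  let ?a = "fourier_coeff A" and ?T = "toeplitz_operator A"
  obtain R where R: "bounded_operator_ell2 R" "\<And>x. x \<in> ell2 \<Longrightarrow> R (?T x) = x" "\<And>x. x \<in> ell2 \<Longrightarrow> ?T (R x) = x"
    using inv unfolding invertible_operator_ell2_def by blast
  then obtain K0 where K0: "\<And>x. x \<in> ell2 \<Longrightarrow> ell2_norm (R x) \<le> K0 * ell2_norm x"
    and R_ell2: "\<And>x. x \<in> ell2 \<Longrightarrow> R x \<in> ell2"
    unfolding bounded_operator_ell2_def by blast
  define K where "K = max K0 1"
  have K: "K > 0" "ell2_norm (R x) \<le> K * ell2_norm x" if "x \<in> ell2" for x :: "nat \<Rightarrow> complex ^ 'a"
    using order_trans[OF K0[OF that] mult_right_mono[OF _ ell2_norm_nonneg[OF that], of K0 K]]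
    by (auto simp: K_def)
  have "(\<lambda>_. 0) \<in> (ell2 :: (nat \<Rightarrow> complex ^ 'a) set)" by (simp add: ell2_def)
  from K(1)[OF this] have "K > 0" .
  show ?thesis
  proof (intro exI[of _ "1 / K"] conjI allI impI)
    fix \<xi> :: "(int, complex ^ 'a) l2" assume \<xi>: "cutoff {0..} \<xi> = \<xi>"
    define x where "x = (\<lambda>j. coord \<xi> (int j))"
    have x: "x \<in> ell2" unfolding x_def by (rule coord_in_ell2)
    have emb: "half_line_embed x = \<xi>" unfolding x_def by (simp add: half_line_embed_coord \<xi>)
    have norm_x: "ell2_norm x = norm \<xi>" by (simp add: coord_half_line_embed(2)[OF x, symmetric] emb)
    have Tx: "?T x \<in> ell2" by (rule toeplitz_operator_in_ell2[OF d x])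
    have "norm \<xi> = ell2_norm (R (?T x))" by (simp add: R(2)[OF x] norm_x)
    also have "\<dots> \<le> K * ell2_norm (?T x)" by (rule K(2)[OF Tx])
    also have "ell2_norm (?T x) = norm (compress {0..} (laurent_op ?a) \<xi>)"
      by (simp add: coord_half_line_embed(2)[OF Tx, symmetric] half_line_embed_toeplitz[OF d x] emb)
    finally show "1 / K * norm \<xi> \<le> norm (compress {0..} (laurent_op ?a) \<xi>)"
      using \<open>K > 0\<close> by (simp add: field_simps)
    let ?c = "compress {0..} (laurent_op (adjoint_coeff ?a)) \<xi>"
    have "\<xi> = compress {0..} (laurent_op ?a) (half_line_embed (R x))"
      by (simp add: half_line_embed_toeplitz[OF d R_ell2[OF x], symmetric] R(3)[OF x] emb)
    then have "inner \<xi> \<xi> = inner \<xi> (compress {0..} (laurent_op ?a) (half_line_embed (R x)))" by simp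
    also have "\<dots> = inner ?c (half_line_embed (R x))"
      by (rule inner_compress_laurent_op[OF d])
    also have "\<dots> \<le> norm ?c * norm (half_line_embed (R x))" by (rule norm_cauchy_schwarz)
    also have "\<dots> \<le> norm ?c * (K * norm \<xi>)"
      using K(2)[OF x] by (intro mult_left_mono)
        (simp_all add: coord_half_line_embed(2)[OF R_ell2[OF x]] norm_x)
    finally have "norm \<xi> * norm \<xi> \<le> K * norm ?c * norm \<xi>"
      by (simp add: power2_norm_eq_inner[symmetric] power2_eq_square mult_ac)
    then have "norm \<xi> \<le> K * norm ?c"
      using \<open>K > 0\<close> by (cases "norm \<xi> = 0") (auto simp: mult_le_cancel_right)
    then show "1 / K * norm \<xi> \<le> norm ?c" using \<open>K > 0\<close> by (simp add: field_simps)
  qed (use \<open>K > 0\<close> in simp)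
qed

section \<open>Exponential growth of the condition numbers\<close>

lemma toeplitz_array_alt: "toeplitz_array A = (\<lambda>j k. fourier_coeff A (int j - int k))"
  by (simp add: toeplitz_array_def fun_eq_iff)

text \<open>A vector that is shrunk by the factor \<open>\<epsilon>\<close> forces the inverse to have norm at least \<open>1 / \<epsilon>\<close>.  If the
adjoint shrinks \<open>\<xi>\<close>, the same follows from \<open>\<parallel>\<xi>\<parallel>\<^sup>2 = \<langle>\<xi>, T (B \<xi>)\<rangle>\<close> by moving \<open>T\<close> to the left.\<close>

lemma inverse_norm_lower_bound:
  assumes d: "decaying (fourier_coeff A)" and B: "block_inverse n (toeplitz_array A) B"
    and \<xi>: "cutoff {0..<int n} \<xi> = \<xi>" "\<xi> \<noteq> 0"
    and small: "norm (compress {0..<int n} (laurent_op (fourier_coeff A)) \<xi>) \<le> \<epsilon> * norm \<xi> \<or>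
      norm (compress {0..<int n} (laurent_op (adjoint_coeff (fourier_coeff A))) \<xi>) \<le> \<epsilon> * norm \<xi>"
  shows "1 \<le> \<epsilon> * block_norm n B"
proof -
  let ?M = "toeplitz_array A"
  note embed = block_embed_mult[OF d, folded toeplitz_array_alt]
  define x where "x = (\<lambda>k. coord \<xi> (int k))"
  have x: "block_embed n x = \<xi>" unfolding x_def by (rule block_embed_coord[OF \<xi>(1)])
  have pos: "norm \<xi> > 0" using \<xi>(2) by simp
  have norm_x: "block_vec_norm n x = norm \<xi>" by (metis norm_block_embed x)
  from small have "norm \<xi> * norm \<xi> \<le> \<epsilon> * block_norm n B * (norm \<xi> * norm \<xi>)"
  proof
    assume s: "norm (compress {0..<int n} (laurent_op (fourier_coeff A)) \<xi>) \<le> \<epsilon> * norm \<xi>"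
    have "norm \<xi> = block_vec_norm n (block_mult n B (block_mult n ?M x))"
      unfolding norm_x[symmetric] using B by (intro block_vec_norm_cong) (simp add: block_inverse_iff)
    also have "\<dots> \<le> block_norm n B * block_vec_norm n (block_mult n ?M x)"
      by (rule block_vec_norm_mult_le)
    also have "block_vec_norm n (block_mult n ?M x) = norm (compress {0..<int n} (laurent_op (fourier_coeff A)) \<xi>)"
      by (simp add: norm_block_embed[symmetric] embed x del: norm_block_embed)
    also have "block_norm n B * \<dots> \<le> block_norm n B * (\<epsilon> * norm \<xi>)"
      by (intro mult_left_mono s block_norm_nonneg)
    finally show ?thesis using pos by (simp add: mult_ac)
  next
    let ?c = "compress {0..<int n} (laurent_op (adjoint_coeff (fourier_coeff A))) \<xi>"
    let ?z = "block_embed n (block_mult n B x)"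
    assume s: "norm ?c \<le> \<epsilon> * norm \<xi>"
    have "compress {0..<int n} (laurent_op (fourier_coeff A)) ?z = block_embed n (block_mult n ?M (block_mult n B x))"
      by (simp add: embed)
    also have "\<dots> = \<xi>"
      unfolding x[symmetric] using B by (intro l2_eqI) (auto simp: block_inverse_iff)
    finally have "inner \<xi> \<xi> = inner \<xi> (compress {0..<int n} (laurent_op (fourier_coeff A)) ?z)" by simp
    also have "\<dots> = inner ?c ?z"
      by (rule inner_compress_laurent_op[OF d])
    also have "\<dots> \<le> norm ?c * norm ?z" by (rule norm_cauchy_schwarz)
    also have "\<dots> \<le> (\<epsilon> * norm \<xi>) * (block_norm n B * norm \<xi>)"
      using s block_vec_norm_mult_le[of n B x] by (intro mult_mono) (auto simp: norm_x order_trans[OF norm_ge_zero])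
    finally show ?thesis by (simp add: power2_norm_eq_inner[symmetric] power2_eq_square mult_ac)
  qed
  then show ?thesis using pos by (simp add: mult_le_cancel_right1)
qed

lemma one_le_block_norm_mult_inverse:
  assumes "block_inverse n M B" "n \<ge> 1"
  shows "1 \<le> block_norm n M * block_norm n B"
proof -
  define x :: "nat \<Rightarrow> complex ^ 'a" where "x = (\<lambda>i. if i = 0 then axis undefined 1 else 0)"
  have x: "block_vec_norm n x = 1"
    unfolding x_def using assms(2) by (subst block_vec_norm_single) (auto simp: norm_axis_1)
  have "1 = block_vec_norm n (block_mult n M (block_mult n B x))"
    unfolding x[symmetric] using assms(1) by (intro block_vec_norm_cong) (simp add: block_inverse_iff)
  also have "\<dots> \<le> block_norm n M * (block_norm n B * block_vec_norm n x)"
    by (intro order_trans[OF block_vec_norm_mult_le] mult_left_mono block_vec_norm_mult_le block_norm_nonneg)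
  finally show ?thesis by (simp add: x)
qed

text \<open>Some Fourier coefficient is nonzero, and it is a block of every sufficiently large section.\<close>

lemma section_norms_bounded_away_from_zero:
  assumes "inverse_symbols (fourier_coeff A) b"
  shows "\<exists>m>0. \<exists>n1. \<forall>n\<ge>n1. m \<le> block_norm n (toeplitz_array A)"
proof -
  obtain k where "fourier_coeff A k \<noteq> 0" using inverse_symbols_nonzero[OF assms] by blast
  then obtain r c where "fourier_coeff A k $ r $ c \<noteq> 0" by (auto simp: vec_eq_iff)
  then have "fourier_coeff A k *v axis c 1 \<noteq> 0"
    by (metis matrix_vector_mult_axis zero_index)
  moreover have "norm (fourier_coeff A k *v axis c 1) \<le> block_norm n (toeplitz_array A)"
    if "n \<ge> nat \<bar>k\<bar> + 1" for n
  proof -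
    have "norm (toeplitz_array A (nat k) (nat (- k)) *v axis c 1) \<le> block_norm n (toeplitz_array A)"
      using that by (intro norm_block_le_block_norm) (auto simp: norm_axis_1)
    moreover have "int (nat k) - int (nat (- k)) = k" by simp
    ultimately show ?thesis by (simp add: toeplitz_array_def)
  qed
  ultimately show ?thesis by (intro exI[of _ "norm (fourier_coeff A k *v axis c 1)"]) auto
qed

text \<open>The least singular value of the \<open>n\<close>-th section is \<open>O(s^n)\<close>, witnessed by a vector.\<close>

definition sections_exp_small :: "(int \<Rightarrow> complex ^ 'n ^ 'n) \<Rightarrow> bool" where
  "sections_exp_small a \<longleftrightarrow> (\<exists>D>0. \<exists>s>0. s < 1 \<and> (\<exists>n0. \<forall>n\<ge>n0.
     \<exists>\<xi>. cutoff {0..<int n} \<xi> = \<xi> \<and> \<xi> \<noteq> 0 \<and>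
       norm (compress {0..<int n} (laurent_op a) \<xi>) \<le> D * s ^ n * norm \<xi>))"

text \<open>For large \<open>n\<close> the norms of the sections stay away from zero while those of the inverses grow like
\<open>s^(-n)\<close>.  For the remaining \<open>n\<close> the condition number is at least 1, so a small \<open>c\<close> suffices.\<close>

lemma sections_exp_small_imp_cond_growth:
  assumes sym: "inverse_symbols (fourier_coeff A) b"
    and small: "sections_exp_small a" "a = fourier_coeff A \<or> a = adjoint_coeff (fourier_coeff A)"
  shows "\<exists>c>0. \<exists>\<alpha>>0. \<forall>n\<ge>1. ereal (c * exp (\<alpha> * real n)) \<le> toeplitz_cond A n"
proof -
  have d: "decaying (fourier_coeff A)" using sym by (simp add: inverse_symbols_def)
  obtain D s n0 where D: "D > 0" and s: "0 < s" "s < 1"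
    and sm: "\<And>n. n \<ge> n0 \<Longrightarrow> \<exists>\<xi>. cutoff {0..<int n} \<xi> = \<xi> \<and> \<xi> \<noteq> 0 \<and>
      norm (compress {0..<int n} (laurent_op a) \<xi>) \<le> D * s ^ n * norm \<xi>"
    using small(1) unfolding sections_exp_small_def by blast
  obtain m n1 where m: "m > 0" "\<And>n. n \<ge> n1 \<Longrightarrow> m \<le> block_norm n (toeplitz_array A)"
    using section_norms_bounded_away_from_zero[OF sym] by blast
  define N where "N = max n0 n1"
  \<comment> \<open>The first bound serves \<open>n \<ge> N\<close>, the second one makes \<open>c / s ^ n \<le> 1\<close> for \<open>n < N\<close>.\<close>
  define c where "c = min (m / D) (s ^ N)"
  have "c > 0" using m D s by (simp add: c_def)
  have exp_eq: "exp (- ln s * real n) = 1 / s ^ n" for n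
  proof -
    have "exp (- ln s * real n) = exp (- ln s) ^ n" by (rule exp_of_nat2_mult)
    also have "\<dots> = 1 / s ^ n" using s by (simp add: exp_minus power_inverse divide_simps)
    finally show ?thesis .
  qed
  have "ereal (c * exp (- ln s * real n)) \<le> toeplitz_cond A n" if "n \<ge> 1" for n
  proof (cases "\<exists>B. block_inverse n (toeplitz_array A) B")
    case True
    define B where "B = (SOME B. block_inverse n (toeplitz_array A) B)"
    have B: "block_inverse n (toeplitz_array A) B" unfolding B_def using True by (rule someI_ex)
    have "c * (1 / s ^ n) \<le> block_norm n (toeplitz_array A) * block_norm n B"
    proof (cases "n \<ge> N")
      case True
      then obtain \<xi> where \<xi>: "cutoff {0..<int n} \<xi> = \<xi>" "\<xi> \<noteq> 0"
        "norm (compress {0..<int n} (laurent_op (fourier_coeff A)) \<xi>) \<le> D * s ^ n * norm \<xi> \<or>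
         norm (compress {0..<int n} (laurent_op (adjoint_coeff (fourier_coeff A))) \<xi>) \<le> D * s ^ n * norm \<xi>"
        using sm[of n] small(2) by (auto simp: N_def)
      have "1 / (D * s ^ n) \<le> block_norm n B"
        using inverse_norm_lower_bound[OF d B \<xi>] D s by (simp add: field_simps)
      then have "m * (1 / (D * s ^ n)) \<le> block_norm n (toeplitz_array A) * block_norm n B"
        using m True D s by (intro mult_mono) (auto simp: N_def block_norm_nonneg)
      moreover have "c * (1 / s ^ n) \<le> m / D * (1 / s ^ n)"
        using s by (intro mult_right_mono) (auto simp: c_def)
      moreover have "m / D * (1 / s ^ n) = m * (1 / (D * s ^ n))" by simp
      ultimately show ?thesis by linarith
    next
      case False
      have "c * (1 / s ^ n) \<le> s ^ N * (1 / s ^ n)"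
        using s by (intro mult_right_mono) (auto simp: c_def)
      also have "\<dots> \<le> 1"
        using False s power_decreasing[of n N s] by (simp add: divide_le_eq)
      also have "\<dots> \<le> block_norm n (toeplitz_array A) * block_norm n B"
        by (rule one_le_block_norm_mult_inverse[OF B that])
      finally show ?thesis .
    qed
    then show ?thesis unfolding exp_eq using True
      by (simp add: toeplitz_cond_def cond_number_def B_def[symmetric])
  qed (simp add: toeplitz_cond_def cond_number_def)
  moreover have "- ln s > 0" using s by (simp add: ln_less_zero)
  ultimately show ?thesis using \<open>c > 0\<close> by blast
qed

lemma flip_compress:
  assumes "decaying a" "\<And>j. j \<in> S' \<longleftrightarrow> n - 1 - j \<in> S"
  shows "compress S (laurent_op a) (flip n x) = flip n (compress S' (laurent_op (\<lambda>k. a (- k))) x)"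
proof -
  have "laurent_op a (flip n y) = flip n (laurent_op (\<lambda>k. a (- k)) y)" for y
    using flip_laurent_op[OF decaying_reflect[OF assms(1)], of n y] by simp
  then show ?thesis by (simp add: compress_def cutoff_flip[OF assms(2)])
qed

lemma reflected_coeff:
  assumes "A \<in> GR"
  shows "fourier_coeff (reflected A) = (\<lambda>k. fourier_coeff A (- k))"
  using GR_fourier_coeff(2)[OF assms] by (simp add: fun_eq_iff)

lemma adjoint_coeff_reflect: "adjoint_coeff (\<lambda>k. a (- k)) = (\<lambda>k. adjoint_coeff a (- k))"
  by (simp add: adjoint_coeff_def fun_eq_iff)

lemma kernel_imp_sections_exp_small:
  assumes ab: "inverse_symbols a b"
    and x: "cutoff {0..} x = x" "x \<noteq> 0" "compress {0..} (laurent_op a) x = 0"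
  shows "sections_exp_small a"
  unfolding sections_exp_small_def
  by (rule kernel_vector_almost_annihilated[of _ "laurent_op b"])
    (use ab x in \<open>auto simp: inverse_symbols_def intro: localized_laurent_op\<close>)

lemma sections_exp_small_reflect:
  assumes a: "decaying a" and small: "sections_exp_small (\<lambda>k. a (- k))"
  shows "sections_exp_small a"
proof -
  obtain D s n0 where D: "D > 0" "0 < s" "s < 1" and sm: "\<And>n. n \<ge> n0 \<Longrightarrow> \<exists>\<xi>. cutoff {0..<int n} \<xi> = \<xi> \<and>
      \<xi> \<noteq> 0 \<and> norm (compress {0..<int n} (laurent_op (\<lambda>k. a (- k))) \<xi>) \<le> D * s ^ n * norm \<xi>"
    using small unfolding sections_exp_small_def by blast
  have "\<exists>\<xi>. cutoff {0..<int n} \<xi> = \<xi> \<and> \<xi> \<noteq> 0 \<and>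
      norm (compress {0..<int n} (laurent_op a) \<xi>) \<le> D * s ^ n * norm \<xi>" if "n \<ge> n0" for n
  proof -
    obtain \<xi> where \<xi>: "cutoff {0..<int n} \<xi> = \<xi>" "\<xi> \<noteq> 0"
      "norm (compress {0..<int n} (laurent_op (\<lambda>k. a (- k))) \<xi>) \<le> D * s ^ n * norm \<xi>"
      using sm[OF \<open>n \<ge> n0\<close>] by blast
    have S: "j \<in> {0..<int n} \<longleftrightarrow> int n - 1 - j \<in> {0..<int n}" for j by auto
    have "flip (int n) \<xi> \<noteq> 0" using \<xi>(2) by (metis norm_eq_zero norm_flip)
    then show ?thesis
      using \<xi> by (intro exI[of _ "flip (int n) \<xi>"])
        (simp add: flip_compress[OF a S] cutoff_flip[OF S])
  qed
  with D show ?thesis unfolding sections_exp_small_def by blast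
qed

lemma kernel_imp_cond_growth:
  assumes sym: "inverse_symbols (fourier_coeff A) b"
    and x: "cutoff {0..} x = x" "x \<noteq> 0"
      "compress {0..} (laurent_op (fourier_coeff A)) x = 0 \<or>
       compress {0..} (laurent_op (adjoint_coeff (fourier_coeff A))) x = 0 \<or>
       compress {0..} (laurent_op (\<lambda>k. fourier_coeff A (- k))) x = 0 \<or>
       compress {0..} (laurent_op (\<lambda>k. adjoint_coeff (fourier_coeff A) (- k))) x = 0"
  shows "\<exists>c>0. \<exists>\<alpha>>0. \<forall>n\<ge>1. ereal (c * exp (\<alpha> * real n)) \<le> toeplitz_cond A n"
proof -
  note sym' = inverse_symbols_adjoint[OF sym]
  have d: "decaying (fourier_coeff A)" "decaying (adjoint_coeff (fourier_coeff A))"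
    using sym sym' by (auto simp: inverse_symbols_def)
  note small = kernel_imp_sections_exp_small[OF _ x(1,2)]
  have "sections_exp_small (fourier_coeff A) \<or> sections_exp_small (adjoint_coeff (fourier_coeff A))"
    using x(3) small[OF sym] small[OF sym'] small[OF inverse_symbols_reflect[OF sym]]
      small[OF inverse_symbols_reflect[OF sym']]
      sections_exp_small_reflect[OF d(1)] sections_exp_small_reflect[OF d(2)] by blast
  then show ?thesis using sections_exp_small_imp_cond_growth[OF sym] by blast
qed

section \<open>Stability\<close>

text \<open>The lower bound on \<open>{..<n}\<close> is, after reversal, the one of the reflected symbol on \<open>{0..}\<close>, and hence
uniform in \<open>n\<close>.\<close>

lemma sections_bounded_below:
  assumes ab: "inverse_symbols a b" and \<delta>: "\<delta> > 0"
    and T: "\<And>x. cutoff {0..} x = x \<Longrightarrow> \<delta> * norm x \<le> norm (compress {0..} (laurent_op a) x)"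
    and T': "\<And>x. cutoff {0..} x = x \<Longrightarrow> \<delta> * norm x \<le> norm (compress {0..} (laurent_op (\<lambda>k. a (- k))) x)"
  shows "\<exists>\<eta>>0. \<exists>n0. \<forall>n\<ge>n0. \<forall>x. cutoff {0..<int n} x = x \<longrightarrow>
           \<eta> * norm x \<le> norm (compress {0..<int n} (laurent_op a) x)"
proof (rule finite_sections_bounded_below[OF _ _ _ \<delta> T])
  show "localized (laurent_op a)" "localized (laurent_op b)" "\<And>x. laurent_op b (laurent_op a x) = x"
    using ab by (auto simp: inverse_symbols_def intro: localized_laurent_op)
  show "\<delta> * norm x \<le> norm (compress {..<int n} (laurent_op a) x)" if x: "cutoff {..<int n} x = x" for n x
  proof -
    have S: "j \<in> {0..} \<longleftrightarrow> int n - 1 - j \<in> {..<int n}" "j \<in> {..<int n} \<longleftrightarrow> int n - 1 - j \<in> {0..}"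
      for j by auto
    have "cutoff {0..} (flip (int n) x) = flip (int n) x" by (simp add: cutoff_flip[OF S(2)] x)
    from T'[OF this] have "\<delta> * norm x \<le> norm (compress {..<int n} (laurent_op a) (flip (int n) (flip (int n) x)))"
      using ab by (subst flip_compress[OF _ S(1)]) (auto simp: inverse_symbols_def)
    then show ?thesis by simp
  qed
qed

text \<open>A section that is bounded below, together with its adjoint, is invertible, and its inverse has norm
at most \<open>1 / \<eta>\<close>.\<close>

lemma cond_bounded:
  assumes sym: "inverse_symbols (fourier_coeff A) b"
    and \<eta>: "\<eta> > 0"
      "\<And>n x. n \<ge> n0 \<Longrightarrow> cutoff {0..<int n} x = x \<Longrightarrow>
        \<eta> * norm x \<le> norm (compress {0..<int n} (laurent_op (fourier_coeff A)) x)"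
      "\<And>n x. n \<ge> n0 \<Longrightarrow> cutoff {0..<int n} x = x \<Longrightarrow>
        \<eta> * norm x \<le> norm (compress {0..<int n} (laurent_op (adjoint_coeff (fourier_coeff A))) x)"
  shows "\<exists>C::real. \<forall>n\<ge>n0. toeplitz_cond A n \<le> ereal C"
proof -
  let ?a = "fourier_coeff A" and ?M = "toeplitz_array A"
  have d: "decaying ?a" using sym by (simp add: inverse_symbols_def)
  note L = bounded_linear_laurent_op[OF d]
  note L' = bounded_linear_laurent_op[OF decaying_adjoint_coeff[OF d]]
  note embed = block_embed_mult[OF d, folded toeplitz_array_alt]
  have norm_eq: "block_vec_norm n (block_mult n ?M x) = norm (compress {0..<int n} (laurent_op ?a) (block_embed n x))"
    for n x by (simp add: norm_block_embed[symmetric] embed del: norm_block_embed)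
  obtain K where K: "K \<ge> 0" "\<And>x. norm (laurent_op ?a x) \<le> norm x * K"
    using bounded_linear.nonneg_bounded[OF L] by blast
  have "toeplitz_cond A n \<le> ereal (K * (1 / \<eta>))" if n: "n \<ge> n0" for n
  proof -
    have M: "block_norm n ?M \<le> K"
    proof (rule block_norm_le)
      show "block_vec_norm n (block_mult n ?M x) \<le> K * block_vec_norm n x" for x
        using order_trans[OF norm_cutoff_le K(2)[of "block_embed n x"]]
        by (simp add: norm_eq compress_def mult.commute)
    qed (rule K)
    have lower: "\<eta> * block_vec_norm n x \<le> block_vec_norm n (block_mult n ?M x)" for x
      using \<eta>(2)[OF n cutoff_block_embed, of x] by (simp add: norm_eq)
    have "\<exists>x. \<forall>j<n. block_mult n ?M x j = y j" for y
    proof -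
      obtain \<xi> where \<xi>: "cutoff {0..<int n} \<xi> = \<xi>" "compress {0..<int n} (laurent_op ?a) \<xi> = block_embed n y"
      proof (rule compress_surj[OF L L' _ \<eta>(1) \<eta>(3)[OF n]])
        show "inner (laurent_op (adjoint_coeff ?a) x) y = inner x (laurent_op ?a y)" for x y
          by (rule inner_laurent_op_right[OF d, symmetric])
      qed auto
      have eq: "block_embed n (block_mult n ?M (\<lambda>k. coord \<xi> (int k))) = block_embed n y"
        by (simp add: embed block_embed_coord[OF \<xi>(1)] \<xi>(2))
      have "block_mult n ?M (\<lambda>k. coord \<xi> (int k)) j = y j" if "j < n" for j
        using arg_cong[OF eq, of "\<lambda>z. coord z (int j)"] that by simp
      then show ?thesis by blast
    qed
    then have ex: "\<exists>B. block_inverse n ?M B" by (rule block_inverse_exists[OF \<eta>(1) lower])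
    have "block_norm n (SOME B. block_inverse n ?M B) \<le> 1 / \<eta>"
      by (rule block_inverse_norm_le[OF \<eta>(1) lower someI_ex[OF ex]])
    with M have "block_norm n ?M * block_norm n (SOME B. block_inverse n ?M B) \<le> K * (1 / \<eta>)"
      using K(1) by (intro mult_mono block_norm_nonneg)
    with ex show ?thesis by (simp add: toeplitz_cond_def cond_number_def)
  qed
  then show ?thesis by blast
qed

theorem theorem3p1:
  fixes A :: "complex \<Rightarrow> complex ^ 'N ^ 'N"
  assumes "A \<in> GR"
  shows "((\<exists>(C::real) n0. \<forall>n\<ge>n0. toeplitz_cond A n \<le> ereal C) \<longleftrightarrow>
            invertible_operator_ell2 (toeplitz_operator A) \<and>
            invertible_operator_ell2 (toeplitz_operator (reflected A))) \<and>
         (\<not> invertible_operator_ell2 (toeplitz_operator A) \<or>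
          \<not> invertible_operator_ell2 (toeplitz_operator (reflected A)) \<longrightarrow>
            (\<exists>c>0. \<exists>\<alpha>>0. \<forall>n\<ge>1. ereal (c * exp (\<alpha> * real n)) \<le> toeplitz_cond A n))"
proof -
  let ?a = "fourier_coeff A"
  obtain b where sym: "inverse_symbols ?a b" using GR_inverse_symbols[OF assms] by blast
  note refl = reflected_coeff[OF assms]
  have sym_refl: "inverse_symbols (fourier_coeff (reflected A)) (\<lambda>k. b (- k))"
    unfolding refl by (rule inverse_symbols_reflect[OF sym])
  have d: "decaying ?a" "decaying (fourier_coeff (reflected A))"
    using sym sym_refl by (auto simp: inverse_symbols_def)
  have growth: "\<exists>c>0. \<exists>\<alpha>>0. \<forall>n\<ge>1. ereal (c * exp (\<alpha> * real n)) \<le> toeplitz_cond A n"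
    if "\<not> invertible_operator_ell2 (toeplitz_operator A) \<or>
        \<not> invertible_operator_ell2 (toeplitz_operator (reflected A))"
    using that not_invertible_imp_kernel[OF sym] not_invertible_imp_kernel[OF sym_refl]
      kernel_imp_cond_growth[OF sym] unfolding refl adjoint_coeff_reflect by blast
  have bounded: "\<exists>(C::real) n0. \<forall>n\<ge>n0. toeplitz_cond A n \<le> ereal C"
    if inv: "invertible_operator_ell2 (toeplitz_operator A)"
      and inv': "invertible_operator_ell2 (toeplitz_operator (reflected A))"
  proof -
    obtain \<delta>1 where \<delta>1: "\<delta>1 > 0"
      "\<And>x. cutoff {0..} x = x \<Longrightarrow> \<delta>1 * norm x \<le> norm (compress {0..} (laurent_op ?a) x)"
      "\<And>x. cutoff {0..} x = x \<Longrightarrow> \<delta>1 * norm x \<le> norm (compress {0..} (laurent_op (adjoint_coeff ?a)) x)"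
      using invertible_imp_bounded_below[OF d(1) inv] by blast
    obtain \<delta>2 where \<delta>2: "\<delta>2 > 0"
      "\<And>x. cutoff {0..} x = x \<Longrightarrow> \<delta>2 * norm x \<le> norm (compress {0..} (laurent_op (\<lambda>k. ?a (- k))) x)"
      "\<And>x. cutoff {0..} x = x \<Longrightarrow>
        \<delta>2 * norm x \<le> norm (compress {0..} (laurent_op (\<lambda>k. adjoint_coeff ?a (- k))) x)"
      using invertible_imp_bounded_below[OF d(2) inv'] unfolding refl adjoint_coeff_reflect by blast
    define \<delta> where "\<delta> = min \<delta>1 \<delta>2"
    have \<delta>: "\<delta> > 0" using \<delta>1 \<delta>2 by (simp add: \<delta>_def)
    have le: "\<delta> * norm x \<le> \<delta>1 * norm x" "\<delta> * norm x \<le> \<delta>2 * norm x" for x :: "(int, complex ^ 'N) l2"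
      by (auto simp: \<delta>_def intro!: mult_right_mono)
    obtain \<eta>1 n1 where \<eta>1: "\<eta>1 > 0" "\<And>n x. n \<ge> n1 \<Longrightarrow> cutoff {0..<int n} x = x \<Longrightarrow>
        \<eta>1 * norm x \<le> norm (compress {0..<int n} (laurent_op ?a) x)"
      using sections_bounded_below[OF sym \<delta>] order_trans[OF le(1) \<delta>1(2)] order_trans[OF le(2) \<delta>2(2)] by blast
    obtain \<eta>2 n2 where \<eta>2: "\<eta>2 > 0" "\<And>n x. n \<ge> n2 \<Longrightarrow> cutoff {0..<int n} x = x \<Longrightarrow>
        \<eta>2 * norm x \<le> norm (compress {0..<int n} (laurent_op (adjoint_coeff ?a)) x)"
      using sections_bounded_below[OF inverse_symbols_adjoint[OF sym] \<delta>]
        order_trans[OF le(1) \<delta>1(3)] order_trans[OF le(2) \<delta>2(3)] by blast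
    have le': "min \<eta>1 \<eta>2 * norm x \<le> \<eta>1 * norm x" "min \<eta>1 \<eta>2 * norm x \<le> \<eta>2 * norm x"
      for x :: "(int, complex ^ 'N) l2" by (auto intro!: mult_right_mono)
    have "\<exists>C::real. \<forall>n\<ge>max n1 n2. toeplitz_cond A n \<le> ereal C"
      using \<eta>1(1) \<eta>2(1) order_trans[OF le'(1) \<eta>1(2)] order_trans[OF le'(2) \<eta>2(2)]
      by (intro cond_bounded[OF sym, of "min \<eta>1 \<eta>2"]) auto
    then show ?thesis by blast
  qed
  have "False" if bdd: "\<forall>n\<ge>n0. toeplitz_cond A n \<le> ereal C"
    and gr: "c > 0" "\<alpha> > 0" "\<forall>n\<ge>1. ereal (c * exp (\<alpha> * real n)) \<le> toeplitz_cond A n" for C n0 c \<alpha>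
  proof -
    obtain n where n: "real n > max (real n0 + 1) (C / (c * \<alpha>))" using reals_Archimedean2 by blast
    have "c * exp (\<alpha> * real n) \<le> C"
      using bdd gr(3) n order_trans[of "ereal (c * exp (\<alpha> * real n))" "toeplitz_cond A n" "ereal C"] by auto
    moreover have "c * (\<alpha> * real n) < c * exp (\<alpha> * real n)"
      using gr exp_ge_add_one_self[of "\<alpha> * real n"] by (intro mult_strict_left_mono) linarith+
    moreover have "C < c * (\<alpha> * real n)" using n gr by (simp add: field_simps)
    ultimately show False by linarith
  qed
  with growth bounded show ?thesis by blast
qed

end
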